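(* Assume that the Lévy measure $\nu$ is finite. Let $x\in\mathbb R$, let $h:\mathbb R_0\to\mathbb R$, $h\ne0$, be a bounded function in $L^2(\mathbb R_0,\nu)$, let $f:\mathbb R\to\mathbb R$ be a bounded function with two bounded derivatives and $g:\mathbb R\to\mathbb R$ a bounded function with one bounded derivative. Assume that $$|h(y)\,W(g,f)(z)|>\tfrac12\|f''\|_\infty\|h\|_\infty^2\|g\|_\infty^2\qquad\text{for all }z\in\mathbb R,\ y\in\mathbb R_0,$$ where $W(g,f)=g'f-f'g$ is the Wronskian of $g$ and $f$. Let $Z$ be the solution of $$Z_t=x+\int_0^tf(Z_s)\,ds+\int_0^t\int_{\mathbb R_0}h(y)\,g(Z_{s-})\,dN(s,y),\qquad t\in[0,T].$$ Then $Z_T$ has a density on the set $\{N^{\mathbb R_0}_T>0\}$, where $N^{\mathbb R_0}_T=N([0,T]\times\mathbb R_0)$; that is, $\mathbb P(\{Z_T\in B\}\cap\{N^{\mathbb R_0}_T>0\})=0$ for every Borel set $B\subset\mathbb R$ of zero Lebesgue measure.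
   Context: Fix $T>0$ and $\mathbb R_0=\mathbb R\setminus\{0\}$. $N$ is the jump measure on $(0,\infty)\times\mathbb R_0$ of a real Lévy process $X$ with Lévy measure $\nu$ on a complete probability space $(\Omega,\mathcal F,\mathbb P)$, i.e. $N(B)=\#\{t>0:(t,\Delta X_t)\in B\}$; it is a Poisson random measure with intensity $dt\,\nu(dx)$. *)

theory Defs
  imports "HOL-Probability.Probability"
begin

definition cadlag_on :: "real set \<Rightarrow> (real \<Rightarrow> real) \<Rightarrow> bool" where
  "cadlag_on I p \<longleftrightarrow>
     (\<forall>t\<in>I. (p \<longlongrightarrow> p t) (at t within (I \<inter> {t<..})) \<and>
            (\<exists>l. (p \<longlongrightarrow> l) (at t within (I \<inter> {..<t}))))"

definition left_limit :: "(real \<Rightarrow> real) \<Rightarrow> real \<Rightarrow> real" where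
  "left_limit p t = Lim (at_left t) p"

definition jump :: "(real \<Rightarrow> real) \<Rightarrow> real \<Rightarrow> real" where
  "jump p t = p t - left_limit p t"

text \<open>
  Processes are functions on all of \<open>real\<close>, but only their values at times \<open>t \<ge> 0\<close> matter.
\<close>

locale levy_process = prob_space M
  for M :: "'a measure" and X :: "real \<Rightarrow> 'a \<Rightarrow> real" +
  assumes random_variable_X: "\<And>t. 0 \<le> t \<Longrightarrow> random_variable borel (X t)"
    and start_zero: "AE \<omega> in M. X 0 \<omega> = 0"
    and independent_increments:
      "\<And>(n::nat) (u::nat \<Rightarrow> real). 0 \<le> u 0 \<Longrightarrow> (\<And>i. i < n \<Longrightarrow> u i < u (Suc i)) \<Longrightarrow>
         indep_vars (\<lambda>_. borel) (\<lambda>i \<omega>. X (u (Suc i)) \<omega> - X (u i) \<omega>) {..<n}"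
    and stationary_increments:
      "\<And>s t. 0 \<le> s \<Longrightarrow> 0 \<le> t \<Longrightarrow>
         distr M borel (\<lambda>\<omega>. X (s + t) \<omega> - X s \<omega>) = distr M borel (\<lambda>\<omega>. X t \<omega> - X 0 \<omega>)"
    and stochastically_continuous:
      "\<And>t \<epsilon>. 0 \<le> t \<Longrightarrow> 0 < \<epsilon> \<Longrightarrow>
         ((\<lambda>s. prob {\<omega> \<in> space M. \<epsilon> < \<bar>X s \<omega> - X t \<omega>\<bar>}) \<longlongrightarrow> 0) (at t within {0..})"
    and cadlag_paths: "AE \<omega> in M. cadlag_on {0..} (\<lambda>t. X t \<omega>)"

text \<open>
  The jump measure of a single path \<open>p\<close> on \<open>(0,\<infinity>) \<times> (\<real> - {0})\<close>; see
  \<open>emeasure_jump_measure\<close> below. The jump measure \<open>N\<close> of \<open>X\<close> is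
  \<open>N(\<omega>) = jump_measure (\<lambda>t. X t \<omega>)\<close>.
\<close>

definition jump_measure :: "(real \<Rightarrow> real) \<Rightarrow> (real \<times> real) measure" where
  "jump_measure p =
     distr (count_space {t. 0 < t \<and> jump p t \<noteq> 0})
           (restrict_space borel ({0<..} \<times> (- {0}))) (\<lambda>t. (t, jump p t))"

lemma emeasure_jump_measure:
  assumes "B \<in> sets borel" "B \<subseteq> {0<..} \<times> (- {0})"
  shows "emeasure (jump_measure p) B = emeasure (count_space UNIV) {t. 0 < t \<and> (t, jump p t) \<in> B}"
proof -
  have D: "{0<..} \<times> (- {0}) \<in> sets (borel :: (real \<times> real) measure)"
    by (intro borel_open open_Times) auto
  have "(\<lambda>t. (t, jump p t)) \<in> measurable (count_space {t. 0 < t \<and> jump p t \<noteq> 0})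
          (restrict_space borel ({0<..} \<times> (- {0})))"
    by (auto simp: measurable_count_space_eq1 space_restrict_space)
  moreover have "B \<in> sets (restrict_space borel ({0<..} \<times> (- {0})))"
    using assms D by (auto simp: sets_restrict_space_iff)
  ultimately have "emeasure (jump_measure p) B =
      emeasure (count_space {t. 0 < t \<and> jump p t \<noteq> 0})
        ((\<lambda>t. (t, jump p t)) -` B \<inter> {t. 0 < t \<and> jump p t \<noteq> 0})"
    by (simp add: jump_measure_def emeasure_distr)
  also have "(\<lambda>t. (t, jump p t)) -` B \<inter> {t. 0 < t \<and> jump p t \<noteq> 0} = {t. 0 < t \<and> (t, jump p t) \<in> B}"
    using assms(2) by auto
  also have "emeasure (count_space {t. 0 < t \<and> jump p t \<noteq> 0}) {t. 0 < t \<and> (t, jump p t) \<in> B} =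
      emeasure (count_space UNIV) {t. 0 < t \<and> (t, jump p t) \<in> B}"
    using assms(2) by (subst (1 2) emeasure_count_space) auto
  finally show ?thesis .
qed

text \<open>
  \<open>\<nu>(A)\<close> is the expected number of jumps, per unit of time, whose size lies in \<open>A\<close>.
\<close>

definition is_levy_measure :: "'a measure \<Rightarrow> (real \<Rightarrow> 'a \<Rightarrow> real) \<Rightarrow> real measure \<Rightarrow> bool" where
  "is_levy_measure M X \<nu> \<longleftrightarrow>
     sets \<nu> = sets (restrict_space borel (- {0})) \<and>
     (\<forall>A\<in>sets \<nu>. emeasure \<nu> A = (\<integral>\<^sup>+\<omega>. emeasure (jump_measure (\<lambda>t. X t \<omega>)) ({0<..1} \<times> A) \<partial>M))"

definition sup_norm_on :: "real set \<Rightarrow> (real \<Rightarrow> real) \<Rightarrow> real" where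
  "sup_norm_on A f = (SUP x\<in>A. \<bar>f x\<bar>)"

definition wronskian :: "(real \<Rightarrow> real) \<Rightarrow> (real \<Rightarrow> real) \<Rightarrow> real \<Rightarrow> real" where
  "wronskian g f z = deriv g z * f z - deriv f z * g z"

text \<open>
  Cadlag solutions on \<open>[0,T]\<close> of
  \<open>Z\<^sub>t = x + \<integral>\<^sub>0\<^sup>t f(Z\<^sub>s) ds + \<integral>\<^sub>0\<^sup>t \<integral> h(y) g(Z\<^sub>s\<^sub>-) dN(s,y)\<close>, where \<open>N\<close> is the jump measure of \<open>X\<close>.
\<close>

definition jump_sde_solution ::
  "'a measure \<Rightarrow> (real \<Rightarrow> 'a \<Rightarrow> real) \<Rightarrow> real \<Rightarrow> real \<Rightarrow> (real \<Rightarrow> real) \<Rightarrow> (real \<Rightarrow> real) \<Rightarrow>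
   (real \<Rightarrow> real) \<Rightarrow> (real \<Rightarrow> 'a \<Rightarrow> real) \<Rightarrow> bool" where
  "jump_sde_solution M X T x f g h Z \<longleftrightarrow>
     (\<forall>t\<in>{0..T}. Z t \<in> borel_measurable M) \<and>
     (AE \<omega> in M. cadlag_on {0..T} (\<lambda>t. Z t \<omega>) \<and>
        (\<forall>t\<in>{0..T}.
           set_integrable lborel {0..t} (\<lambda>s. f (Z s \<omega>)) \<and>
           set_integrable (jump_measure (\<lambda>t. X t \<omega>)) ({0<..t} \<times> (- {0}))
             (\<lambda>(s, y). h y * g (left_limit (\<lambda>r. Z r \<omega>) s)) \<and>
           Z t \<omega> = x + (LINT s:{0..t}|lborel. f (Z s \<omega>)) +
             (LINT (s, y):({0<..t} \<times> (- {0}))|jump_measure (\<lambda>t. X t \<omega>).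
                h y * g (left_limit (\<lambda>r. Z r \<omega>) s))))"

text \<open>
  Membership in \<open>null_sets M\<close> (rather than an equation for \<open>emeasure\<close>, which is \<open>0\<close> on
  non-measurable sets) makes the event measurable and of probability zero.
\<close>

definition has_density_on :: "'a measure \<Rightarrow> ('a \<Rightarrow> real) \<Rightarrow> 'a set \<Rightarrow> bool" where
  "has_density_on M Y A \<longleftrightarrow>
     (\<forall>B\<in>sets borel. emeasure lborel B = 0 \<longrightarrow> {\<omega>\<in>space M. Y \<omega> \<in> B} \<inter> A \<in> null_sets M)"

end

(*
  Let phi be the flow of z' = f(z). If u is the last jump time, of size y, and q < u is a dyadic multiple of T
  such that no jump occurs in (q, u), then Z_T = phi (T - u) (w + h y * g w) with w = phi (u - q) (Z_q).
  With Z_q and y frozen, the right-hand side moves with u at a speed that is, up to the nonvanishing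
  derivative of phi (T - u), equal to h y * W(g, f)(w) - f''(xi) (h y)^2 (g w)^2 / 2 by Taylor's formula;
  by assumption this never vanishes, so the set of u that are sent into a Lebesgue null set is null.
  It remains to see that u has a diffuse law given (Z_q, y). Instead of the full Poisson structure one needs
  only the compensation formula E (card {u > q. ((Z_q, y_u), u) : L}) = (law of Z_q x c x Lebesgue) L / T,
  with c the mean measure of the jump sizes. On boxes it follows from the independence and stationarity of
  the increments of X on dyadic grids, since the number of jumps of a given kind is an almost sure limit of
  functions of these increments, and Z_q is a limit of an Euler scheme driven by the jumps before q.
*)

theory Submission
  imports Defs
begin

text \<open>The last jump time depends on the future, so one cannot condition on it directly. A mean
  count avoids this: for fixed \<open>q\<close>, a jump \<open>u > q\<close> is bad if the end
  value, computed as though \<open>u\<close> were the only jump after \<open>q\<close>, lies in the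
  null set. This makes sense for every jump after \<open>q\<close>, last or not, and if the mean
  number of bad jumps is 0, then almost surely no jump is bad for any dyadic \<open>q\<close>; one
  such \<open>q\<close> lies between the last two jumps. Two obstacles shape the rest. A solution
  \<open>Z\<close> is not assumed adapted, so its dependence on the past alone has to be derived,
  and this dependence holds only up to null sets; hence the augmented sigma-algebras. Moreover
  \<open>g'\<close> and \<open>f''\<close> may be discontinuous. The end value as a function of
  \<open>u\<close> is therefore only shown to leave each of its values at a linear rate, with the
  two-sided Lipschitz bound of the flow in place of its spatial derivative; such a lower bound
  already makes preimages of null sets null.\<close>

section \<open>Flows of bounded Lipschitz vector fields on the line\<close>

text \<open>Both \<open>c / m * exp (m * s) - D s\<close> and
  \<open>c / m * exp (m * s) + D s\<close> are nondecreasing from the value \<open>c / m\<close> at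
  0. In the norm weighted by \<open>exp (- m * \<bar>t\<bar>)\<close> integration thus gains a
  factor \<open>1 / m\<close>, which makes Picard iteration contract on the whole line.\<close>

lemma exp_weighted_mvt_bound_nonneg:
  fixes D d :: "real \<Rightarrow> real"
  assumes D: "\<And>s. (D has_real_derivative d s) (at s)" and D0: "D 0 = 0"
    and d: "\<And>s. 0 \<le> s \<Longrightarrow> \<bar>d s\<bar> \<le> c * exp (m * s)" and m: "0 < m" and t: "0 \<le> t"
  shows "\<bar>D t\<bar> \<le> c / m * exp (m * t)"
proof -
  have c: "0 \<le> c" using d[of 0] by simp
  have "c / m * exp (m * 0) - D 0 \<le> c / m * exp (m * t) - D t"
  proof (rule DERIV_nonneg_imp_nondecreasing[OF t])
    fix s assume s: "0 \<le> s" "s \<le> t"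
    have "((\<lambda>s. c / m * exp (m * s) - D s) has_real_derivative c * exp (m * s) - d s) (at s)"
      using m by (auto intro!: derivative_eq_intros D)
    then show "\<exists>y. ((\<lambda>s. c / m * exp (m * s) - D s) has_real_derivative y) (at s) \<and> 0 \<le> y"
      using d[OF s(1)] by (intro exI[of _ "c * exp (m * s) - d s"]) auto
  qed
  moreover have "c / m * exp (m * 0) + D 0 \<le> c / m * exp (m * t) + D t"
  proof (rule DERIV_nonneg_imp_nondecreasing[OF t])
    fix s assume s: "0 \<le> s" "s \<le> t"
    have "((\<lambda>s. c / m * exp (m * s) + D s) has_real_derivative c * exp (m * s) + d s) (at s)"
      using m by (auto intro!: derivative_eq_intros D)
    then show "\<exists>y. ((\<lambda>s. c / m * exp (m * s) + D s) has_real_derivative y) (at s) \<and> 0 \<le> y"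
      using d[OF s(1)] by (intro exI[of _ "c * exp (m * s) + d s"]) auto
  qed
  moreover have "0 \<le> c / m" using c m by simp
  ultimately show ?thesis using D0 by (simp add: abs_le_iff)
qed

lemma exp_weighted_mvt_bound:
  fixes D d :: "real \<Rightarrow> real"
  assumes D: "\<And>s. (D has_real_derivative d s) (at s)" and D0: "D 0 = 0"
    and d: "\<And>s. \<bar>d s\<bar> \<le> c * exp (m * \<bar>s\<bar>)" and m: "0 < m"
  shows "\<bar>D t\<bar> \<le> c / m * exp (m * \<bar>t\<bar>)"
proof (cases "0 \<le> t")
  case True
  have "\<bar>D t\<bar> \<le> c / m * exp (m * t)"
  proof (rule exp_weighted_mvt_bound_nonneg[OF D D0 _ m True])
    show "\<bar>d s\<bar> \<le> c * exp (m * s)" if "0 \<le> s" for s using d[of s] that by simp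
  qed
  then show ?thesis using True by simp
next
  case False
  have "\<bar>(\<lambda>s. D (- s)) (- t)\<bar> \<le> c / m * exp (m * (- t))"
  proof (rule exp_weighted_mvt_bound_nonneg)
    show "((\<lambda>s. D (- s)) has_real_derivative - d (- s)) (at s)" for s
      by (rule DERIV_cong[OF DERIV_chain2[where f = D and g = uminus]])
        (auto intro!: derivative_eq_intros D)
    show "\<bar>- d (- s)\<bar> \<le> c * exp (m * s)" if "0 \<le> s" for s using d[of "- s"] that by simp
  qed (use D0 m False in auto)
  then show ?thesis using False by simp
qed

text \<open>Countable decomposition: \<open>n\<close> makes the lower bound uniform in constant and
  radius, and the floor index \<open>i\<close> confines \<open>u\<close> to an interval of length
  \<open>1 / real (Suc n)\<close>. On a piece \<open>P n i\<close> the map \<open>F\<close> is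
  injective with Lipschitz inverse, so the piece is a Lipschitz image of a subset of
  \<open>B\<close>.\<close>

lemma negligible_vimage_expanding:
  fixes F :: "real \<Rightarrow> real"
  assumes expanding: "\<And>u. u \<in> S \<Longrightarrow> \<exists>k>0. \<forall>\<^sub>F r in at u. k * \<bar>r - u\<bar> \<le> \<bar>F r - F u\<bar>"
    and B: "negligible B"
  shows "negligible {u \<in> S. F u \<in> B}"
proof -
  define P where "P n i = {u \<in> S. F u \<in> B \<and> \<lfloor>u * real (Suc n)\<rfloor> = i \<and>
    (\<forall>r. \<bar>r - u\<bar> < 1 / real (Suc n) \<longrightarrow> \<bar>r - u\<bar> \<le> real (Suc n) * \<bar>F r - F u\<bar>)}" for n i
  have neg: "negligible (P n i)" for n i
  proof -
    have lip: "\<bar>u - r\<bar> \<le> real (Suc n) * \<bar>F u - F r\<bar>" if "u \<in> P n i" "r \<in> P n i" for u r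
    proof -
      have "\<bar>u * real (Suc n) - r * real (Suc n)\<bar> < 1"
        using that floor_correct[of "u * real (Suc n)"] floor_correct[of "r * real (Suc n)"]
        unfolding P_def by auto linarith
      then have "\<bar>u - r\<bar> * real (Suc n) < 1"
        by (metis abs_mult abs_of_nat left_diff_distrib)
      then have "\<bar>u - r\<bar> < 1 / real (Suc n)" by (simp add: field_simps)
      then show ?thesis using that unfolding P_def by blast
    qed
    have inj: "inj_on F (P n i)"
    proof (rule inj_onI)
      fix u r assume "u \<in> P n i" "r \<in> P n i" "F u = F r"
      then show "u = r" using lip[of u r] by simp
    qed
    have "negligible (inv_into (P n i) F ` (F ` P n i))"
    proof (rule negligible_locally_Lipschitz_image)
      show "negligible (F ` P n i)" by (rule negligible_subset[OF B]) (auto simp: P_def)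
      fix y assume "y \<in> F ` P n i"
      show "\<exists>T C. open T \<and> y \<in> T \<and> (\<forall>z\<in>F ` P n i \<inter> T.
          norm (inv_into (P n i) F z - inv_into (P n i) F y) \<le> C * norm (z - y))"
        using lip inj \<open>y \<in> F ` P n i\<close>
        by (intro exI[of _ UNIV] exI[of _ "real (Suc n)"]) (auto simp: inv_into_f_f)
    qed simp
    then show ?thesis by (simp add: inj)
  qed
  have "{u \<in> S. F u \<in> B} \<subseteq> (\<Union>(n, i)\<in>UNIV. P n i)"
  proof
    fix u assume u: "u \<in> {u \<in> S. F u \<in> B}"
    then obtain k where k: "0 < k" "\<forall>\<^sub>F r in at u. k * \<bar>r - u\<bar> \<le> \<bar>F r - F u\<bar>" using expanding by blast
    then obtain d where d: "0 < d" "\<And>r. r \<noteq> u \<Longrightarrow> \<bar>r - u\<bar> < d \<Longrightarrow> k * \<bar>r - u\<bar> \<le> \<bar>F r - F u\<bar>"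
      by (auto simp: eventually_at dist_real_def)
    obtain n where n: "1 / real (Suc n) < min k d" using k(1) d(1) nat_approx_posE[of "min k d"] by auto
    have "\<bar>r - u\<bar> \<le> real (Suc n) * \<bar>F r - F u\<bar>" if "\<bar>r - u\<bar> < 1 / real (Suc n)" for r
    proof (cases "r = u")
      case False
      have "1 / real (Suc n) * \<bar>r - u\<bar> \<le> k * \<bar>r - u\<bar>" using n by (intro mult_right_mono) auto
      also have "\<dots> \<le> \<bar>F r - F u\<bar>" using d(2)[OF False] that n by simp
      finally show ?thesis by (simp add: field_simps)
    qed simp
    then have "u \<in> P n \<lfloor>u * real (Suc n)\<rfloor>" using u by (auto simp: P_def)
    then show "u \<in> (\<Union>(n, i)\<in>UNIV. P n i)" by blast
  qed
  moreover have "negligible (\<Union>(n, i)\<in>UNIV. P n i)"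
    using neg by (intro negligible_countable_Union) auto
  ultimately show ?thesis by (rule negligible_subset[rotated])
qed

lemma has_real_derivative_quadratic_error:
  fixes p :: "real \<Rightarrow> real"
  assumes d: "0 < d" and est: "\<And>t. \<bar>t - s\<bar> < d \<Longrightarrow> \<bar>p t - p s - (t - s) * D\<bar> \<le> C * (t - s)\<^sup>2"
  shows "(p has_real_derivative D) (at s)"
  unfolding has_field_derivative_iff
proof (rule LIM_zero_cancel, rule Lim_null_comparison)
  show "\<forall>\<^sub>F t in at s. norm ((p t - p s) / (t - s) - D) \<le> C * \<bar>t - s\<bar>"
    unfolding eventually_at
  proof (intro exI[of _ d] conjI ballI impI d)
    fix t assume t: "t \<noteq> s \<and> dist t s < d"
    then have "(p t - p s) / (t - s) - D = (p t - p s - (t - s) * D) / (t - s)"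
      by (simp add: field_simps)
    then show "norm ((p t - p s) / (t - s) - D) \<le> C * \<bar>t - s\<bar>"
      using est[of t] t
      by (simp add: abs_divide divide_le_eq power2_eq_square dist_real_def mult.assoc flip: abs_mult)
  qed
  have "((\<lambda>t. C * \<bar>t - s\<bar>) \<longlongrightarrow> C * \<bar>s - s\<bar>) (at s)" by (intro tendsto_intros)
  then show "((\<lambda>t. C * \<bar>t - s\<bar>) \<longlongrightarrow> 0) (at s)" by simp
qed

lemma mvt_symmetric:
  fixes p p' :: "real \<Rightarrow> real"
  assumes p: "\<And>t. (p has_real_derivative p' t) (at t)"
  shows "\<exists>\<xi>. \<bar>\<xi> - b\<bar> \<le> \<bar>a - b\<bar> \<and> p a - p b = (a - b) * p' \<xi>"
proof (cases a b rule: linorder_cases)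
  case less
  then obtain z where "a < z" "z < b" "p b - p a = (b - a) * p' z" using MVT2[OF less p] by blast
  then show ?thesis by (intro exI[of _ z]) (auto simp: algebra_simps)
next
  case greater
  then obtain z where "b < z" "z < a" "p a - p b = (a - b) * p' z" using MVT2[OF greater p] by blast
  then show ?thesis by (intro exI[of _ z]) (auto simp: algebra_simps)
qed auto

text \<open>The squared distance is differentiable also where the two solutions meet; damped by
  \<open>exp (- 2 * L * (t - a))\<close> it cannot increase.\<close>

lemma lipschitz_ode_gronwall:
  fixes f p r :: "real \<Rightarrow> real"
  assumes lip: "\<And>u v. \<bar>f u - f v\<bar> \<le> L * \<bar>u - v\<bar>"
    and ab: "a \<le> b" and c: "continuous_on {a..b} p" "continuous_on {a..b} r"
    and p: "\<And>t. a < t \<Longrightarrow> t < b \<Longrightarrow> (p has_real_derivative f (p t)) (at t)"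
    and r: "\<And>t. a < t \<Longrightarrow> t < b \<Longrightarrow> (r has_real_derivative f (r t)) (at t)"
  shows "\<bar>p b - r b\<bar> \<le> exp (L * (b - a)) * \<bar>p a - r a\<bar>"
proof -
  have le: "\<bar>(p t - r t) * (f (p t) - f (r t))\<bar> \<le> L * (p t - r t)\<^sup>2" for t
    using mult_left_mono[OF lip[of "p t" "r t"], of "\<bar>p t - r t\<bar>"]
    by (simp add: abs_mult power2_eq_square ac_simps abs_mult_self_eq)
  have sq: "exp (2 * c) * u\<^sup>2 = (exp c * \<bar>u\<bar>)\<^sup>2" for c u :: real
    by (simp add: power_mult_distrib exp_double)
  have "(p b - r b)\<^sup>2 * exp (- 2 * L * (b - a)) \<le> (p a - r a)\<^sup>2 * exp (- 2 * L * (a - a))"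
  proof (rule DERIV_nonpos_imp_decreasing_open[OF ab, where f = "\<lambda>t. (p t - r t)\<^sup>2 * exp (- 2 * L * (t - a))"])
    fix t assume t: "a < t" "t < b"
    have "((\<lambda>t. (p t - r t)\<^sup>2 * exp (- 2 * L * (t - a))) has_real_derivative
       (2 * ((p t - r t) * (f (p t) - f (r t))) - 2 * L * (p t - r t)\<^sup>2) * exp (- 2 * L * (t - a))) (at t)"
      by (rule derivative_eq_intros p[OF t] r[OF t] refl | simp)+ (simp add: algebra_simps)
    note D = this
    have "(2 * ((p t - r t) * (f (p t) - f (r t))) - 2 * L * (p t - r t)\<^sup>2) * exp (- 2 * L * (t - a)) \<le> 0"
      using le[of t] by (intro mult_nonpos_nonneg) auto
    with D show "\<exists>y. ((\<lambda>t. (p t - r t)\<^sup>2 * exp (- 2 * L * (t - a))) has_real_derivative y) (at t) \<and> y \<le> 0"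
      by blast
  qed (intro continuous_intros c)
  then have "(p b - r b)\<^sup>2 * exp (- 2 * L * (b - a)) * exp (2 * (L * (b - a)))
      \<le> (p a - r a)\<^sup>2 * exp (2 * (L * (b - a)))"
    by (intro mult_right_mono) simp_all
  then have "(p b - r b)\<^sup>2 \<le> exp (2 * (L * (b - a))) * (p a - r a)\<^sup>2"
    by (simp add: mult.assoc mult_exp_exp mult.commute[of "(p a - r a)\<^sup>2"])
  then have "\<bar>p b - r b\<bar>\<^sup>2 \<le> (exp (L * (b - a)) * \<bar>p a - r a\<bar>)\<^sup>2"
    by (simp flip: sq)
  then show ?thesis
    by (rule power2_le_imp_le) simp
qed

section \<open>Picard iteration and the global flow\<close>

locale bounded_lipschitz =
  fixes f :: "real \<Rightarrow> real" and L K :: real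
  assumes lipschitz: "\<bar>f a - f b\<bar> \<le> L * \<bar>a - b\<bar>"
    and bound: "\<bar>f a\<bar> \<le> K"
    and L_pos: "0 < L"
begin

lemma K_nonneg: "0 \<le> K" using bound[of 0] by linarith

lemma isCont_f: "isCont f a"
proof -
  have "continuous_on UNIV f"
    using lipschitz L_pos
    by (intro lipschitz_on_continuous_on[of L] lipschitz_onI) (auto simp: dist_real_def)
  then show ?thesis by (simp add: continuous_on_eq_continuous_at)
qed

lemma antiderivative_ex:
  assumes "\<And>t. isCont p t"
  shows "\<exists>P. P 0 = v \<and> (\<forall>t. (P has_real_derivative f (p t)) (at t))"
proof -
  obtain F where F: "\<And>t. (F has_vector_derivative f (p t)) (at t)"
    using einterval_antiderivative[of "-\<infinity>" "\<infinity>" "\<lambda>t. f (p t)"] isCont_f assms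
    by (auto intro!: continuous_intros isCont_o2[where g = f and f = p])
  then have F: "\<And>t. (F has_real_derivative f (p t)) (at t)"
    by (simp add: has_real_derivative_iff_has_vector_derivative)
  show ?thesis
    by (rule exI[of _ "\<lambda>t. F t - F 0 + v"]) (auto intro!: derivative_eq_intros F)
qed

lemma solution_ex: "\<exists>p. p 0 = v \<and> (\<forall>t. (p has_real_derivative f (p t)) (at t))"
proof -
  define A where "A p = (SOME P. P 0 = v \<and> (\<forall>t. (P has_real_derivative f (p t)) (at t)))" for p
  have A: "A p 0 = v \<and> (\<forall>t. (A p has_real_derivative f (p t)) (at t))" if "\<And>t. isCont p t" for p
    unfolding A_def by (rule someI_ex[OF antiderivative_ex[OF that]])
  define P where "P n = (A ^^ n) (\<lambda>_. v)" for n
  have P_Suc: "P (Suc n) = A (P n)" for n by (simp add: P_def)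
  have P_cont: "isCont (P n) t" for n t
  proof (induction n arbitrary: t)
    case (Suc n)
    then have "(P (Suc n) has_real_derivative f (P n t)) (at t)" using A[of "P n"] by (simp add: P_Suc)
    then show ?case by (rule DERIV_isCont)
  qed (simp add: P_def)
  have P0: "P n 0 = v" for n
    using A[OF P_cont] by (cases n) (simp_all add: P_Suc, simp add: P_def)
  have P_deriv: "(P (Suc n) has_real_derivative f (P n t)) (at t)" for n t
    using A[OF P_cont] by (simp add: P_Suc)
  \<comment> \<open>Twice the Lipschitz constant: one Picard step multiplies the weighted distance
    by \<open>L / m\<close>, that is, by one half.\<close>
  define m where "m = 2 * L"
  have m: "0 < m" using L_pos by (simp add: m_def)
  have step: "\<bar>P (Suc n) t - P n t\<bar> \<le> K / m * (1/2) ^ n * exp (m * \<bar>t\<bar>)" for n t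
  proof (induction n arbitrary: t)
    case 0
    have "\<bar>P 1 t - v\<bar> \<le> K / m * exp (m * \<bar>t\<bar>)"
    proof (rule exp_weighted_mvt_bound[where d = "\<lambda>t. f (P 0 t)"])
      show "((\<lambda>t. P 1 t - v) has_real_derivative f (P 0 s)) (at s)" for s
        using P_deriv[of 0 s] by (auto intro!: derivative_eq_intros)
      show "\<bar>f (P 0 s)\<bar> \<le> K * exp (m * \<bar>s\<bar>)" for s
        using bound[of "P 0 s"] mult_left_mono[of 1 "exp (m * \<bar>s\<bar>)" K] K_nonneg m by simp
    qed (use P0 m in auto)
    then show ?case by (simp add: P_def)
  next
    case (Suc n)
    have "\<bar>P (Suc (Suc n)) t - P (Suc n) t\<bar> \<le> L * (K / m * (1/2) ^ n) / m * exp (m * \<bar>t\<bar>)"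
    proof (rule exp_weighted_mvt_bound[where d = "\<lambda>t. f (P (Suc n) t) - f (P n t)"])
      show "\<bar>f (P (Suc n) s) - f (P n s)\<bar> \<le> L * (K / m * (1/2) ^ n) * exp (m * \<bar>s\<bar>)" for s
        using lipschitz[of "P (Suc n) s" "P n s"] mult_left_mono[OF Suc[of s], of L] L_pos
        by (simp add: mult.assoc)
    qed (use P0 m in \<open>auto intro!: derivative_eq_intros P_deriv\<close>)
    also have "L * (K / m * (1/2) ^ n) / m = K / m * (1/2) ^ Suc n"
      using L_pos by (simp add: m_def field_simps)
    finally show ?case .
  qed
  have conv: "convergent (\<lambda>n. P n t)" for t
  proof -
    have "summable (\<lambda>n. P (Suc n) t - P n t)"
    proof (rule summable_comparison_test')
      show "summable (\<lambda>n. K / m * exp (m * \<bar>t\<bar>) * (1/2) ^ n)"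
        by (intro summable_mult summable_geometric) simp
      show "norm (P (Suc n) t - P n t) \<le> K / m * exp (m * \<bar>t\<bar>) * (1/2) ^ n" if "0 \<le> n" for n
        using step[of n t] by (simp add: ac_simps)
    qed
    then have "convergent (\<lambda>n. P n t - P 0 t)"
      by (simp add: summable_iff_convergent sum_lessThan_telescope[of "\<lambda>n. P n t"])
    from convergent_add[OF this convergent_const[of "P 0 t"]] show ?thesis by simp
  qed
  define p where "p t = lim (\<lambda>n. P n t)" for t
  have lim: "(\<lambda>n. P n t) \<longlonglongrightarrow> p t" for t
    using conv convergent_LIMSEQ_iff by (auto simp: p_def)
  \<comment> \<open>The iterates satisfy this quadratic estimate with a constant independent of
    \<open>n\<close>. It therefore survives pointwise convergence and yields the differential
    equation for \<open>p\<close> at once.\<close>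
  have taylor: "\<bar>p t - p s - (t - s) * f (p s)\<bar> \<le> L * K * (t - s)\<^sup>2" for s t
  proof -
    have *: "\<bar>P (Suc (Suc n)) t - P (Suc (Suc n)) s - (t - s) * f (P (Suc n) s)\<bar> \<le> L * K * (t - s)\<^sup>2" for n
    proof -
      note mv = mvt_symmetric[of "P (Suc n)" "\<lambda>t. f (P n t)" for n, OF P_deriv]
      obtain \<xi> where xi: "\<bar>\<xi> - s\<bar> \<le> \<bar>t - s\<bar>"
        "P (Suc (Suc n)) t - P (Suc (Suc n)) s = (t - s) * f (P (Suc n) \<xi>)" using mv by blast
      obtain \<zeta> where "P (Suc n) \<xi> - P (Suc n) s = (\<xi> - s) * f (P n \<zeta>)" using mv by blast
      then have "\<bar>P (Suc n) \<xi> - P (Suc n) s\<bar> \<le> \<bar>t - s\<bar> * K"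
        using xi(1) bound[of "P n \<zeta>"] by (simp add: abs_mult mult_mono)
      then have "\<bar>f (P (Suc n) \<xi>) - f (P (Suc n) s)\<bar> \<le> L * (\<bar>t - s\<bar> * K)"
        using lipschitz[of "P (Suc n) \<xi>" "P (Suc n) s"] L_pos
        by (meson mult_left_mono order_trans less_imp_le)
      then have "\<bar>t - s\<bar> * \<bar>f (P (Suc n) \<xi>) - f (P (Suc n) s)\<bar> \<le> \<bar>t - s\<bar> * (L * (\<bar>t - s\<bar> * K))"
        by (intro mult_left_mono) auto
      then show ?thesis unfolding xi(2)
        by (simp add: abs_mult[symmetric] right_diff_distrib power2_eq_square ac_simps)
    qed
    have "(\<lambda>n. \<bar>P (Suc (Suc n)) t - P (Suc (Suc n)) s - (t - s) * f (P (Suc n) s)\<bar>)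
        \<longlonglongrightarrow> \<bar>p t - p s - (t - s) * f (p s)\<bar>"
      using LIMSEQ_Suc[OF lim] LIMSEQ_Suc[OF LIMSEQ_Suc[OF lim]]
      by (intro tendsto_intros isCont_tendsto_compose[OF isCont_f]) auto
    then show ?thesis by (rule LIMSEQ_le_const2) (use * in auto)
  qed
  have "(p has_real_derivative f (p s)) (at s)" for s
    by (rule has_real_derivative_quadratic_error[OF zero_less_one]) (rule taylor)
  moreover have "p 0 = v" using lim[of 0] by (simp add: P0 LIMSEQ_const_iff)
  ultimately show ?thesis by blast
qed

text \<open>Times of both signs are included: backward times occur when kicks at different times are
  compared at the same instant.\<close>

definition flow :: "real \<Rightarrow> real \<Rightarrow> real" where
  "flow t v = (SOME p. p 0 = v \<and> (\<forall>t. (p has_real_derivative f (p t)) (at t))) t"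

lemma flow_0 [simp]: "flow 0 v = v"
  and flow_deriv: "((\<lambda>t. flow t v) has_real_derivative f (flow t v)) (at t)"
  using someI_ex[OF solution_ex[of v]] unfolding flow_def by auto

text \<open>The second estimate is the first one after time reversal: reflected at the midpoint of
  \<open>{a..b}\<close>, solutions for \<open>f\<close> become solutions for
  \<open>- f\<close>.\<close>

lemma gronwall_interval:
  assumes "a \<le> b" and c: "continuous_on {a..b} p" "continuous_on {a..b} r"
    and p: "\<And>t. a < t \<Longrightarrow> t < b \<Longrightarrow> (p has_real_derivative f (p t)) (at t)"
    and r: "\<And>t. a < t \<Longrightarrow> t < b \<Longrightarrow> (r has_real_derivative f (r t)) (at t)"
  shows "\<bar>p b - r b\<bar> \<le> exp (L * (b - a)) * \<bar>p a - r a\<bar>"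
    and "\<bar>p a - r a\<bar> \<le> exp (L * (b - a)) * \<bar>p b - r b\<bar>"
proof -
  show "\<bar>p b - r b\<bar> \<le> exp (L * (b - a)) * \<bar>p a - r a\<bar>"
    by (rule lipschitz_ode_gronwall[OF lipschitz assms])
  have d: "((\<lambda>t. y (a + b - t)) has_real_derivative - f (y (a + b - t))) (at t)"
    if "\<And>t. a < t \<Longrightarrow> t < b \<Longrightarrow> (y has_real_derivative f (y t)) (at t)" "a < t" "t < b" for y t
    by (rule DERIV_cong[OF DERIV_chain2[where f = y and g = "\<lambda>t. a + b - t"]])
      (use that in \<open>auto intro!: derivative_eq_intros\<close>)
  have c': "continuous_on {a..b} (\<lambda>t. y (a + b - t))" if "continuous_on {a..b} y" for y :: "real \<Rightarrow> real"
    by (rule continuous_on_compose2[OF that]) (auto intro!: continuous_intros)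
  have lip: "\<bar>- f u - - f v\<bar> \<le> L * \<bar>u - v\<bar>" for u v using lipschitz[of u v] by simp
  show "\<bar>p a - r a\<bar> \<le> exp (L * (b - a)) * \<bar>p b - r b\<bar>"
    using lipschitz_ode_gronwall[of "\<lambda>z. - f z", OF lip \<open>a \<le> b\<close> c'[OF c(1)] c'[OF c(2)] d[OF p] d[OF r]] by simp
qed

lemma flow_gronwall:
  "\<bar>flow t a - flow t b\<bar> \<le> exp (L * \<bar>t\<bar>) * \<bar>a - b\<bar>"
  "\<bar>a - b\<bar> \<le> exp (L * \<bar>t\<bar>) * \<bar>flow t a - flow t b\<bar>"
proof -
  have c: "continuous_on S (\<lambda>t. flow t a)" for S a
    using flow_deriv by (meson DERIV_isCont continuous_at_imp_continuous_on)
  show "\<bar>flow t a - flow t b\<bar> \<le> exp (L * \<bar>t\<bar>) * \<bar>a - b\<bar>"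
    using gronwall_interval[of 0 t "\<lambda>t. flow t a" "\<lambda>t. flow t b"]
      gronwall_interval[of t 0 "\<lambda>t. flow t a" "\<lambda>t. flow t b"] c flow_deriv
    by (cases "0 \<le> t") auto
  show "\<bar>a - b\<bar> \<le> exp (L * \<bar>t\<bar>) * \<bar>flow t a - flow t b\<bar>"
    using gronwall_interval[of 0 t "\<lambda>t. flow t a" "\<lambda>t. flow t b"]
      gronwall_interval[of t 0 "\<lambda>t. flow t a" "\<lambda>t. flow t b"] c flow_deriv
    by (cases "0 \<le> t") auto
qed

lemma flow_unique:
  assumes "a \<le> b" "continuous_on {a..b} p"
    and "\<And>t. a < t \<Longrightarrow> t < b \<Longrightarrow> (p has_real_derivative f (p t)) (at t)"
  shows "p b = flow (b - a) (p a)"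
proof -
  have d: "((\<lambda>t. flow (t - a) (p a)) has_real_derivative f (flow (t - a) (p a))) (at t)" for t
    by (rule DERIV_cong[OF DERIV_chain2[where f = "\<lambda>t. flow t (p a)" and g = "\<lambda>t. t - a"]])
      (auto intro!: derivative_eq_intros flow_deriv)
  have "continuous_on {a..b} (\<lambda>t. flow (t - a) (p a))"
    using d by (meson DERIV_isCont continuous_at_imp_continuous_on)
  from gronwall_interval(1)[OF assms(1,2) this assms(3) d] show ?thesis by simp
qed

lemma flow_add: "flow s (flow t v) = flow (s + t) v"
proof -
  have d: "((\<lambda>s. flow (s + t) v) has_real_derivative f (flow (s + t) v)) (at s)" for s
    by (rule DERIV_cong[OF DERIV_chain2[where f = "\<lambda>t. flow t v" and g = "\<lambda>s. s + t"]])
      (auto intro!: derivative_eq_intros flow_deriv)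
  then have c: "continuous_on S (\<lambda>s. flow (s + t) v)" for S
    by (meson DERIV_isCont continuous_at_imp_continuous_on)
  have c': "continuous_on S (\<lambda>s. flow s (flow t v))" for S
    using flow_deriv by (meson DERIV_isCont continuous_at_imp_continuous_on)
  show ?thesis
  proof (cases "0 \<le> s")
    case True
    then show ?thesis using flow_unique[OF True c d] by simp
  next
    case False
    then show ?thesis
      using gronwall_interval(2)[of s 0 "\<lambda>s. flow s (flow t v)" "\<lambda>s. flow (s + t) v", OF _ c' c flow_deriv d]
      by auto
  qed
qed

lemma flow_time_lipschitz: "\<bar>flow s v - flow t v\<bar> \<le> K * \<bar>s - t\<bar>"
  using field_differentiable_bound[of UNIV "\<lambda>t. flow t v" "\<lambda>t. f (flow t v)" K s t] bound flow_deriv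
  by auto

lemma continuous_on_flow: "continuous_on UNIV (\<lambda>(t, v). flow t v)"
  unfolding continuous_on_eq_continuous_at[OF open_UNIV] isCont_def
proof safe
  fix s b
  show "(\<lambda>(t, v). flow t v) \<midarrow>(s, b)\<rightarrow> flow s b"
  proof (rule LIM_zero_cancel, rule Lim_null_comparison)
    show "\<forall>\<^sub>F x in at (s, b). norm ((case x of (t, v) \<Rightarrow> flow t v) - flow s b)
        \<le> K * \<bar>fst x - s\<bar> + exp (L * \<bar>s\<bar>) * \<bar>snd x - b\<bar>"
    proof (rule always_eventually, safe)
      fix t v
      show "norm (flow t v - flow s b) \<le> K * \<bar>fst (t, v) - s\<bar> + exp (L * \<bar>s\<bar>) * \<bar>snd (t, v) - b\<bar>"
        using flow_time_lipschitz[of t v s] flow_gronwall(1)[of s v b] by simp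
    qed
    have "((\<lambda>x. K * \<bar>fst x - s\<bar> + exp (L * \<bar>s\<bar>) * \<bar>snd x - b\<bar>) \<longlongrightarrow>
       K * \<bar>fst (s, b) - s\<bar> + exp (L * \<bar>s\<bar>) * \<bar>snd (s, b) - b\<bar>) (at (s, b))"
      by (intro tendsto_intros)
    then show "((\<lambda>x. K * \<bar>fst x - s\<bar> + exp (L * \<bar>s\<bar>) * \<bar>snd x - b\<bar>) \<longlongrightarrow> 0) (at (s, b))" by simp
  qed
qed

lemma borel_measurable_flow [measurable (raw)]:
  assumes [measurable]: "t \<in> borel_measurable N" "v \<in> borel_measurable N"
  shows "(\<lambda>x. flow (t x) (v x)) \<in> borel_measurable N"
proof -
  have "(\<lambda>(t, v). flow t v) \<in> borel_measurable (borel :: (real \<times> real) measure)"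
    by (rule borel_measurable_continuous_onI[OF continuous_on_flow])
  then have "(\<lambda>x. (\<lambda>(t, v). flow t v) (t x, v x)) \<in> borel_measurable N"
    by (rule measurable_compose[rotated]) (simp add: borel_prod[symmetric])
  then show ?thesis by simp
qed

text \<open>The constant is \<open>L\<close> times the speed bound \<open>K\<close>: along the flow
  \<open>f\<close> changes by at most \<open>L * K * \<bar>t\<bar>\<close>.\<close>

lemma flow_taylor: "\<bar>flow t v - v - t * f v\<bar> \<le> L * K * t\<^sup>2"
proof -
  have "\<exists>\<xi>. \<bar>\<xi>\<bar> \<le> \<bar>t\<bar> \<and> flow t v - v = t * f (flow \<xi> v)"
    using mvt_symmetric[of "\<lambda>t. flow t v" "\<lambda>t. f (flow t v)" 0 t, OF flow_deriv] by simp
  then obtain \<xi> where xi: "\<bar>\<xi>\<bar> \<le> \<bar>t\<bar>" "flow t v - v = t * f (flow \<xi> v)" by blast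
  have "\<bar>flow \<xi> v - v\<bar> \<le> K * \<bar>t\<bar>"
    using flow_time_lipschitz[of \<xi> v 0] mult_left_mono[OF xi(1) K_nonneg] by simp
  then have "\<bar>f (flow \<xi> v) - f v\<bar> \<le> L * (K * \<bar>t\<bar>)"
    using lipschitz[of "flow \<xi> v" v] L_pos by (meson mult_left_mono order_trans less_imp_le)
  then have "\<bar>t\<bar> * \<bar>f (flow \<xi> v) - f v\<bar> \<le> \<bar>t\<bar> * (L * (K * \<bar>t\<bar>))"
    by (intro mult_left_mono) auto
  then show ?thesis unfolding xi(2)
    by (simp add: abs_mult[symmetric] right_diff_distrib power2_eq_square ac_simps)
qed

text \<open>Kicks at times \<open>r\<close> near \<open>u\<close> are compared at the common time
  \<open>u\<close>: \<open>G r\<close> is the state there after a kick at \<open>r\<close>, and its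
  derivative \<open>D\<close> at \<open>r = u\<close> is the difference of the two sides of
  \<open>transversal\<close>. The flow from \<open>u\<close> to \<open>T\<close> shrinks distances
  by at most the factor \<open>exp (L * \<bar>T - u\<bar>)\<close>, so the end value inherits a
  linear lower bound and the map is expanding at every \<open>u\<close>.\<close>

lemma negligible_flow_kick:
  assumes g: "\<And>z. (g has_real_derivative g' z) (at z)"
    and transversal: "\<And>z. (1 + c * g' z) * f z \<noteq> f (z + c * g z)"
    and B: "negligible B"
  shows "negligible {u. flow (T - u) (flow (u - q) v + c * g (flow (u - q) v)) \<in> B}"
proof -
  define w where "w u = flow (u - q) v" for u
  define p where "p u = w u + c * g (w u)" for u
  have w: "(w has_real_derivative f (w u)) (at u)" for u
    unfolding w_def
    by (rule DERIV_cong[OF DERIV_chain2[where f = "\<lambda>t. flow t v" and g = "\<lambda>u. u - q"]])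
      (auto intro!: derivative_eq_intros flow_deriv)
  have p: "(p has_real_derivative (1 + c * g' (w u)) * f (w u)) (at u)" for u
    unfolding p_def
    by (rule derivative_eq_intros DERIV_chain2[OF g] w refl)+ (simp add: algebra_simps)
  have "negligible {u \<in> UNIV. flow (T - u) (p u) \<in> B}"
  proof (rule negligible_vimage_expanding[OF _ B])
    fix u
    define D where "D = (1 + c * g' (w u)) * f (w u) - f (p u)"
    define G where "G r = flow (u - r) (p r)" for r
    have "D \<noteq> 0" using transversal[of "w u"] by (simp add: D_def p_def)
    have pc: "(p \<longlongrightarrow> p u) (at u)" using DERIV_isCont[OF p] by (simp add: isCont_def)
    have "((\<lambda>r. (G r - G u) / (r - u)) \<longlongrightarrow> D) (at u)"
    proof -
      \<comment> \<open>First-order expansion of the short flow that starts in \<open>p r\<close>;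
        note that \<open>G u = p u\<close>.\<close>
      have "((\<lambda>r. (G r - G u) / (r - u) - ((p r - p u) / (r - u) - f (p r))) \<longlongrightarrow> 0) (at u)"
      proof (rule Lim_null_comparison)
        show "\<forall>\<^sub>F r in at u. norm ((G r - G u) / (r - u) - ((p r - p u) / (r - u) - f (p r))) \<le> L * K * \<bar>r - u\<bar>"
        proof (rule eventually_mono[OF eventually_neq_at_within])
          fix r assume r: "r \<noteq> u"
          have "(G r - G u) / (r - u) - ((p r - p u) / (r - u) - f (p r)) = (G r - p r - (u - r) * f (p r)) / (r - u)"
            using r by (simp add: G_def divide_simps) (simp add: algebra_simps)
          moreover have "\<bar>G r - p r - (u - r) * f (p r)\<bar> \<le> L * K * (u - r)\<^sup>2"
            unfolding G_def by (rule flow_taylor)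
          moreover have "(u - r)\<^sup>2 = \<bar>r - u\<bar> * \<bar>r - u\<bar>" by (simp add: power2_eq_square algebra_simps)
          ultimately show "norm ((G r - G u) / (r - u) - ((p r - p u) / (r - u) - f (p r))) \<le> L * K * \<bar>r - u\<bar>"
            using r by (simp add: abs_divide divide_le_eq mult.assoc)
        qed
        have "((\<lambda>r. L * K * \<bar>r - u\<bar>) \<longlongrightarrow> L * K * \<bar>u - u\<bar>) (at u)" by (intro tendsto_intros)
        then show "((\<lambda>r. L * K * \<bar>r - u\<bar>) \<longlongrightarrow> 0) (at u)" by simp
      qed
      moreover have "((\<lambda>r. (p r - p u) / (r - u) - f (p r)) \<longlongrightarrow> D) (at u)"
        unfolding D_def using p[of u] isCont_tendsto_compose[OF isCont_f pc]
        by (intro tendsto_diff) (auto simp: has_field_derivative_iff)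
      ultimately show ?thesis using tendsto_add by fastforce
    qed
    then have "((\<lambda>r. \<bar>(G r - G u) / (r - u)\<bar>) \<longlongrightarrow> \<bar>D\<bar>) (at u)" by (rule tendsto_rabs)
    then have ev: "\<forall>\<^sub>F r in at u. \<bar>D\<bar> / 2 < \<bar>(G r - G u) / (r - u)\<bar>"
      using \<open>D \<noteq> 0\<close> by (intro order_tendstoD) auto
    define k where "k = \<bar>D\<bar> / 2 / exp (L * \<bar>T - u\<bar>)"
    have "\<forall>\<^sub>F r in at u. k * \<bar>r - u\<bar> \<le> \<bar>flow (T - r) (p r) - flow (T - u) (p u)\<bar>"
    proof (rule eventually_rev_mp[OF ev], rule eventually_mono[OF eventually_neq_at_within], rule impI)
      fix r assume r: "r \<noteq> u" "\<bar>D\<bar> / 2 < \<bar>(G r - G u) / (r - u)\<bar>"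
      then have "\<bar>D\<bar> / 2 * \<bar>r - u\<bar> \<le> \<bar>G r - G u\<bar>" by (simp add: abs_divide field_simps)
      also have "\<dots> \<le> exp (L * \<bar>T - u\<bar>) * \<bar>flow (T - u) (G r) - flow (T - u) (G u)\<bar>"
        by (rule flow_gronwall)
      also have "flow (T - u) (G r) = flow (T - r) (p r)" by (simp add: G_def flow_add)
      also have "flow (T - u) (G u) = flow (T - u) (p u)" by (simp add: G_def)
      finally show "k * \<bar>r - u\<bar> \<le> \<bar>flow (T - r) (p r) - flow (T - u) (p u)\<bar>"
        by (simp add: k_def field_simps)
    qed
    moreover have "0 < k" using \<open>D \<noteq> 0\<close> by (simp add: k_def)
    ultimately show "\<exists>k>0. \<forall>\<^sub>F r in at u. k * \<bar>r - u\<bar> \<le> \<bar>flow (T - r) (p r) - flow (T - u) (p u)\<bar>"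
      by blast
  qed
  then show ?thesis by (simp add: p_def w_def)
qed

end

section \<open>Increments of cadlag paths over fine grids\<close>

lemma finite_real_separated:
  fixes J :: "real set"
  assumes "finite J"
  obtains \<rho> where "0 < \<rho>" "\<And>u v. u \<in> J \<Longrightarrow> v \<in> J \<Longrightarrow> \<bar>u - v\<bar> < \<rho> \<Longrightarrow> u = v"
proof -
  define S where "S = insert 1 ((\<lambda>(u, v). \<bar>u - v\<bar>) ` {(u, v) \<in> J \<times> J. u \<noteq> v})"
  have "finite {(u, v) \<in> J \<times> J. u \<noteq> v}"
    by (rule finite_subset[of _ "J \<times> J"]) (use assms in auto)
  then have S: "finite S" "S \<noteq> {}" by (simp_all add: S_def)
  show ?thesis
  proof (rule that[of "Min S"])
    show "0 < Min S" using S by (auto simp: S_def)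
    fix u v assume "u \<in> J" "v \<in> J" "\<bar>u - v\<bar> < Min S"
    moreover have "Min S \<le> \<bar>u - v\<bar>" if "u \<noteq> v"
      using S that \<open>u \<in> J\<close> \<open>v \<in> J\<close> by (intro Min_le) (auto simp: S_def)
    ultimately show "u = v" by fastforce
  qed
qed

lemma cadlag_on_tendsto_left_limit:
  assumes "cadlag_on {0..} p" "0 < u"
  shows "(p \<longlongrightarrow> left_limit p u) (at_left u)"
proof -
  have "at u within ({0..} \<inter> {..<u}) = at_left u"
    by (rule at_within_nhd[of u "{0<..}"]) (use assms in auto)
  moreover obtain l where "(p \<longlongrightarrow> l) (at u within ({0..} \<inter> {..<u}))"
    using assms unfolding cadlag_on_def by (meson atLeast_iff less_imp_le)
  ultimately have "(p \<longlongrightarrow> l) (at_left u)" by simp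
  moreover from this have "left_limit p u = l"
    unfolding left_limit_def by (intro tendsto_Lim) auto
  ultimately show ?thesis by simp
qed

lemma cadlag_on_tendsto_right:
  assumes "cadlag_on {0..} p" "0 \<le> u"
  shows "(p \<longlongrightarrow> p u) (at_right u)"
proof -
  have "{0..} \<inter> {u<..} = {u<..}" using assms by auto
  moreover have "(p \<longlongrightarrow> p u) (at u within ({0..} \<inter> {u<..}))" using assms unfolding cadlag_on_def by auto
  ultimately show ?thesis by simp
qed

text \<open>The half-open \<open>{x<..y}\<close> fits right continuity: if \<open>u\<close> is
  outside it, then either both points lie strictly to the left of \<open>u\<close>, near the left
  limit, or both lie at or to the right of \<open>u\<close>, near \<open>p u\<close>.\<close>

lemma cadlag_local_oscillation:
  assumes p: "cadlag_on {0..} p" and u: "0 \<le> u" and e: "0 < e"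
  shows "\<exists>\<delta>>0. \<forall>x y. 0 \<le> x \<longrightarrow> x < y \<longrightarrow> x \<in> ball u \<delta> \<longrightarrow> y \<in> ball u \<delta> \<longrightarrow> u \<notin> {x<..y} \<longrightarrow> \<bar>p y - p x\<bar> < e"
proof -
  obtain l where l: "(p \<longlongrightarrow> l) (at u within ({0..} \<inter> {..<u}))" using p u unfolding cadlag_on_def by auto
  have "\<forall>\<^sub>F r in at u within ({0..} \<inter> {..<u}). dist (p r) l < e / 2" using l e by (intro tendstoD) auto
  then obtain \<delta>1 where 1: "0 < \<delta>1" "\<And>r. 0 \<le> r \<Longrightarrow> r < u \<Longrightarrow> dist r u < \<delta>1 \<Longrightarrow> dist (p r) l < e / 2"
    by (auto simp: eventually_at)
  have "\<forall>\<^sub>F r in at_right u. dist (p r) (p u) < e / 2"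
    using cadlag_on_tendsto_right[OF p u] e by (intro tendstoD) auto
  then obtain \<delta>2 where 2: "0 < \<delta>2" "\<And>r. u < r \<Longrightarrow> dist r u < \<delta>2 \<Longrightarrow> dist (p r) (p u) < e / 2"
    by (auto simp: eventually_at)
  have near: "dist (p r) (p u) < e / 2" if "u \<le> r" "dist r u < \<delta>2" for r
    using that 2(2)[of r] e by (cases "r = u") auto
  show ?thesis
  proof (intro exI[of _ "min \<delta>1 \<delta>2"] conjI allI impI)
    fix x y assume xy: "0 \<le> x" "x < y" "x \<in> ball u (min \<delta>1 \<delta>2)" "y \<in> ball u (min \<delta>1 \<delta>2)" "u \<notin> {x<..y}"
    show "\<bar>p y - p x\<bar> < e"
    proof (cases "y < u")
      case True
      then have "dist (p x) l < e / 2" "dist (p y) l < e / 2"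
        using xy 1(2)[of x] 1(2)[of y] by (auto simp: dist_commute)
      then show ?thesis unfolding dist_real_def by linarith
    next
      case False
      then have "dist (p x) (p u) < e / 2" "dist (p y) (p u) < e / 2"
        using xy near[of x] near[of y] by (auto simp: dist_commute)
      then show ?thesis unfolding dist_real_def by linarith
    qed
  qed (use 1 2 in auto)
qed

text \<open>Compactness: \<open>U\<close> consists of the centres of a finite subcover by the local
  balls, and \<open>\<rho>\<close> is a Lebesgue number of that subcover.\<close>

lemma cadlag_oscillation:
  assumes p: "cadlag_on {0..} p" and s: "0 \<le> s" and e: "0 < e"
  obtains U \<rho> where "finite U" "0 < \<rho>"
    "\<And>x y. s \<le> x \<Longrightarrow> x < y \<Longrightarrow> y \<le> t \<Longrightarrow> y - x < \<rho> \<Longrightarrow> U \<inter> {x<..y} = {} \<Longrightarrow> \<bar>p y - p x\<bar> < e"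
proof -
  have "\<forall>u\<in>{s..t}. \<exists>\<delta>>0. \<forall>x y. 0 \<le> x \<longrightarrow> x < y \<longrightarrow> x \<in> ball u \<delta> \<longrightarrow> y \<in> ball u \<delta> \<longrightarrow> u \<notin> {x<..y} \<longrightarrow> \<bar>p y - p x\<bar> < e"
    using cadlag_local_oscillation[OF p _ e] s by auto
  then obtain \<delta> where \<delta>: "\<And>u. u \<in> {s..t} \<Longrightarrow> 0 < \<delta> u"
    "\<And>u x y. u \<in> {s..t} \<Longrightarrow> 0 \<le> x \<Longrightarrow> x < y \<Longrightarrow> x \<in> ball u (\<delta> u) \<Longrightarrow> y \<in> ball u (\<delta> u) \<Longrightarrow> u \<notin> {x<..y} \<Longrightarrow> \<bar>p y - p x\<bar> < e"
    by metis
  obtain U where U: "U \<subseteq> {s..t}" "finite U" "{s..t} \<subseteq> (\<Union>u\<in>U. ball u (\<delta> u))"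
    using compactE_image[OF compact_Icc, of "{s..t}" "\<lambda>u. ball u (\<delta> u)" s t] \<delta>(1) by force
  obtain \<rho> where \<rho>: "0 < \<rho>" "\<And>x. x \<in> {s..t} \<Longrightarrow> \<exists>G\<in>(\<lambda>u. ball u (\<delta> u)) ` U. ball x \<rho> \<subseteq> G"
    using Heine_Borel_lemma[OF compact_Icc U(3)] by blast
  show ?thesis
  proof (rule that[OF U(2) \<rho>(1)])
    fix x y assume xy: "s \<le> x" "x < y" "y \<le> t" "y - x < \<rho>" "U \<inter> {x<..y} = {}"
    obtain u where u: "u \<in> U" "ball x \<rho> \<subseteq> ball u (\<delta> u)" using \<rho>(2)[of x] xy by auto
    have "x \<in> ball x \<rho>" "y \<in> ball x \<rho>" using xy \<rho>(1) by (auto simp: dist_real_def)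
    then have "x \<in> ball u (\<delta> u)" "y \<in> ball u (\<delta> u)" using u by blast+
    moreover have "u \<notin> {x<..y}" "u \<in> {s..t}" using u U(1) xy by auto
    ultimately show "\<bar>p y - p x\<bar> < e" using xy s by (intro \<delta>(2)[of u]) simp_all
  qed
qed

lemma cadlag_large_jumps:
  assumes p: "cadlag_on {0..} p" and s: "0 \<le> s"
    and osc: "\<And>x y. s \<le> x \<Longrightarrow> x < y \<Longrightarrow> y \<le> t \<Longrightarrow> y - x < \<rho> \<Longrightarrow> U \<inter> {x<..y} = {} \<Longrightarrow> \<bar>p y - p x\<bar> < e"
    and \<rho>: "0 < \<rho>" and U: "finite U"
  shows "{u. s < u \<and> u \<le> t \<and> e < \<bar>jump p u\<bar>} \<subseteq> U"
proof (rule ccontr, clarsimp simp: subset_eq)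
  fix u assume u: "s < u" "u \<le> t" "e < \<bar>jump p u\<bar>" "u \<notin> U"
  have "\<exists>x0<u. \<forall>x. x0 < x \<longrightarrow> x < u \<longrightarrow> U \<inter> {x<..u} = {}"
  proof -
    have "open (- U)" using U by (simp add: finite_imp_closed open_Compl)
    then obtain b where "0 < b" "ball u b \<subseteq> - U" using u openE by blast
    then show ?thesis
      using u(4) by (intro exI[of _ "u - b"]) (fastforce simp: dist_real_def subset_eq)
  qed
  then obtain x0 where x0: "x0 < u" "\<And>x. x0 < x \<Longrightarrow> x < u \<Longrightarrow> U \<inter> {x<..u} = {}" by blast
  have "((\<lambda>x. \<bar>p u - p x\<bar>) \<longlongrightarrow> \<bar>p u - left_limit p u\<bar>) (at_left u)"
    using cadlag_on_tendsto_left_limit[OF p] u s by (intro tendsto_intros) auto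
  moreover have "\<forall>\<^sub>F x in at_left u. \<bar>p u - p x\<bar> \<le> e"
  proof (rule eventually_at_leftI)
    show "max x0 (max s (u - \<rho>)) < u" using x0 u \<rho> by simp
    fix x assume "x \<in> {max x0 (max s (u - \<rho>))<..<u}"
    then show "\<bar>p u - p x\<bar> \<le> e" using osc[of x u] x0(2)[of x] u by auto
  qed
  ultimately have "\<bar>p u - left_limit p u\<bar> \<le> e"
    by (intro tendsto_upperbound[where F = "at_left u"]) auto
  then show False using u by (simp add: jump_def)
qed

lemma finite_large_jumps:
  assumes "cadlag_on {0..} p" "0 < e"
  shows "finite {u. 0 < u \<and> u \<le> t \<and> e < \<bar>jump p u\<bar>}"
proof -
  obtain U \<rho> where U: "finite U" "0 < \<rho>"
    "\<And>x y. 0 \<le> x \<Longrightarrow> x < y \<Longrightarrow> y \<le> t \<Longrightarrow> y - x < \<rho> \<Longrightarrow> U \<inter> {x<..y} = {} \<Longrightarrow> \<bar>p y - p x\<bar> < e"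
    using cadlag_oscillation[OF assms(1) order_refl assms(2)] by metis
  show ?thesis
    by (rule finite_subset[OF cadlag_large_jumps[OF assms(1) order_refl _ U(2,1)] U(1)]) (use U(3) in blast)
qed

section \<open>Sums of functions of increments over fine grids\<close>

lemma grid_cell_unique:
  assumes d: "0 < d" and u: "0 < u"
  defines "\<kappa> \<equiv> nat \<lceil>u / d\<rceil> - 1"
  shows "u \<in> {real k * d<..real (Suc k) * d} \<longleftrightarrow> k = \<kappa>"
proof -
  have pos: "0 < \<lceil>u / d\<rceil>" using d u by simp
  have "u \<in> {real k * d<..real (Suc k) * d} \<longleftrightarrow> real k < u / d \<and> u / d \<le> real (Suc k)"
    using d by (simp add: field_simps)
  also have "\<dots> \<longleftrightarrow> \<lceil>u / d\<rceil> = int (Suc k)"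
    by (simp add: ceiling_eq_iff)
  also have "\<dots> \<longleftrightarrow> k = \<kappa>" using pos unfolding \<kappa>_def by linarith
  finally show ?thesis .
qed

text \<open>On a fine grid a cell holds at most one point of the exceptional set \<open>U\<close>. A
  cell without such a point contributes 0, because its increment is below \<open>e\<close>, where
  \<open>\<psi>\<close> vanishes. A cell around \<open>u\<close> has its left end tending to
  \<open>u\<close> strictly from the left and its right end from the right, so its increment tends
  to the jump. In this way jumps become limits of functions of increments.\<close>

lemma cadlag_grid_sum_tendsto:
  assumes p: "cadlag_on {0..} p" and s: "0 \<le> s"
    and \<psi>: "\<And>y. isCont \<psi> y" and e: "0 < e" and \<psi>0: "\<And>y. \<bar>y\<bar> \<le> e \<Longrightarrow> \<psi> y = (0::real)"
    and d: "\<And>n. 0 < d n" "d \<longlonglongrightarrow> 0"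
    and grid: "\<forall>\<^sub>F n in sequentially. real (a n) * d n = s \<and> real (b n) * d n = t"
  shows "(\<lambda>n. \<Sum>k\<in>{a n..<b n}. \<psi> (p (real (Suc k) * d n) - p (real k * d n)))
     \<longlonglongrightarrow> (\<Sum>u | s < u \<and> u \<le> t \<and> e < \<bar>jump p u\<bar>. \<psi> (jump p u))"
proof -
  obtain U \<rho> where U: "finite U" "0 < \<rho>"
    and osc: "\<And>x y. s \<le> x \<Longrightarrow> x < y \<Longrightarrow> y \<le> t \<Longrightarrow> y - x < \<rho> \<Longrightarrow> U \<inter> {x<..y} = {} \<Longrightarrow> \<bar>p y - p x\<bar> < e"
    using cadlag_oscillation[OF p s e] by metis
  obtain \<rho>' where \<rho>': "0 < \<rho>'" "\<And>u v. u \<in> U \<Longrightarrow> v \<in> U \<Longrightarrow> \<bar>u - v\<bar> < \<rho>' \<Longrightarrow> u = v"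
    using finite_real_separated[OF U(1)] by blast
  define V where "V = U \<inter> {s<..t}"
  have V: "finite V" using U by (simp add: V_def)
  have sub: "{u. s < u \<and> u \<le> t \<and> e < \<bar>jump p u\<bar>} \<subseteq> U"
    by (rule cadlag_large_jumps[OF p s _ U(2,1)]) (use osc in blast)
  have "e < \<bar>jump p u\<bar>" if "\<psi> (jump p u) \<noteq> 0" for u
    using \<psi>0[of "jump p u"] that by force
  \<comment> \<open>\<open>U\<close> may contain points without a large jump; they only add
    zeros.\<close>
  then have "(\<Sum>u | s < u \<and> u \<le> t \<and> e < \<bar>jump p u\<bar>. \<psi> (jump p u)) = (\<Sum>u\<in>V. \<psi> (jump p u))"
    by (intro sum.mono_neutral_left) (use V sub in \<open>auto simp: V_def\<close>)
  moreover have "(\<lambda>n. \<Sum>k\<in>{a n..<b n}. \<psi> (p (real (Suc k) * d n) - p (real k * d n))) \<longlonglongrightarrow> (\<Sum>u\<in>V. \<psi> (jump p u))"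
  proof -
    define \<kappa> where "\<kappa> n u = nat \<lceil>u / d n\<rceil> - 1" for n u
    have \<kappa>: "u \<in> {real k * d n<..real (Suc k) * d n} \<longleftrightarrow> k = \<kappa> n u" if "u \<in> V" for u k n
      unfolding \<kappa>_def using that s by (intro grid_cell_unique d) (auto simp: V_def)
    have lim: "(\<lambda>n. \<psi> (p (real (Suc (\<kappa> n u)) * d n) - p (real (\<kappa> n u) * d n))) \<longlonglongrightarrow> \<psi> (jump p u)" if u: "u \<in> V" for u
    proof -
      have u0: "0 < u" using u s by (auto simp: V_def)
      have cell: "real (\<kappa> n u) * d n < u" "u \<le> real (Suc (\<kappa> n u)) * d n" for n
        using \<kappa>[OF u, where n = n and k = "\<kappa> n u"] by auto
      have width: "real (Suc (\<kappa> n u)) * d n = real (\<kappa> n u) * d n + d n" for n by (simp add: algebra_simps)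
      have lo: "(\<lambda>n. real (\<kappa> n u) * d n) \<longlonglongrightarrow> u"
      proof (rule tendsto_sandwich)
        show "\<forall>\<^sub>F n in sequentially. u - d n \<le> real (\<kappa> n u) * d n"
          using cell(2) width by (auto simp: algebra_simps)
        show "\<forall>\<^sub>F n in sequentially. real (\<kappa> n u) * d n \<le> u" 
          by (intro always_eventually allI less_imp_le cell(1))
        show "(\<lambda>n. u - d n) \<longlonglongrightarrow> u" using tendsto_diff[OF tendsto_const d(2)] by simp
      qed simp
      have "filterlim (\<lambda>n. real (\<kappa> n u) * d n) (at_left u) sequentially"
        
        by (simp add: filterlim_at lo cell(1) less_imp_neq[OF cell(1)])
      then have "(\<lambda>n. p (real (\<kappa> n u) * d n)) \<longlonglongrightarrow> left_limit p u"
        by (rule filterlim_compose[OF cadlag_on_tendsto_left_limit[OF p u0]])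
      moreover have "(\<lambda>n. p (real (Suc (\<kappa> n u)) * d n)) \<longlonglongrightarrow> p u"
      proof -
        have "(\<lambda>n. real (Suc (\<kappa> n u)) * d n) \<longlonglongrightarrow> u"
          unfolding width using tendsto_add[OF lo d(2)] by simp
        moreover have "(p \<longlongrightarrow> p u) (at u within {u..})"
        proof -
          have "at u within {u..} = at_right u"
            by (rule at_within_nhd[of u UNIV]) auto
          then show ?thesis using cadlag_on_tendsto_right[OF p] u0 by simp
        qed
        then have "continuous (at u within {u..}) p" by (simp add: continuous_within)
        ultimately show ?thesis
          by (rule continuous_within_tendsto_compose[rotated 2]) (use cell(2) in auto)
      qed
      ultimately show ?thesis unfolding jump_def
        by (intro isCont_tendsto_compose[OF \<psi>] tendsto_diff)
    qed
    have ev: "\<forall>\<^sub>F n in sequentially. (\<Sum>u\<in>V. \<psi> (p (real (Suc (\<kappa> n u)) * d n) - p (real (\<kappa> n u) * d n))) =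
       (\<Sum>k\<in>{a n..<b n}. \<psi> (p (real (Suc k) * d n) - p (real k * d n)))"
      using order_tendstoD(2)[OF d(2) U(2)] order_tendstoD(2)[OF d(2) \<rho>'(1)] grid
    proof eventually_elim
      case (elim n)
      define D where "D k = \<psi> (p (real (Suc k) * d n) - p (real k * d n))" for k
      have width: "real (Suc k) * d n - real k * d n = d n" for k by (simp add: algebra_simps)
      have cellsum: "D k = (\<Sum>u\<in>V. if k = \<kappa> n u then D k else 0)" if k: "k \<in> {a n..<b n}" for k
      proof (cases "\<exists>u\<in>V. k = \<kappa> n u")
        case True
        then obtain u where u: "u \<in> V" "k = \<kappa> n u" by blast
        have "v = u" if "v \<in> V" "k = \<kappa> n v" for v
        proof -
          have "v \<in> {real k * d n<..real (Suc k) * d n}" "u \<in> {real k * d n<..real (Suc k) * d n}"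
            using \<kappa> u that by auto
          then have "\<bar>v - u\<bar> < d n" using width[of k] by auto
          then show ?thesis using that u \<rho>'(2)[of v u] elim by (auto simp: V_def)
        qed
        then have "(\<Sum>v\<in>V. if k = \<kappa> n v then D k else 0) = (\<Sum>v\<in>V. if v = u then D k else 0)"
          using u by (intro sum.cong) auto
        then show ?thesis using V u by simp
      next
        case False
        have lo: "s \<le> real k * d n"
          using k elim d(1)[of n] mult_right_mono[of "real (a n)" "real k" "d n"] by auto
        have "real (Suc k) * d n \<le> real (b n) * d n"
          using k d(1)[of n] by (intro mult_right_mono) auto
        then have hi: "real (Suc k) * d n \<le> t" using elim by simp
        have "U \<inter> {real k * d n<..real (Suc k) * d n} = {}"
        proof (rule ccontr)
          assume "U \<inter> {real k * d n<..real (Suc k) * d n} \<noteq> {}"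
          then obtain u where u: "u \<in> U" "u \<in> {real k * d n<..real (Suc k) * d n}" by blast
          then have "u \<in> V" using lo hi by (auto simp: V_def)
          then show False using \<kappa>[where u = u and n = n and k = k] u False by blast
        qed
        moreover have "real k * d n < real (Suc k) * d n" using width[of k] d(1)[of n] by linarith
        ultimately have "\<bar>p (real (Suc k) * d n) - p (real k * d n)\<bar> < e"
          using lo hi elim width[of k] by (intro osc) simp_all
        then have "D k = 0" using \<psi>0 by (simp add: D_def)
        then show ?thesis using False by simp
      qed
      have "(\<Sum>k\<in>{a n..<b n}. D k) = (\<Sum>k\<in>{a n..<b n}. \<Sum>u\<in>V. if k = \<kappa> n u then D k else 0)"
        using cellsum by (rule sum.cong[OF refl])
      also have "\<dots> = (\<Sum>u\<in>V. \<Sum>k\<in>{a n..<b n}. if k = \<kappa> n u then D k else 0)"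
        by (rule sum.swap)
      also have "\<dots> = (\<Sum>u\<in>V. D (\<kappa> n u))"
      proof (rule sum.cong[OF refl])
        fix u assume u: "u \<in> V"
        then have c: "real (\<kappa> n u) * d n < u" "u \<le> real (Suc (\<kappa> n u)) * d n" "s < u" "u \<le> t"
          using \<kappa>[OF u, where n = n and k = "\<kappa> n u"] by (auto simp: V_def)
        then have "real (a n) * d n < real (Suc (\<kappa> n u)) * d n" "real (\<kappa> n u) * d n < real (b n) * d n"
          using elim by linarith+
        then have "\<kappa> n u \<in> {a n..<b n}" using d(1)[of n] by (simp add: mult_less_cancel_right_pos)
        then show "(\<Sum>k\<in>{a n..<b n}. if k = \<kappa> n u then D k else 0) = D (\<kappa> n u)"
          by (simp add: sum.delta)
      qed
      finally show ?case by (simp add: D_def)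
    qed
    have "(\<lambda>n. \<Sum>u\<in>V. \<psi> (p (real (Suc (\<kappa> n u)) * d n) - p (real (\<kappa> n u) * d n))) \<longlonglongrightarrow> (\<Sum>u\<in>V. \<psi> (jump p u))"
      by (intro tendsto_sum lim)
    then show ?thesis using ev by (rule Lim_transform_eventually)
  qed
  ultimately show ?thesis by simp
qed

section \<open>Paths of the jump equation\<close>

lemma discrete_gronwall:
  fixes e a b :: "nat \<Rightarrow> real"
  assumes "e 0 \<le> 0" and step: "\<And>k. k < N \<Longrightarrow> e (Suc k) \<le> (1 + a k) * e k + b k"
    and a: "\<And>k. 0 \<le> a k" and b: "\<And>k. 0 \<le> b k" and "k \<le> N"
  shows "e k \<le> exp (\<Sum>i<k. a i) * (\<Sum>i<k. b i)"
  using \<open>k \<le> N\<close>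
proof (induction k)
  case (Suc k)
  have "e (Suc k) \<le> (1 + a k) * e k + b k" using Suc.prems by (intro step) simp
  also have "\<dots> \<le> (1 + a k) * (exp (\<Sum>i<k. a i) * (\<Sum>i<k. b i)) + b k"
    using Suc a[of k] by (intro add_right_mono mult_left_mono) auto
  also have "\<dots> \<le> exp (a k) * (exp (\<Sum>i<k. a i) * (\<Sum>i<k. b i)) + exp (\<Sum>i<Suc k. a i) * b k"
  proof (intro add_mono mult_right_mono)
    show "b k \<le> exp (\<Sum>i<Suc k. a i) * b k"
      using mult_right_mono[of 1 "exp (\<Sum>i<Suc k. a i)" "b k"] a b by (simp add: sum_nonneg)
  qed (use a b in \<open>auto intro!: mult_nonneg_nonneg sum_nonneg\<close>)
  also have "\<dots> = exp (\<Sum>i<Suc k. a i) * (\<Sum>i<Suc k. b i)"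
    by (simp add: exp_add algebra_simps)
  finally show ?case .
qed (use assms in simp)

lemma set_integral_approx_const:
  fixes F :: "real \<Rightarrow> real"
  assumes F: "set_integrable lborel {s<..t} F" and "s \<le> t"
    and le: "\<And>r. s < r \<Longrightarrow> r \<le> t \<Longrightarrow> \<bar>F r - a\<bar> \<le> B"
  shows "\<bar>(LINT r:{s<..t}|lborel. F r) - (t - s) * a\<bar> \<le> B * (t - s)"
proof -
  have c: "set_integrable lborel {s<..t} (\<lambda>_. y)" for y :: real
    unfolding set_integrable_def
    by (intro integrable_scaleR_left integrable_real_indicator) (auto simp: emeasure_lborel_Ioc \<open>s \<le> t\<close>)
  have v: "(LINT r:{s<..t}|lborel. y) = (t - s) * y" for y :: real
    using \<open>s \<le> t\<close> by (simp add: set_lebesgue_integral_def)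
  have "(LINT r:{s<..t}|lborel. F r) \<le> (LINT r:{s<..t}|lborel. a + B)"
    "(LINT r:{s<..t}|lborel. a - B) \<le> (LINT r:{s<..t}|lborel. F r)"
    using le by (intro set_integral_mono F c; fastforce simp: abs_le_iff)+
  then show ?thesis by (simp only: v) (simp add: algebra_simps abs_le_iff)
qed

text \<open>\<open>S k\<close> stands for the sum of the jump coefficients over the k-th cell. The
  scheme thus sees the driving path through finitely many cell sums only, which decides what it is
  measurable for.\<close>

primrec euler_scheme :: "(real \<Rightarrow> real) \<Rightarrow> (real \<Rightarrow> real) \<Rightarrow> real \<Rightarrow> (nat \<Rightarrow> real) \<Rightarrow> real \<Rightarrow> nat \<Rightarrow> real" where
  "euler_scheme f g d S x 0 = x"
| "euler_scheme f g d S x (Suc k) =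
     (let y = euler_scheme f g d S x k in y + d * f y + S k * g y)"

text \<open>One fixed path of the equation: \<open>J\<close> is the set of jump times of the driving
  process and \<open>c u\<close> the value of \<open>h\<close> at the jump at time
  \<open>u\<close>.\<close>

locale jump_ode_path = bounded_lipschitz f L K for f :: "real \<Rightarrow> real" and L K +
  fixes g c z :: "real \<Rightarrow> real" and x T Lg Kg H :: real and J :: "real set"
  assumes finite_J: "finite J" and J_subset: "J \<subseteq> {0<..T}"
    and integrable_f: "\<And>t. 0 \<le> t \<Longrightarrow> t \<le> T \<Longrightarrow> set_integrable lborel {0..t} (\<lambda>s. f (z s))"
    and z_eq: "\<And>t. 0 \<le> t \<Longrightarrow> t \<le> T \<Longrightarrow>
      z t = x + (LINT s:{0..t}|lborel. f (z s)) + (\<Sum>u\<in>J \<inter> {..t}. c u * g (left_limit z u))"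
    and g_lipschitz: "\<And>a b. \<bar>g a - g b\<bar> \<le> Lg * \<bar>a - b\<bar>" and g_bound: "\<And>a. \<bar>g a\<bar> \<le> Kg"
    and c_bound: "\<And>u. \<bar>c u\<bar> \<le> H"
begin

abbreviation kick :: "real \<Rightarrow> real" where "kick u \<equiv> c u * g (left_limit z u)"

lemma z_0: "0 \<le> T \<Longrightarrow> z 0 = x"
proof -
  assume "0 \<le> T"
  moreover have "J \<inter> {..0} = {}" using J_subset by auto
  moreover have "(LINT s:{0..0::real}|lborel. f (z s)) = 0"
    unfolding set_lebesgue_integral_def
    by (rule integral_eq_zero_AE) (use AE_lborel_singleton[of 0] in \<open>auto elim!: eventually_mono\<close>)
  ultimately show ?thesis using z_eq[of 0] by simp
qed

lemma integrable_f_interval: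
  "0 \<le> s \<Longrightarrow> t \<le> T \<Longrightarrow> set_integrable lborel {s<..t} (\<lambda>r. f (z r))"
  by (cases "0 \<le> t", rule set_integrable_subset[OF integrable_f[of t]]) (auto simp: set_integrable_def)

lemma increment:
  assumes "0 \<le> s" "s \<le> t" "t \<le> T"
  shows "z t - z s = (LINT r:{s<..t}|lborel. f (z r)) + (\<Sum>u\<in>J \<inter> {s<..t}. kick u)"
proof -
  have "(LINT r:{0..s} \<union> {s<..t}|lborel. f (z r)) =
      (LINT r:{0..s}|lborel. f (z r)) + (LINT r:{s<..t}|lborel. f (z r))"
    by (rule set_integral_Un) (use assms integrable_f[of s] integrable_f_interval[of s t] in auto)
  moreover have "{0..s} \<union> {s<..t} = {0..t}" using assms by auto
  moreover have "(\<Sum>u\<in>J \<inter> {..t}. kick u) =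
      (\<Sum>u\<in>J \<inter> {..s}. kick u) + (\<Sum>u\<in>J \<inter> {s<..t}. kick u)"
    using assms finite_J by (subst sum.union_disjoint[symmetric]) (auto intro!: sum.cong)
  ultimately show ?thesis using assms z_eq[of s] z_eq[of t] by simp
qed

lemma increment_bound:
  assumes "0 \<le> s" "s \<le> t" "t \<le> T"
  shows "\<bar>z t - z s - (\<Sum>u\<in>J \<inter> {s<..t}. kick u)\<bar> \<le> K * (t - s)"
  using set_integral_approx_const[OF integrable_f_interval[OF assms(1,3)] assms(2), of 0 K] bound
    increment[OF assms] by simp

text \<open>A bootstrap: boundedness of \<open>f\<close> and the integral equation make the path
  Lipschitz; only then is the integrand close to \<open>f (z r)\<close> near \<open>r\<close>, so
  that the integral equation can be differentiated.\<close>

lemma flow_between_jumps: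
  assumes "0 \<le> s" "s \<le> t" "t \<le> T" and no_jump: "J \<inter> {s<..t} = {}"
  shows "z t = flow (t - s) (z s)"
proof (rule flow_unique[OF \<open>s \<le> t\<close>])
  have lip: "\<bar>z b - z a\<bar> \<le> K * \<bar>b - a\<bar>" if "s \<le> a" "a \<le> t" "s \<le> b" "b \<le> t" for a b
  proof -
    have *: "\<bar>z b - z a\<bar> \<le> K * (b - a)" if "s \<le> a" "a \<le> b" "b \<le> t" for a b
    proof -
      have "J \<inter> {a<..b} = {}" using no_jump that by auto
      then show ?thesis using increment_bound[of a b] that assms by simp
    qed
    show ?thesis using *[of a b] *[of b a] that by (cases "a \<le> b") (auto simp: abs_minus_commute)
  qed
  show "continuous_on {s..t} z"
    by (rule lipschitz_on_continuous_on[of K])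
      (use lip K_nonneg in \<open>auto intro!: lipschitz_onI simp: dist_real_def\<close>)
  fix r assume r: "s < r" "r < t"
  show "(z has_real_derivative f (z r)) (at r)"
  proof (rule has_real_derivative_quadratic_error)
    show "0 < min (r - s) (t - r)" using r by simp
    fix y assume y: "\<bar>y - r\<bar> < min (r - s) (t - r)"
    have near: "\<bar>f (z w) - f (z r)\<bar> \<le> L * (K * \<bar>y - r\<bar>)" if "\<bar>w - r\<bar> \<le> \<bar>y - r\<bar>" for w
    proof -
      have "\<bar>z w - z r\<bar> \<le> K * \<bar>w - r\<bar>" using that y r by (intro lip) auto
      also have "\<dots> \<le> K * \<bar>y - r\<bar>" using that K_nonneg by (intro mult_left_mono)
      finally show ?thesis
        using lipschitz[of "z w" "z r"] L_pos by (meson mult_left_mono order_trans less_imp_le)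
    qed
    show "\<bar>z y - z r - (y - r) * f (z r)\<bar> \<le> L * K * (y - r)\<^sup>2"
    proof (cases "r \<le> y")
      case True
      have "J \<inter> {r<..y} = {}" using no_jump y r by auto
      then have "z y - z r = (LINT w:{r<..y}|lborel. f (z w))"
        using increment[of r y] True y r assms by simp
      moreover have "\<bar>(LINT w:{r<..y}|lborel. f (z w)) - (y - r) * f (z r)\<bar> \<le> L * (K * \<bar>y - r\<bar>) * (y - r)"
        using True y r assms
        by (intro set_integral_approx_const integrable_f_interval near) auto
      ultimately show ?thesis using True by (simp add: power2_eq_square ac_simps)
    next
      case False
      have "J \<inter> {y<..r} = {}" using no_jump y r by auto
      then have "z r - z y = (LINT w:{y<..r}|lborel. f (z w))"
        using increment[of y r] False y r assms by simp
      moreover have "\<bar>(LINT w:{y<..r}|lborel. f (z w)) - (r - y) * f (z r)\<bar> \<le> L * (K * \<bar>y - r\<bar>) * (r - y)"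
        using False y r assms
        by (intro set_integral_approx_const integrable_f_interval near) auto
      moreover have "\<bar>z y - z r - (y - r) * f (z r)\<bar> = \<bar>z r - z y - (r - y) * f (z r)\<bar>"
        by (simp add: abs_if algebra_simps)
      moreover have "(y - r)\<^sup>2 = (r - y) * (r - y)" by (simp add: power2_eq_square algebra_simps)
      ultimately show ?thesis using False by (simp add: ac_simps)
    qed
  qed
qed

lemma left_limit_at_first_jump:
  assumes "0 \<le> s" "s < u" "u \<le> T" and no_jump: "J \<inter> {s<..<u} = {}"
  shows "(z \<longlongrightarrow> flow (u - s) (z s)) (at_left u)" "left_limit z u = flow (u - s) (z s)"
proof -
  have "((\<lambda>r. flow (r - s) (z s)) \<longlongrightarrow> flow (u - s) (z s)) (at_left u)"
  proof -
    have "isCont (\<lambda>t. flow t (z s)) (u - s)" using DERIV_isCont[OF flow_deriv] .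
    then show ?thesis by (rule isCont_tendsto_compose) (intro tendsto_intros)
  qed
  moreover have "\<forall>\<^sub>F r in at_left u. flow (r - s) (z s) = z r"
  proof (rule eventually_at_leftI[OF _ \<open>s < u\<close>])
    fix r assume "r \<in> {s<..<u}"
    moreover from this have "J \<inter> {s<..r} = {}" using no_jump by auto
    ultimately show "flow (r - s) (z s) = z r" using flow_between_jumps[of s r] assms by simp
  qed
  ultimately show "(z \<longlongrightarrow> flow (u - s) (z s)) (at_left u)" by (rule Lim_transform_eventually)
  then show "left_limit z u = flow (u - s) (z s)"
    unfolding left_limit_def by (intro tendsto_Lim) auto
qed

lemma jump_at_first_jump:
  assumes "0 \<le> s" "s < u" "u \<le> T" "u \<in> J" and no_jump: "J \<inter> {s<..<u} = {}"
  shows "z u = left_limit z u + kick u"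
proof -
  have "((\<lambda>r. z u - z r - kick u) \<longlongrightarrow> 0) (at_left u)"
  proof (rule Lim_null_comparison)
    show "\<forall>\<^sub>F r in at_left u. norm (z u - z r - kick u) \<le> K * (u - r)"
    proof (rule eventually_at_leftI[OF _ \<open>s < u\<close>])
      fix r assume r: "r \<in> {s<..<u}"
      then have "J \<inter> {r<..u} = {u}" using no_jump \<open>u \<in> J\<close> by auto
      then show "norm (z u - z r - kick u) \<le> K * (u - r)"
        using increment_bound[of r u] r assms by simp
    qed
    have "((\<lambda>r. K * (u - r)) \<longlongrightarrow> K * (u - u)) (at_left u)" by (intro tendsto_intros)
    then show "((\<lambda>r. K * (u - r)) \<longlongrightarrow> 0) (at_left u)" by simp
  qed
  moreover have "((\<lambda>r. z u - z r - kick u) \<longlongrightarrow>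
      z u - left_limit z u - kick u) (at_left u)"
    using left_limit_at_first_jump[OF assms(1-3) no_jump] by (intro tendsto_intros) simp
  ultimately have "z u - left_limit z u - kick u = 0"
    by (intro tendsto_unique[OF trivial_limit_at_left_real])
  then show ?thesis by simp
qed

lemma end_value_last_jump:
  assumes "0 \<le> s" "s < u" "u \<le> T" and only_jump: "J \<inter> {s<..T} = {u}"
  shows "z T = flow (T - u) (flow (u - s) (z s) + c u * g (flow (u - s) (z s)))"
proof -
  have u: "u \<in> J" using only_jump by blast
  have 1: "J \<inter> {s<..<u} = {}"
  proof -
    have "J \<inter> {s<..<u} \<subseteq> J \<inter> {s<..T}" using assms(2,3) by auto
    then show ?thesis unfolding only_jump by auto
  qed
  have "J \<inter> {u<..T} = {}"
  proof -
    have "J \<inter> {u<..T} \<subseteq> J \<inter> {s<..T}" using assms(2,3) by auto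
    then show ?thesis unfolding only_jump by auto
  qed
  then have "z T = flow (T - u) (z u)" using flow_between_jumps[of u T] assms by simp
  then show ?thesis
    using jump_at_first_jump[OF assms(1-3) u 1] left_limit_at_first_jump(2)[OF assms(1-3) 1] by simp
qed

text \<open>With at most one jump per cell, the path follows the flow from the start of the cell up
  to its jump, so the left limit in the jump coefficient is within \<open>K * d\<close> of the grid
  value used by the scheme. Several jumps in one cell would spoil this estimate.\<close>

lemma euler_error:
  assumes d: "0 < d" and N: "real N * d = q" "q \<le> T"
    and sep: "\<And>k. card (J \<inter> {real k * d<..real (Suc k) * d}) \<le> 1"
  shows "\<bar>z q - euler_scheme f g d (\<lambda>k. \<Sum>u\<in>J \<inter> {real k * d<..real (Suc k) * d}. c u) x N\<bar>
    \<le> exp (L * q + H * Lg * card J) * (d * (L * K * q + (L * H * Kg + H * Lg * K) * card J))"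
proof -
  define cell where "cell k = J \<inter> {real k * d<..real (Suc k) * d}" for k
  define n where "n k = real (card (cell k))" for k
  define \<zeta> where "\<zeta> = euler_scheme f g d (\<lambda>k. \<Sum>u\<in>cell k. c u) x"
  define e where "e k = \<bar>z (real k * d) - \<zeta> k\<bar>" for k
  have H: "0 \<le> H" using c_bound[of 0] by linarith
  have Lg: "0 \<le> Lg" using g_lipschitz[of 0 1] by simp
  have Kg: "0 \<le> Kg" using g_bound[of 0] by linarith
  have q: "0 \<le> q" using N d by (simp flip: N(1))
  \<comment> \<open>\<open>a k\<close> is the amplification of an inherited error over one cell and
    \<open>b k\<close> the error newly made there. Jumps enter through their number
    \<open>n k\<close>; hence the sum of all \<open>a k\<close> is bounded independently of
    \<open>d\<close>, while the sum of all \<open>b k\<close> is of order \<open>d\<close>.\<close>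
  define a where "a k = d * L + H * Lg * n k" for k
  define b where "b k = d * (L * (K * d + H * Kg * n k)) + H * Lg * (K * d) * n k" for k
  have step: "e (Suc k) \<le> (1 + a k) * e k + b k" if "k < N" for k
  proof -
    define s t where "s = real k * d" and "t = real (Suc k) * d"
    have st: "0 \<le> s" "s \<le> t" "t - s = d" using d by (simp_all add: s_def t_def algebra_simps)
    have "t \<le> real N * d" using that d by (simp only: t_def) (intro mult_right_mono; simp)
    then have tT: "t \<le> T" using N by simp
    have cell: "cell k = J \<inter> {s<..t}" by (simp add: cell_def s_def t_def)
    have left: "\<bar>left_limit z u - z s\<bar> \<le> K * d" if "u \<in> cell k" for u
    proof -
      have fin: "finite (cell k)" using finite_J by (simp add: cell_def)
      have "J \<inter> {s<..<u} = {}"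
      proof (rule ccontr)
        assume "J \<inter> {s<..<u} \<noteq> {}"
        then obtain v where v: "v \<in> J" "s < v" "v < u" by auto
        then have "v \<in> cell k" using that by (auto simp: cell)
        then have "card {u, v} \<le> card (cell k)" using that fin by (intro card_mono) auto
        then show False using v sep[of k] by (auto simp: cell_def)
      qed
      then have "left_limit z u = flow (u - s) (z s)"
        using left_limit_at_first_jump(2)[of s u] that st tT by (auto simp: cell)
      moreover have "\<bar>flow (u - s) (z s) - flow 0 (z s)\<bar> \<le> K * \<bar>u - s - 0\<bar>" by (rule flow_time_lipschitz)
      moreover have "K * \<bar>u - s\<bar> \<le> K * d" using that st K_nonneg by (intro mult_left_mono) (auto simp: cell)
      ultimately show ?thesis by simp
    qed
    have sum_g: "\<bar>\<Sum>u\<in>J \<inter> {s<..r}. kick u\<bar> \<le> H * Kg * n k" if "r \<le> t" for r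
    proof -
      have "\<bar>\<Sum>u\<in>J \<inter> {s<..r}. kick u\<bar> \<le> (\<Sum>u\<in>J \<inter> {s<..r}. \<bar>kick u\<bar>)"
        by (rule sum_abs)
      also have "\<dots> \<le> (\<Sum>u\<in>cell k. H * Kg)"
      proof (rule order_trans[OF sum_mono sum_mono2])
        show "\<bar>kick u\<bar> \<le> H * Kg" for u
          using c_bound g_bound H by (simp add: abs_mult mult_mono)
      qed (use finite_J H Kg that in \<open>auto simp: cell\<close>)
      finally show ?thesis by (simp add: n_def ac_simps)
    qed
    have near: "\<bar>f (z r) - f (z s)\<bar> \<le> L * (K * d + H * Kg * n k)" if r: "s < r" "r \<le> t" for r
    proof -
      have "\<bar>z r - z s - (\<Sum>u\<in>J \<inter> {s<..r}. kick u)\<bar> \<le> K * (r - s)"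
        using r st tT by (intro increment_bound) auto
      moreover have "K * (r - s) \<le> K * d" using r st K_nonneg by (intro mult_left_mono) auto
      ultimately have "\<bar>z r - z s\<bar> \<le> K * d + H * Kg * n k" using sum_g[OF r(2)] by linarith
      then show ?thesis
        using lipschitz[of "z r" "z s"] L_pos by (meson mult_left_mono order_trans less_imp_le)
    qed
    have 1: "\<bar>(LINT r:{s<..t}|lborel. f (z r)) - d * f (z s)\<bar> \<le> d * (L * (K * d + H * Kg * n k))"
      using set_integral_approx_const[of s t "\<lambda>r. f (z r)" "f (z s)" "L * (K * d + H * Kg * n k)"]
        integrable_f_interval[of s t] st tT near by (simp add: mult.commute)
    have 2: "\<bar>d * f (z s) - d * f (\<zeta> k)\<bar> \<le> d * (L * e k)"
      using mult_left_mono[OF lipschitz[of "z s" "\<zeta> k"], of d] d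
      by (simp add: e_def s_def abs_mult flip: right_diff_distrib)
    have 3: "\<bar>\<Sum>u\<in>cell k. c u * (g (left_limit z u) - g (\<zeta> k))\<bar> \<le> H * (Lg * (K * d + e k)) * n k"
    proof -
      have "\<bar>\<Sum>u\<in>cell k. c u * (g (left_limit z u) - g (\<zeta> k))\<bar> \<le> (\<Sum>u\<in>cell k. \<bar>c u * (g (left_limit z u) - g (\<zeta> k))\<bar>)"
        by (rule sum_abs)
      also have "\<dots> \<le> (\<Sum>u\<in>cell k. H * (Lg * (K * d + e k)))"
      proof (rule sum_mono)
        fix u assume u: "u \<in> cell k"
        have "\<bar>left_limit z u - \<zeta> k\<bar> \<le> K * d + e k" using left[OF u] by (simp add: e_def s_def)
        then have "\<bar>g (left_limit z u) - g (\<zeta> k)\<bar> \<le> Lg * (K * d + e k)"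
          using g_lipschitz[of "left_limit z u" "\<zeta> k"] Lg by (meson mult_left_mono order_trans)
        then show "\<bar>c u * (g (left_limit z u) - g (\<zeta> k))\<bar> \<le> H * (Lg * (K * d + e k))"
          using c_bound[of u] H by (simp add: abs_mult mult_mono)
      qed
      finally show ?thesis by (simp add: n_def mult.commute)
    qed
    have "z t - z s = (LINT r:{s<..t}|lborel. f (z r)) + (\<Sum>u\<in>cell k. kick u)"
      using increment[of s t] st tT by (simp add: cell)
    moreover have "\<zeta> (Suc k) = \<zeta> k + d * f (\<zeta> k) + (\<Sum>u\<in>cell k. c u) * g (\<zeta> k)"
      by (simp add: \<zeta>_def Let_def)
    ultimately have "z t - \<zeta> (Suc k) = (z s - \<zeta> k) + ((LINT r:{s<..t}|lborel. f (z r)) - d * f (z s))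
       + (d * f (z s) - d * f (\<zeta> k)) + (\<Sum>u\<in>cell k. c u * (g (left_limit z u) - g (\<zeta> k)))"
      by (simp add: right_diff_distrib sum_subtractf sum_distrib_right)
    then have "e (Suc k) \<le> e k + d * (L * (K * d + H * Kg * n k)) + d * (L * e k) + H * (Lg * (K * d + e k)) * n k"
      using 1 2 3 unfolding e_def t_def[symmetric] s_def[symmetric] by linarith
    also have "\<dots> = (1 + a k) * e k + b k" by (simp add: a_def b_def algebra_simps)
    finally show ?thesis .
  qed
  have sum_n: "(\<Sum>k<N. n k) \<le> card J"
  proof -
    have disj: "disjoint_family_on cell {..<N}"
      unfolding disjoint_family_on_def
    proof (intro ballI impI)
      fix i j :: nat assume "i \<noteq> j"
      have *: "cell i \<inter> cell j = {}" if "i < j" for i j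
      proof -
        have "real (Suc i) * d \<le> real j * d" using that d by (intro mult_right_mono) auto
        then show ?thesis by (auto simp: cell_def)
      qed
      show "cell i \<inter> cell j = {}" using \<open>i \<noteq> j\<close> *[of i j] *[of j i] by (metis Int_commute linorder_neqE_nat)
    qed
    have "(\<Sum>k<N. card (cell k)) = card (\<Union>k<N. cell k)"
      by (rule card_UN_disjoint[symmetric])
        (use disj finite_J in \<open>auto simp: disjoint_family_on_def cell_def\<close>)
    also have "\<dots> \<le> card J" using finite_J by (intro card_mono) (auto simp: cell_def)
    finally show ?thesis by (simp add: n_def flip: of_nat_sum)
  qed
  have "e N \<le> exp (\<Sum>i<N. a i) * (\<Sum>i<N. b i)"
  proof (rule discrete_gronwall[where N = N])
    show "e 0 \<le> 0" using z_0 N q by (simp add: e_def \<zeta>_def)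
    show "0 \<le> a k" "0 \<le> b k" for k using d L_pos H Lg Kg K_nonneg
      by (auto simp: a_def b_def n_def intro!: add_nonneg_nonneg mult_nonneg_nonneg)
  qed (use step in auto)
  also have "\<dots> \<le> exp (L * q + H * Lg * card J) * (d * (L * K * q + (L * H * Kg + H * Lg * K) * card J))"
  proof (intro mult_mono)
    have "(\<Sum>i<N. a i) = L * q + H * Lg * (\<Sum>i<N. n i)"
      by (simp add: a_def sum.distrib sum_distrib_left flip: N(1))
    then show "exp (\<Sum>i<N. a i) \<le> exp (L * q + H * Lg * card J)"
      using sum_n H Lg by (simp add: mult_left_mono)
    have "(\<Sum>i<N. b i) = d * (L * K * q + (L * H * Kg + H * Lg * K) * (\<Sum>i<N. n i))"
    proof -
      have "b i = d * (L * K * d) + d * (L * H * Kg + H * Lg * K) * n i" for i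
        by (simp add: b_def algebra_simps)
      then have "(\<Sum>i<N. b i) = real N * (d * (L * K * d)) + d * (L * H * Kg + H * Lg * K) * (\<Sum>i<N. n i)"
        by (simp add: sum.distrib sum_distrib_left)
      also have "\<dots> = d * (L * K * (real N * d) + (L * H * Kg + H * Lg * K) * (\<Sum>i<N. n i))"
        by (simp only: distrib_left ac_simps)
      finally show ?thesis by (simp only: N(1))
    qed
    also have "\<dots> \<le> d * (L * K * q + (L * H * Kg + H * Lg * K) * card J)"
      using sum_n d L_pos H Lg Kg K_nonneg
      by (intro mult_left_mono add_left_mono add_nonneg_nonneg mult_nonneg_nonneg) auto
    finally show "(\<Sum>i<N. b i) \<le> d * (L * K * q + (L * H * Kg + H * Lg * K) * card J)" .
    show "0 \<le> (\<Sum>i<N. b i)" using d L_pos H Lg Kg K_nonneg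
      by (auto simp: b_def n_def intro!: sum_nonneg add_nonneg_nonneg mult_nonneg_nonneg)
  qed simp
  finally show ?thesis by (simp add: e_def \<zeta>_def N(1) cell_def)
qed

text \<open>There are finitely many jump times, so the separation assumption of
  \<open>euler_error\<close> holds as soon as the mesh is below their least distance.\<close>

lemma euler_tendsto:
  assumes d: "\<And>n. 0 < d n" "d \<longlonglongrightarrow> 0" and N: "\<forall>\<^sub>F n in sequentially. real (N n) * d n = q" "q \<le> T"
  shows "(\<lambda>n. euler_scheme f g (d n) (\<lambda>k. \<Sum>u\<in>J \<inter> {real k * d n<..real (Suc k) * d n}. c u) x (N n)) \<longlonglongrightarrow> z q"
proof (rule LIM_zero_cancel, rule Lim_null_comparison)
  obtain \<rho> where \<rho>: "0 < \<rho>" "\<And>u v. u \<in> J \<Longrightarrow> v \<in> J \<Longrightarrow> \<bar>u - v\<bar> < \<rho> \<Longrightarrow> u = v"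
    using finite_real_separated[OF finite_J] by blast
  show "\<forall>\<^sub>F n in sequentially.
      norm (euler_scheme f g (d n) (\<lambda>k. \<Sum>u\<in>J \<inter> {real k * d n<..real (Suc k) * d n}. c u) x (N n) - z q)
      \<le> exp (L * q + H * Lg * card J) * (d n * (L * K * q + (L * H * Kg + H * Lg * K) * card J))"
    using order_tendstoD(2)[OF d(2) \<rho>(1)] N(1)
  proof eventually_elim
    case (elim n)
    have "card (J \<inter> {real k * d n<..real (Suc k) * d n}) \<le> 1" for k
    proof -
      have "u = v" if "u \<in> J \<inter> {real k * d n<..real (Suc k) * d n}" "v \<in> J \<inter> {real k * d n<..real (Suc k) * d n}" for u v
      proof -
        have "\<bar>u - v\<bar> < real (Suc k) * d n - real k * d n" using that by auto
        also have "\<dots> = d n" by (simp add: algebra_simps)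
        finally show ?thesis using that \<rho>(2) elim by auto
      qed
      then show ?thesis using finite_J by (simp add: card_le_Suc0_iff_eq)
    qed
    then show ?case using euler_error[OF d(1) elim(2) N(2)] by (simp add: abs_minus_commute)
  qed
  have "(\<lambda>n. exp (L * q + H * Lg * card J) * (d n * (L * K * q + (L * H * Kg + H * Lg * K) * card J)))
      \<longlonglongrightarrow> exp (L * q + H * Lg * card J) * (0 * (L * K * q + (L * H * Kg + H * Lg * K) * card J))"
    by (intro tendsto_intros d)
  then show "(\<lambda>n. exp (L * q + H * Lg * card J) * (d n * (L * K * q + (L * H * Kg + H * Lg * K) * card J))) \<longlonglongrightarrow> 0"
    by simp
qed

end

section \<open>Augmented sigma-algebras and random finite sets of marks\<close>

text \<open>Outside the exceptional null set \<open>F\<close> is the pointwise \<open>lim\<close>,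
  which is measurable for \<open>S\<close>. Inside it, completeness makes every part of a preimage a
  null set, and \<open>S\<close> contains the null sets.\<close>

lemma borel_measurable_AE_limit:
  fixes F :: "'a \<Rightarrow> real" and f :: "nat \<Rightarrow> 'a \<Rightarrow> real"
  assumes "complete_measure M" and space: "space S = space M" and null: "null_sets M \<subseteq> sets S"
    and f: "\<And>n. f n \<in> borel_measurable S" and lim: "AE \<omega> in M. (\<lambda>n. f n \<omega>) \<longlonglongrightarrow> F \<omega>"
  shows "F \<in> borel_measurable S"
proof (rule measurableI)
  interpret complete_measure M by fact
  obtain N where N: "N \<in> null_sets M" "{\<omega>\<in>space M. \<not> (\<lambda>n. f n \<omega>) \<longlonglongrightarrow> F \<omega>} \<subseteq> N"
    using lim by (auto simp: eventually_ae_filter)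
  fix B :: "real set" assume B: "B \<in> sets borel"
  have "(\<lambda>\<omega>. lim (\<lambda>n. f n \<omega>)) \<in> borel_measurable S" using f by measurable
  then have "(\<lambda>\<omega>. lim (\<lambda>n. f n \<omega>)) -` B \<inter> space S - N \<in> sets S"
    using B null N(1) by (blast intro: measurable_sets)
  moreover have "F -` B \<inter> N \<in> sets S"
    using null complete[of "F -` B \<inter> N" N] N(1) null_sets_subset[of N M "F -` B \<inter> N"] by auto
  moreover have "F -` B \<inter> space S = ((\<lambda>\<omega>. lim (\<lambda>n. f n \<omega>)) -` B \<inter> space S - N) \<union> F -` B \<inter> N"
    using N null_setsD2[OF N(1)] sets.sets_into_space by (auto simp: space limI)
  ultimately show "F -` B \<inter> space S \<in> sets S" by auto
qed simp

lemma borel_measurable_AE_eq: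
  fixes F G :: "'a \<Rightarrow> real"
  assumes "complete_measure M" "space S = space M" "null_sets M \<subseteq> sets S"
    and "G \<in> borel_measurable S" "AE \<omega> in M. G \<omega> = F \<omega>"
  shows "F \<in> borel_measurable S"
  by (rule borel_measurable_AE_limit[OF assms(1-3), of "\<lambda>_. G"]) (use assms(4,5) in auto)

text \<open>Events that agree with a member of \<open>F\<close> up to a null set are added, so that
  almost sure limits stay measurable while independence is kept.\<close>

definition augmented :: "'a measure \<Rightarrow> 'a set set \<Rightarrow> 'a measure" where
  "augmented M F = sigma (space M) {A \<in> sets M. \<exists>B\<in>F. sym_diff A B \<in> null_sets M}"

lemma
  shows space_augmented: "space (augmented M F) = space M"
    and sets_augmented: "sets (augmented M F) =
      sigma_sets (space M) {A \<in> sets M. \<exists>B\<in>F. sym_diff A B \<in> null_sets M}"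
  using sets.sets_into_space by (auto simp: augmented_def space_measure_of_conv intro!: sets_measure_of)

lemma subset_sets_augmented: "F \<subseteq> sets M \<Longrightarrow> F \<subseteq> sets (augmented M F)"
  unfolding sets_augmented by (auto intro!: sigma_sets.Basic bexI)

lemma null_sets_subset_augmented: "{} \<in> F \<Longrightarrow> null_sets M \<subseteq> sets (augmented M F)"
  unfolding sets_augmented by (auto intro!: sigma_sets.Basic bexI[of _ "{}"])

lemma sets_augmented_subset: "sets (augmented M F) \<subseteq> sets M"
  unfolding sets_augmented by (rule sets.sigma_sets_subset) auto

text \<open>The product rule sees events only up to null sets, and the enlarged families are again
  stable under intersection; so independence extends to the generated sigma-algebras.\<close>

lemma (in prob_space) indep_set_augmented:
  assumes F: "Int_stable F" "F \<subseteq> events" and G: "Int_stable G" "G \<subseteq> events"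
    and indep: "indep_set F G"
  shows "indep_set (sets (augmented M F)) (sets (augmented M G))"
  unfolding sets_augmented
proof (rule indep_set_sigma_sets)
  let ?aug = "\<lambda>F. {A \<in> events. \<exists>B\<in>F. sym_diff A B \<in> null_sets M}"
  have eq: "prob A = prob B" if "A \<in> events" "B \<in> events" "sym_diff A B \<in> null_sets M" for A B
  proof (rule finite_measure_eq_AE)
    have "AE \<omega> in M. \<omega> \<notin> sym_diff A B" using that(3) by (rule AE_not_in)
    then show "AE \<omega> in M. \<omega> \<in> A \<longleftrightarrow> \<omega> \<in> B" by eventually_elim auto
  qed (use that in auto)
  have inter: "sym_diff (A \<inter> A') (B \<inter> B') \<in> null_sets M"
    if "A \<in> events" "A' \<in> events" "B \<in> events" "B' \<in> events"
      "sym_diff A B \<in> null_sets M" "sym_diff A' B' \<in> null_sets M" for A A' B B'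
    by (rule null_sets_subset[OF null_sets.Un[OF that(5,6)]]) (use that(1-4) in auto)
  show "indep_set (?aug F) (?aug G)"
  proof (rule indep_setI)
    fix A A' assume "A \<in> ?aug F" "A' \<in> ?aug G"
    then obtain B B' where B: "A \<in> events" "A' \<in> events" "B \<in> F" "B' \<in> G" "sym_diff A B \<in> null_sets M" "sym_diff A' B' \<in> null_sets M"
      by auto
    then have B': "B \<in> events" "B' \<in> events" using F G by auto
    have "prob (A \<inter> A') = prob (B \<inter> B')" using B B' by (intro eq inter) auto
    also have "\<dots> = prob B * prob B'" using indep_setD[OF indep] B by simp
    also have "\<dots> = prob A * prob A'" using B B' by (simp add: eq[of A B] eq[of A' B'])
    finally show "prob (A \<inter> A') = prob A * prob A'" .
  qed auto
  have stable: "Int_stable (?aug F)" if "Int_stable F" "F \<subseteq> events" for F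
  proof (rule Int_stableI)
    fix A A' assume "A \<in> ?aug F" "A' \<in> ?aug F"
    then obtain B B' where B: "A \<in> events" "A' \<in> events" "B \<in> F" "B' \<in> F" "sym_diff A B \<in> null_sets M" "sym_diff A' B' \<in> null_sets M"
      by auto
    moreover have "B \<inter> B' \<in> F" using that B by (auto simp: Int_stable_def)
    ultimately show "A \<inter> A' \<in> ?aug F" using that(2) inter[of A A' B B'] by blast
  qed
  show "Int_stable (?aug F)" "Int_stable (?aug G)" using stable F G by auto
qed

lemma (in prob_space) nn_integral_indicator_indep:
  assumes S: "sets S \<subseteq> events" "space S = space M"
    and indep: "\<And>B. B \<in> sets S \<Longrightarrow> prob (C \<inter> B) = prob C * prob B" and C: "C \<in> events"
    and Y: "Y \<in> borel_measurable S"
  shows "(\<integral>\<^sup>+\<omega>. indicator C \<omega> * Y \<omega> \<partial>M) = emeasure M C * (\<integral>\<^sup>+\<omega>. Y \<omega> \<partial>M)"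
proof -
  have meas: "u \<in> borel_measurable M" if "u \<in> borel_measurable S" for u :: "'a \<Rightarrow> ennreal"
    using that S by (auto simp: measurable_def)
  have [measurable]: "C \<in> events" by fact
  show ?thesis using Y
  proof (induction rule: borel_measurable_induct)
    case (cong f g)
    have "(\<integral>\<^sup>+\<omega>. indicator C \<omega> * f \<omega> \<partial>M) = (\<integral>\<^sup>+\<omega>. indicator C \<omega> * g \<omega> \<partial>M)"
      "(\<integral>\<^sup>+\<omega>. f \<omega> \<partial>M) = (\<integral>\<^sup>+\<omega>. g \<omega> \<partial>M)"
      using cong.hyps(3) S(2) by (auto intro!: nn_integral_cong)
    then show ?case using cong by simp
  next
    case (set A)
    then have A: "A \<in> events" using S by auto
    then have "(\<integral>\<^sup>+\<omega>. indicator C \<omega> * indicator A \<omega> \<partial>M) = emeasure M (C \<inter> A)"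
      by (simp add: indicator_inter_arith[symmetric] nn_integral_indicator)
    also have "\<dots> = emeasure M C * emeasure M A"
      using indep[OF set.hyps] by (simp add: emeasure_eq_measure ennreal_mult'')
    finally show ?case using A by simp
  next
    case (mult u c)
    note [measurable] = meas[OF mult.hyps(2)]
    have "(\<integral>\<^sup>+\<omega>. indicator C \<omega> * (c * u \<omega>) \<partial>M) = c * (\<integral>\<^sup>+\<omega>. indicator C \<omega> * u \<omega> \<partial>M)"
      by (subst nn_integral_cmult[symmetric]) (auto simp: ac_simps)
    then show ?case using mult by (simp add: nn_integral_cmult ac_simps)
  next
    case (add u v)
    note [measurable] = meas[OF add.hyps(1)] meas[OF add.hyps(3)]
    show ?case using add by (simp add: nn_integral_add distrib_left)
  next
    case (seq U)
    note [measurable] = meas[OF seq.hyps(1)]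
    have "(\<integral>\<^sup>+\<omega>. indicator C \<omega> * (SUP i. U i) \<omega> \<partial>M) = (\<integral>\<^sup>+\<omega>. (SUP i. indicator C \<omega> * U i \<omega>) \<partial>M)"
      by (simp add: SUP_mult_left_ennreal image_comp)
    also have "\<dots> = (SUP i. \<integral>\<^sup>+\<omega>. indicator C \<omega> * U i \<omega> \<partial>M)"
      using seq.hyps(3) by (intro nn_integral_monotone_convergence_SUP) (auto simp: incseq_def le_fun_def mult_left_mono)
    also have "\<dots> = emeasure M C * (SUP i. \<integral>\<^sup>+\<omega>. U i \<omega> \<partial>M)"
      by (simp add: seq.IH SUP_mult_left_ennreal)
    also have "(SUP i. \<integral>\<^sup>+\<omega>. U i \<omega> \<partial>M) = (\<integral>\<^sup>+\<omega>. (SUP i. U i \<omega>) \<partial>M)"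
      using seq.hyps(3) by (intro nn_integral_monotone_convergence_SUP[symmetric]) auto
    also have "\<dots> = (\<integral>\<^sup>+\<omega>. (SUP i. U i) \<omega> \<partial>M)"
      by (intro nn_integral_cong) (simp add: image_comp)
    finally show ?case .
  qed
qed

text \<open>Characteristic functions converge by dominated convergence and determine the law. This
  carries the stationarity of increments over to sums and counts of jumps.\<close>

lemma (in prob_space) distr_eq_AE_limit:
  fixes f g :: "nat \<Rightarrow> 'a \<Rightarrow> real"
  assumes [measurable]: "\<And>n. f n \<in> borel_measurable M" "\<And>n. g n \<in> borel_measurable M"
      "F \<in> borel_measurable M" "G \<in> borel_measurable M"
    and eq: "\<And>n. distr M borel (f n) = distr M borel (g n)"
    and f: "AE \<omega> in M. (\<lambda>n. f n \<omega>) \<longlonglongrightarrow> F \<omega>" and g: "AE \<omega> in M. (\<lambda>n. g n \<omega>) \<longlonglongrightarrow> G \<omega>"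
  shows "distr M borel F = distr M borel G"
proof (rule Levy_uniqueness)
  have char_lim: "(\<lambda>n. char (distr M borel (f n)) t) \<longlonglongrightarrow> char (distr M borel F) t"
    if [measurable]: "\<And>n. f n \<in> borel_measurable M" "F \<in> borel_measurable M"
      and f: "AE \<omega> in M. (\<lambda>n. f n \<omega>) \<longlonglongrightarrow> F \<omega>" for f and F :: "'a \<Rightarrow> real" and t
  proof -
    have "(\<lambda>n. \<integral>\<omega>. iexp (t * f n \<omega>) \<partial>M) \<longlonglongrightarrow> (\<integral>\<omega>. iexp (t * F \<omega>) \<partial>M)"
    proof (rule integral_dominated_convergence[where w = "\<lambda>_. 1"])
      show "AE \<omega> in M. (\<lambda>n. iexp (t * f n \<omega>)) \<longlonglongrightarrow> iexp (t * F \<omega>)"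
        using f by eventually_elim (intro tendsto_intros)
    qed auto
    then show ?thesis by (simp add: char_def integral_distr)
  qed
  show "char (distr M borel F) = char (distr M borel G)"
  proof
    fix t
    have "(\<lambda>n. char (distr M borel (f n)) t) \<longlonglongrightarrow> char (distr M borel F) t"
      by (rule char_lim) (use f in auto)
    moreover have "(\<lambda>n. char (distr M borel (g n)) t) \<longlonglongrightarrow> char (distr M borel G) t"
      by (rule char_lim) (use g in auto)
    ultimately show "char (distr M borel F) t = char (distr M borel G) t"
      by (intro LIMSEQ_unique[of "\<lambda>n. char (distr M borel (f n)) t"]) (simp_all add: eq)
  qed
qed (auto intro: real_distribution_distr)

section \<open>Counting the marks of a random finite set\<close>

abbreviation card_marks :: "('a \<Rightarrow> 'i set) \<Rightarrow> ('a \<Rightarrow> 'i \<Rightarrow> 'b) \<Rightarrow> 'b set \<Rightarrow> 'a \<Rightarrow> real" where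
  "card_marks I Y A \<omega> \<equiv> real (card {u \<in> I \<omega>. Y \<omega> u \<in> A})"

text \<open>Dynkin argument in \<open>A\<close>: finiteness of \<open>I \<omega>\<close> turns
  complements into differences from the total count and disjoint unions into series. The total is a
  separate premise because \<open>\<Omega>\<close> itself may be missing from
  \<open>E\<close>.\<close>

lemma borel_measurable_card_marks:
  fixes I :: "'a \<Rightarrow> 'i set" and Y :: "'a \<Rightarrow> 'i \<Rightarrow> 'b"
  assumes fin: "\<And>\<omega>. \<omega> \<in> space S \<Longrightarrow> finite (I \<omega>)"
    and mark: "\<And>\<omega> u. \<omega> \<in> space S \<Longrightarrow> u \<in> I \<omega> \<Longrightarrow> Y \<omega> u \<in> \<Omega>"
    and E: "Int_stable E" "E \<subseteq> Pow \<Omega>" and A: "A \<in> sigma_sets \<Omega> E"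
    and total: "(\<lambda>\<omega>. real (card (I \<omega>))) \<in> borel_measurable S"
    and gen: "\<And>A. A \<in> E \<Longrightarrow> (\<lambda>\<omega>. card_marks I Y A \<omega>) \<in> borel_measurable S"
  shows "(\<lambda>\<omega>. card_marks I Y A \<omega>) \<in> borel_measurable S"
  using E A
proof (induction rule: sigma_sets_induct_disjoint)
  case (basic A) then show ?case by (rule gen)
next
  case (compl A)
  have "(\<lambda>\<omega>. real (card (I \<omega>)) - card_marks I Y A \<omega>) \<in> borel_measurable S"
    using total compl(2) by simp
  moreover have "real (card {u \<in> I \<omega>. Y \<omega> u \<in> \<Omega> - A}) = real (card (I \<omega>)) - card_marks I Y A \<omega>"
    if "\<omega> \<in> space S" for \<omega>
  proof -
    have "{u \<in> I \<omega>. Y \<omega> u \<in> \<Omega> - A} = I \<omega> - {u \<in> I \<omega>. Y \<omega> u \<in> A}" using mark[OF that] by auto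
    moreover have "card {u \<in> I \<omega>. Y \<omega> u \<in> A} \<le> card (I \<omega>)" using fin[OF that] by (intro card_mono) auto
    ultimately show ?thesis using fin[OF that] by (simp add: card_Diff_subset)
  qed
  ultimately show ?case by (simp cong: measurable_cong)
next
  case (union A)
  have "(\<lambda>\<omega>. \<Sum>i. card_marks I Y (A i) \<omega>) \<in> borel_measurable S"
    using union.IH by measurable
  moreover have "real (card {u \<in> I \<omega>. Y \<omega> u \<in> (\<Union>i. A i)}) = (\<Sum>i. card_marks I Y (A i) \<omega>)"
    if \<omega>: "\<omega> \<in> space S" for \<omega>
  proof -
    have m: "measure (count_space (I \<omega>)) {u \<in> I \<omega>. Y \<omega> u \<in> B} = card_marks I Y B \<omega>" for B
      using finite_subset[OF _ fin[OF \<omega>], of "{u \<in> I \<omega>. Y \<omega> u \<in> B}"]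
      by (simp add: measure_def emeasure_count_space ennreal_of_nat_eq_real_of_nat)
    have "(\<lambda>i. measure (count_space (I \<omega>)) {u \<in> I \<omega>. Y \<omega> u \<in> A i}) sums
        measure (count_space (I \<omega>)) (\<Union>i. {u \<in> I \<omega>. Y \<omega> u \<in> A i})"
    proof (rule measure_UNION)
      have "finite (\<Union>i. {u \<in> I \<omega>. Y \<omega> u \<in> A i})" by (rule finite_subset[OF _ fin[OF \<omega>]]) auto
      then show "emeasure (count_space (I \<omega>)) (\<Union>i. {u \<in> I \<omega>. Y \<omega> u \<in> A i}) \<noteq> \<infinity>"
        by (subst emeasure_count_space) auto
    qed (use union.hyps(1) in \<open>auto simp: disjoint_family_on_def\<close>)
    moreover have "(\<Union>i. {u \<in> I \<omega>. Y \<omega> u \<in> A i}) = {u \<in> I \<omega>. Y \<omega> u \<in> (\<Union>i. A i)}" by auto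
    ultimately show ?thesis by (simp only: m sums_iff)
  qed
  ultimately show ?case by (simp cong: measurable_cong)
qed simp

lemma borel_measurable_sum_marks:
  fixes I :: "'a \<Rightarrow> 'i set" and Y :: "'a \<Rightarrow> 'i \<Rightarrow> 'b" and F :: "'b \<Rightarrow> real"
  assumes fin: "\<And>\<omega>. \<omega> \<in> space S \<Longrightarrow> finite (I \<omega>)"
    and mark: "\<And>\<omega> u. \<omega> \<in> space S \<Longrightarrow> u \<in> I \<omega> \<Longrightarrow> Y \<omega> u \<in> space N"
    and card: "\<And>A. A \<in> sets N \<Longrightarrow> (\<lambda>\<omega>. card_marks I Y A \<omega>) \<in> borel_measurable S"
    and F: "F \<in> borel_measurable N"
  shows "(\<lambda>\<omega>. \<Sum>u\<in>I \<omega>. F (Y \<omega> u)) \<in> borel_measurable S"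
proof -
  have nn: "(\<lambda>\<omega>. \<Sum>u\<in>I \<omega>. H (Y \<omega> u)) \<in> borel_measurable S" if "H \<in> borel_measurable N" for H :: "'b \<Rightarrow> ennreal"
    using that
  proof (induction rule: borel_measurable_induct)
    case (cong f g)
    then show ?case using mark by (simp cong: measurable_cong sum.cong)
  next
    case (set A)
    have "(\<lambda>\<omega>. ennreal (card_marks I Y A \<omega>)) \<in> borel_measurable S"
      using card[OF set] by measurable
    moreover have "(\<Sum>u\<in>I \<omega>. indicator A (Y \<omega> u)) = ennreal (card_marks I Y A \<omega>)"
      if "\<omega> \<in> space S" for \<omega>
    proof -
      have "(\<Sum>u\<in>I \<omega>. indicator A (Y \<omega> u)) = (\<Sum>u\<in>I \<omega>. if Y \<omega> u \<in> A then 1 else 0 :: ennreal)"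
        by (intro sum.cong) (auto simp: indicator_def)
      also have "\<dots> = of_nat (card {u \<in> I \<omega>. Y \<omega> u \<in> A})"
        using fin[OF that] by (simp add: sum.If_cases Int_def)
      finally show ?thesis by (simp add: ennreal_of_nat_eq_real_of_nat)
    qed
    ultimately show ?case by (simp cong: measurable_cong)
  next
    case (mult u c)
    then show ?case by (simp flip: sum_distrib_left)
  next
    case (add u v)
    then show ?case by (simp add: sum.distrib)
  next
    case (seq U)
    have "(\<lambda>\<omega>. SUP i. \<Sum>u\<in>I \<omega>. U i (Y \<omega> u)) \<in> borel_measurable S" using seq by measurable
    moreover have "(\<Sum>u\<in>I \<omega>. (SUP i. U i) (Y \<omega> u)) = (SUP i. \<Sum>u\<in>I \<omega>. U i (Y \<omega> u))"
      if "\<omega> \<in> space S" for \<omega>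
    proof -
      have "(\<Sum>u\<in>I \<omega>. SUP i. U i (Y \<omega> u)) = (SUP i. \<Sum>u\<in>I \<omega>. U i (Y \<omega> u))"
        using seq.hyps(3) by (intro ennreal_SUP_sum[symmetric]) (auto simp: incseq_def le_fun_def)
      then show ?thesis by (simp add: image_comp)
    qed
    ultimately show ?case by (simp cong: measurable_cong)
  qed
  \<comment> \<open>\<open>ennreal\<close> sends negative reals to 0, so these are the sums of the
    positive and of the negative parts.\<close>
  have "(\<lambda>\<omega>. enn2real (\<Sum>u\<in>I \<omega>. ennreal (F (Y \<omega> u))) - enn2real (\<Sum>u\<in>I \<omega>. ennreal (- F (Y \<omega> u)))) \<in> borel_measurable S"
    by (intro borel_measurable_diff borel_measurable_enn2real nn) (use F in measurable)
  moreover have "(\<Sum>u\<in>I \<omega>. F (Y \<omega> u)) =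
      enn2real (\<Sum>u\<in>I \<omega>. ennreal (F (Y \<omega> u))) - enn2real (\<Sum>u\<in>I \<omega>. ennreal (- F (Y \<omega> u)))" for \<omega>
  proof -
    have pos: "enn2real (\<Sum>u\<in>I \<omega>. ennreal (G u)) = (\<Sum>u\<in>I \<omega>. max 0 (G u))" for G
    proof -
      have "(\<Sum>u\<in>I \<omega>. ennreal (G u)) = ennreal (\<Sum>u\<in>I \<omega>. max 0 (G u))"
        by (subst sum_ennreal[symmetric]) (auto intro!: sum.cong simp: max_def ennreal_neg simp del: sum_ennreal)
      then show ?thesis by (simp add: sum_nonneg)
    qed
    show ?thesis unfolding pos by (subst sum_subtractf[symmetric]) (auto intro!: sum.cong simp: max_def)
  qed
  ultimately show ?thesis by simp
qed

text \<open>The mean measure of the point process formed by the marks.\<close>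

definition mark_intensity :: "'a measure \<Rightarrow> ('a \<Rightarrow> 'i set) \<Rightarrow> ('a \<Rightarrow> 'i \<Rightarrow> 'b) \<Rightarrow> 'b measure \<Rightarrow> 'b measure" where
  "mark_intensity M I Y N = measure_of (space N) (sets N)
     (\<lambda>A. \<integral>\<^sup>+\<omega>. ennreal (card_marks I Y A \<omega>) \<partial>M)"

lemma
  shows space_mark_intensity [simp]: "space (mark_intensity M I Y N) = space N"
    and sets_mark_intensity [simp, measurable_cong]: "sets (mark_intensity M I Y N) = sets N"
  by (simp_all add: mark_intensity_def)

lemma emeasure_mark_intensity:
  assumes fin: "\<And>\<omega>. \<omega> \<in> space M \<Longrightarrow> finite (I \<omega>)"
    and card: "\<And>A. A \<in> sets N \<Longrightarrow> (\<lambda>\<omega>. card_marks I Y A \<omega>) \<in> borel_measurable M"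
    and A: "A \<in> sets N"
  shows "emeasure (mark_intensity M I Y N) A = (\<integral>\<^sup>+\<omega>. ennreal (card_marks I Y A \<omega>) \<partial>M)"
  unfolding mark_intensity_def
proof (rule emeasure_measure_of_sigma[OF sets.sigma_algebra_axioms _ _ A])
  show "positive (sets N) (\<lambda>A. \<integral>\<^sup>+\<omega>. ennreal (card_marks I Y A \<omega>) \<partial>M)"
    by (simp add: positive_def)
  show "countably_additive (sets N) (\<lambda>A. \<integral>\<^sup>+\<omega>. ennreal (card_marks I Y A \<omega>) \<partial>M)"
  proof (rule countably_additiveI)
    fix A :: "nat \<Rightarrow> _" assume A: "range A \<subseteq> sets N" "disjoint_family A" "(\<Union>i. A i) \<in> sets N"
    have "(\<Sum>i. \<integral>\<^sup>+\<omega>. ennreal (card_marks I Y (A i) \<omega>) \<partial>M) =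
        (\<integral>\<^sup>+\<omega>. (\<Sum>i. ennreal (card_marks I Y (A i) \<omega>)) \<partial>M)"
      using A card by (intro nn_integral_suminf[symmetric]) (auto intro!: measurable_compose[OF _ measurable_ennreal])
    also have "\<dots> = (\<integral>\<^sup>+\<omega>. ennreal (real (card {u \<in> I \<omega>. Y \<omega> u \<in> (\<Union>i. A i)})) \<partial>M)"
    proof (rule nn_integral_cong)
      fix \<omega> assume \<omega>: "\<omega> \<in> space M"
      have e: "ennreal (card_marks I Y B \<omega>) = emeasure (count_space (I \<omega>)) {u \<in> I \<omega>. Y \<omega> u \<in> B}" for B
        using finite_subset[OF _ fin[OF \<omega>], of "{u \<in> I \<omega>. Y \<omega> u \<in> B}"]
        by (simp add: emeasure_count_space ennreal_of_nat_eq_real_of_nat)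
      have "{u \<in> I \<omega>. Y \<omega> u \<in> (\<Union>i. A i)} = (\<Union>i. {u \<in> I \<omega>. Y \<omega> u \<in> A i})" by auto
      then show "(\<Sum>i. ennreal (card_marks I Y (A i) \<omega>)) = ennreal (real (card {u \<in> I \<omega>. Y \<omega> u \<in> (\<Union>i. A i)}))"
        unfolding e using A(2) by (simp, intro suminf_emeasure) (auto simp: disjoint_family_on_def)
    qed
    finally show "(\<Sum>i. \<integral>\<^sup>+\<omega>. ennreal (card_marks I Y (A i) \<omega>) \<partial>M) =
      (\<integral>\<^sup>+\<omega>. ennreal (real (card {u \<in> I \<omega>. Y \<omega> u \<in> (\<Union>i. A i)})) \<partial>M)" .
  qed
qed

section \<open>Increments of a Levy process on dyadic grids\<close>

lemma card_cells_sum: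
  fixes d :: real
  assumes d: "0 < d" and fin: "finite {u. real a * d < u \<and> u \<le> real b * d \<and> P u}" and "a \<le> b"
  shows "(\<Sum>i\<in>{a..<b}. card {u \<in> {real i * d<..real (Suc i) * d}. P u}) = card {u. real a * d < u \<and> u \<le> real b * d \<and> P u}"
  using \<open>a \<le> b\<close> fin
proof (induction b rule: dec_induct)
  case (step n)
  have le: "real a * d \<le> real n * d" "real n * d \<le> real (Suc n) * d"
    using d step by (auto intro!: mult_right_mono)
  have split: "{u. real a * d < u \<and> u \<le> real (Suc n) * d \<and> P u} =
     {u. real a * d < u \<and> u \<le> real n * d \<and> P u} \<union> {u \<in> {real n * d<..real (Suc n) * d}. P u}"
    using le by auto
  have "finite {u. real a * d < u \<and> u \<le> real n * d \<and> P u}" "finite {u \<in> {real n * d<..real (Suc n) * d}. P u}"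
    using step.prems unfolding split by auto
  then have "card {u. real a * d < u \<and> u \<le> real (Suc n) * d \<and> P u} =
      card {u. real a * d < u \<and> u \<le> real n * d \<and> P u} + card {u \<in> {real n * d<..real (Suc n) * d}. P u}"
    unfolding split by (intro card_Un_disjoint) auto
  moreover have "(\<Sum>i\<in>{a..<n}. card {u \<in> {real i * d<..real (Suc i) * d}. P u}) = card {u. real a * d < u \<and> u \<le> real n * d \<and> P u}"
    by (rule step.IH) fact
  ultimately show ?case using step.hyps by (simp del: of_nat_Suc)
qed simp

section \<open>Open sets of jump sizes bounded away from 0\<close>

definition open_off_zero :: "real set set" where
  "open_off_zero = {U. open U \<and> (\<exists>e>0. \<forall>y\<in>U. e < \<bar>y\<bar>)}"

text \<open>On a bounded time interval a cadlag path has finitely many jumps with size in a member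
  of \<open>open_off_zero\<close>. These sets reach only Borel sets off 0 and their complements, so
  the point \<open>{0}\<close> is added; it is harmless, since no jump has size 0.\<close>

lemma sets_borel_open_off_zero: "sets borel = sigma_sets UNIV (insert {0} open_off_zero)"
proof (rule antisym)
  have "V \<in> sigma_sets UNIV (insert {0} open_off_zero)" if V: "open V" for V :: "real set"
  proof -
    have "V = (\<Union>l. V \<inter> {y. 1 / real (Suc l) < \<bar>y\<bar>}) \<union> V \<inter> {0}"
    proof -
      have "\<exists>l. 1 / real (Suc l) < \<bar>y\<bar>" if "y \<noteq> 0" for y :: real
        using that nat_approx_posE[of "\<bar>y\<bar>"] by (metis zero_less_abs_iff)
      then show ?thesis by blast
    qed
    moreover have "V \<inter> {y. 1 / real (Suc l) < \<bar>y\<bar>} \<in> open_off_zero" for l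
      unfolding open_off_zero_def using V
      by (auto intro!: open_Int open_Collect_less continuous_intros exI[of _ "1 / real (Suc l)"])
    moreover have "V \<inter> {0} \<in> sigma_sets UNIV (insert {0} open_off_zero)"
      by (cases "0 \<in> V") (auto intro: sigma_sets.intros)
    ultimately show ?thesis
      by (metis (no_types, lifting) sigma_sets.Basic sigma_sets.Union sigma_sets_Un insertCI)
  qed
  then show "sets borel \<subseteq> sigma_sets UNIV (insert {0} open_off_zero)"
    unfolding borel_def by (subst sets_measure_of) (auto intro!: sigma_sets_mono)
  show "sigma_sets UNIV (insert {0} open_off_zero) \<subseteq> sets borel"
  proof -
    have "insert {0} open_off_zero \<subseteq> sets borel" by (auto simp: open_off_zero_def)
    from sets.sigma_sets_subset[OF this] show ?thesis by simp
  qed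
qed

lemma Int_stable_open_off_zero: "Int_stable (insert {0} open_off_zero)"
proof (rule Int_stableI)
  fix A B assume "A \<in> insert {0} open_off_zero" "B \<in> insert {0} open_off_zero"
  moreover have "{} \<in> open_off_zero" by (auto simp: open_off_zero_def intro: exI[of _ 1])
  moreover have "A \<inter> B \<in> open_off_zero" if "A \<in> open_off_zero" "B \<in> open_off_zero"
    using that unfolding open_off_zero_def by (auto intro: open_Int)
  moreover have "A \<inter> {0} = {}" if "A \<in> open_off_zero" for A
    using that by (fastforce simp: open_off_zero_def)
  ultimately show "A \<inter> B \<in> insert {0} open_off_zero" by (metis Int_absorb Int_commute insert_iff)
qed

definition tent :: "real set \<Rightarrow> nat \<Rightarrow> real \<Rightarrow> real" where
  "tent U l y = min 1 (real l * infdist y (- U))"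

lemma isCont_tent: "isCont (tent U l) y"
  unfolding tent_def by (intro continuous_intros)

lemma tent_eq_0: "y \<notin> U \<Longrightarrow> tent U l y = 0"
  by (simp add: tent_def)

text \<open>For \<open>U = UNIV\<close> the tent would vanish, because \<open>infdist\<close> to the
  empty set is 0; hence the second premise.\<close>

lemma tent_tendsto: 
  assumes "open U" "U \<noteq> UNIV"
  shows "(\<lambda>l. tent U l y) \<longlonglongrightarrow> indicator U y"
proof (cases "y \<in> U")
  case True
  have "0 < infdist y (- U)"
    using True assms in_closed_iff_infdist_zero[of "- U" y] infdist_nonneg[of y "- U"]
    by (auto simp: closed_Compl less_le)
  then obtain n where "1 < real n * infdist y (- U)" using reals_Archimedean3 by blast
  then have "tent U l y = 1" if "n \<le> l" for l
    using mult_right_mono[of "real n" "real l" "infdist y (- U)"] that infdist_nonneg[of y "- U"]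
    by (auto simp: tent_def min_def)
  then have "\<forall>\<^sub>F l in sequentially. indicator U y = tent U l y"
    using True by (auto simp: eventually_sequentially)
  then show ?thesis by (rule Lim_transform_eventually[OF tendsto_const])
next
  case False
  then show ?thesis by (simp add: tent_eq_0)
qed

locale dyadic_levy = levy_process M X for M :: "'a measure" and X :: "real \<Rightarrow> 'a \<Rightarrow> real" +
  fixes T :: real
  assumes complete: "complete_measure M" and T_pos: "0 < T"
begin

definition mesh :: "nat \<Rightarrow> real" where "mesh n = T / 2 ^ n"

definition incr :: "nat \<Rightarrow> nat \<Rightarrow> 'a \<Rightarrow> real" where
  "incr n k \<omega> = X (real (Suc k) * mesh n) \<omega> - X (real k * mesh n) \<omega>"

definition cell :: "nat \<Rightarrow> nat \<Rightarrow> real set" where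
  "cell n i = {real i * mesh n<..real (Suc i) * mesh n}"

abbreviation jmp :: "'a \<Rightarrow> real \<Rightarrow> real" where "jmp \<omega> \<equiv> jump (\<lambda>t. X t \<omega>)"

lemma mesh_pos: "0 < mesh n"
  using T_pos by (simp add: mesh_def)

lemma mesh_mult_power: "real (a * 2 ^ n) * mesh (m + n) = real a * mesh m"
  by (simp add: mesh_def power_add)

lemma power_mult_mesh: "real (2 ^ n) * mesh n = T"
  by (simp add: mesh_def)

lemma mesh_tendsto: "mesh \<longlonglongrightarrow> 0"
  unfolding mesh_def using LIMSEQ_divide_realpow_zero[of 2 T] by simp

lemma mesh_add_tendsto: "(\<lambda>n. mesh (m + n)) \<longlonglongrightarrow> 0"
  using LIMSEQ_ignore_initial_segment[OF mesh_tendsto, of m] by (simp add: add.commute)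

lemma incr_measurable [measurable]: "incr n k \<in> borel_measurable M"
  unfolding incr_def using mesh_pos[of n] by (intro borel_measurable_diff random_variable_X) auto

lemma indep_vars_incr: "indep_vars (\<lambda>_. borel) (\<lambda>k. incr n (a + k)) {..<N}"
proof -
  have "indep_vars (\<lambda>_. borel) (\<lambda>i \<omega>. X (real (a + Suc i) * mesh n) \<omega> - X (real (a + i) * mesh n) \<omega>) {..<N}"
    using mesh_pos[of n]
    by (intro independent_increments[of "\<lambda>i. real (a + i) * mesh n"]) (auto intro!: mult_strict_right_mono)
  then show ?thesis unfolding incr_def by simp
qed

lemma distr_incr: "distr M borel (incr n k) = distr M borel (incr n 0)"
proof -
  have "distr M borel (\<lambda>\<omega>. X (real k * mesh n + mesh n) \<omega> - X (real k * mesh n) \<omega>) =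
      distr M borel (\<lambda>\<omega>. X (mesh n) \<omega> - X 0 \<omega>)"
    using mesh_pos[of n] by (intro stationary_increments) auto
  moreover have "real (Suc k) * mesh n = real k * mesh n + mesh n" for k by (simp add: algebra_simps)
  ultimately show ?thesis by (simp add: incr_def[abs_def])
qed

definition incr_sigma :: "nat \<Rightarrow> nat \<Rightarrow> nat \<Rightarrow> 'a set set" where
  "incr_sigma n a b = sigma_sets (space M) (\<Union>k\<in>{a..<b}. {incr n k -` B \<inter> space M | B. B \<in> sets borel})"

lemma incr_sigma_events: "incr_sigma n a b \<subseteq> events"
  unfolding incr_sigma_def by (rule sets.sigma_sets_subset) auto

lemma incr_sigma_Pow: "incr_sigma n a b \<subseteq> Pow (space M)"
  using incr_sigma_events sets.sets_into_space by blast

lemma space_sigma_incr_sigma: "space (sigma (space M) (incr_sigma n a b)) = space M"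
  by (rule space_measure_of[OF incr_sigma_Pow])

lemma sets_sigma_incr_sigma: "sets (sigma (space M) (incr_sigma n a b)) = incr_sigma n a b"
proof -
  have "sigma_sets (space M) (incr_sigma n a b) = incr_sigma n a b"
    unfolding incr_sigma_def by (rule sigma_sets_sigma_sets_eq) auto
  then show ?thesis using incr_sigma_Pow by (simp add: sets_measure_of)
qed

lemma incr_measurable_incr_sigma:
  assumes "a \<le> k" "k < b"
  shows "incr n k \<in> borel_measurable (sigma (space M) (incr_sigma n a b))"
proof (rule measurableI)
  fix B :: "real set" assume "B \<in> sets borel"
  then show "incr n k -` B \<inter> space (sigma (space M) (incr_sigma n a b)) \<in> sets (sigma (space M) (incr_sigma n a b))"
    unfolding space_sigma_incr_sigma sets_sigma_incr_sigma
    unfolding incr_sigma_def using assms by (intro sigma_sets.Basic UN_I[of k]) auto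
qed simp

text \<open>An increment is the sum of the increments over the two halves of its interval. This
  nests the levels of the grid.\<close>

lemma incr_sigma_refine: "incr_sigma n a b \<subseteq> incr_sigma (Suc n) (2 * a) (2 * b)"
  unfolding incr_sigma_def[of n]
proof (rule sigma_algebra.sigma_sets_subset)
  show "sigma_algebra (space M) (incr_sigma (Suc n) (2 * a) (2 * b))"
    unfolding incr_sigma_def by (rule sigma_algebra_sigma_sets) auto
  show "(\<Union>k\<in>{a..<b}. {incr n k -` B \<inter> space M | B. B \<in> sets borel}) \<subseteq> incr_sigma (Suc n) (2 * a) (2 * b)"
  proof safe
    fix k and B :: "real set" assume k: "k \<in> {a..<b}" and B: "B \<in> sets borel"
    let ?S = "sigma (space M) (incr_sigma (Suc n) (2 * a) (2 * b))"
    have [measurable]: "incr (Suc n) (2 * k) \<in> borel_measurable ?S" "incr (Suc n) (Suc (2 * k)) \<in> borel_measurable ?S"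
      using k by (auto intro!: incr_measurable_incr_sigma)
    have "(\<lambda>\<omega>. incr (Suc n) (2 * k) \<omega> + incr (Suc n) (Suc (2 * k)) \<omega>) \<in> borel_measurable ?S" by measurable
    moreover have "(\<lambda>\<omega>. incr (Suc n) (2 * k) \<omega> + incr (Suc n) (Suc (2 * k)) \<omega>) = incr n k"
    proof -
      have e: "real (2 * k) * mesh (Suc n) = real k * mesh n"
        "real (Suc (Suc (2 * k))) * mesh (Suc n) = real (Suc k) * mesh n"
        by (simp_all add: mesh_def field_simps)
      show ?thesis unfolding incr_def e by (rule ext) simp
    qed
    ultimately have "incr n k \<in> borel_measurable ?S" by simp
    from measurable_sets[OF this B] show "incr n k -` B \<inter> space M \<in> incr_sigma (Suc n) (2 * a) (2 * b)"
      unfolding sets_sigma_incr_sigma space_sigma_incr_sigma .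
  qed
qed

lemma indep_set_incr_sigma: "indep_set (incr_sigma n a b) (incr_sigma n b c)"
proof -
  define K where "K t = (if t then {a..<b} else {b..<c})" for t
  have "indep_vars (\<lambda>_. borel) (incr n) {..<b + c}" using indep_vars_incr[of n 0 "b + c"] by simp
  then have "indep_sets (\<lambda>k. {incr n k -` B \<inter> space M | B. B \<in> sets borel}) {..<b + c}"
    by (simp add: indep_vars_def2)
  then have "indep_sets (\<lambda>k. {incr n k -` B \<inter> space M | B. B \<in> sets borel}) (\<Union>t\<in>UNIV. K t)"
    by (rule indep_sets_mono_index[rotated]) (auto simp: K_def split: if_splits)
  then have "indep_sets (\<lambda>t. sigma_sets (space M) (\<Union>k\<in>K t. {incr n k -` B \<inter> space M | B. B \<in> sets borel})) UNIV"
  proof (rule indep_sets_collect_sigma)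
    show "Int_stable {incr n k -` B \<inter> space M | B. B \<in> sets borel}" for k
    proof (rule Int_stableI, safe)
      fix B B' :: "real set" assume "B \<in> sets borel" "B' \<in> sets borel"
      then show "\<exists>C. incr n k -` B \<inter> space M \<inter> (incr n k -` B' \<inter> space M) = incr n k -` C \<inter> space M \<and> C \<in> sets borel"
        by (intro exI[of _ "B \<inter> B'"]) auto
    qed
  qed (auto simp: disjoint_family_on_def K_def)
  moreover have "(\<lambda>t. sigma_sets (space M) (\<Union>k\<in>K t. {incr n k -` B \<inter> space M | B. B \<in> sets borel})) =
      case_bool (incr_sigma n a b) (incr_sigma n b c)"
    by (auto simp: fun_eq_iff K_def incr_sigma_def split: bool.split)
  ultimately show ?thesis unfolding indep_set_def by simp
qed

text \<open>An increasing union over all finer levels. It need not be a sigma-algebra, but two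
  members always lie at a common level; there stability under intersection and independence can be
  checked, and both pass to the generated sigma-algebra.\<close>

definition block :: "nat \<Rightarrow> nat \<Rightarrow> nat \<Rightarrow> 'a set set" where
  "block m a b = (\<Union>n. incr_sigma (m + n) (a * 2 ^ n) (b * 2 ^ n))"

lemma incseq_block: "incseq (\<lambda>n. incr_sigma (m + n) (a * 2 ^ n) (b * 2 ^ n))"
  using incr_sigma_refine[of "m + n" "a * 2 ^ n" "b * 2 ^ n" for n] by (intro incseq_SucI) (simp add: ac_simps)

lemma block_events: "block m a b \<subseteq> events"
  unfolding block_def using incr_sigma_events by blast

lemma empty_in_block: "{} \<in> block m a b"
  unfolding block_def incr_sigma_def by (auto intro: sigma_sets.Empty)

lemma block_common_level:
  assumes "A \<in> block m a b" "B \<in> block m c d"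
  obtains n where "A \<in> incr_sigma (m + n) (a * 2 ^ n) (b * 2 ^ n)" "B \<in> incr_sigma (m + n) (c * 2 ^ n) (d * 2 ^ n)"
proof -
  obtain n1 n2 where "A \<in> incr_sigma (m + n1) (a * 2 ^ n1) (b * 2 ^ n1)" "B \<in> incr_sigma (m + n2) (c * 2 ^ n2) (d * 2 ^ n2)"
    using assms by (auto simp: block_def)
  then show ?thesis
    using that[of "max n1 n2"] incseqD[OF incseq_block, of n1 "max n1 n2" m a b] incseqD[OF incseq_block, of n2 "max n1 n2" m c d]
    by auto
qed

lemma Int_stable_block: "Int_stable (block m a b)"
proof (rule Int_stableI)
  fix A B assume "A \<in> block m a b" "B \<in> block m a b"
  then obtain n where n: "A \<in> incr_sigma (m + n) (a * 2 ^ n) (b * 2 ^ n)" "B \<in> incr_sigma (m + n) (a * 2 ^ n) (b * 2 ^ n)"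
    by (rule block_common_level)
  interpret sigma_algebra "space M" "incr_sigma (m + n) (a * 2 ^ n) (b * 2 ^ n)"
    unfolding incr_sigma_def by (rule sigma_algebra_sigma_sets) auto
  show "A \<inter> B \<in> block m a b" using Int[OF n] by (auto simp: block_def)
qed

lemma indep_set_block: "indep_set (block m a b) (block m b c)"
proof (rule indep_setI)
  fix A B assume "A \<in> block m a b" "B \<in> block m b c"
  then obtain n where "A \<in> incr_sigma (m + n) (a * 2 ^ n) (b * 2 ^ n)" "B \<in> incr_sigma (m + n) (b * 2 ^ n) (c * 2 ^ n)"
    by (rule block_common_level)
  then show "prob (A \<inter> B) = prob A * prob B" by (rule indep_setD[OF indep_set_incr_sigma])
qed (use block_events in auto)

text \<open>The events determined, up to null sets, by the increments of \<open>X\<close> on \<open>[a T / 2\<^sup>m, b T / 2\<^sup>m]\<close>.\<close>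

definition block_algebra :: "nat \<Rightarrow> nat \<Rightarrow> nat \<Rightarrow> 'a measure" where
  "block_algebra m a b = augmented M (block m a b)"

lemma space_block_algebra [simp]: "space (block_algebra m a b) = space M"
  by (simp add: block_algebra_def space_augmented)

lemma null_sets_block_algebra: "null_sets M \<subseteq> sets (block_algebra m a b)"
  unfolding block_algebra_def by (rule null_sets_subset_augmented[OF empty_in_block])

lemma sets_block_algebra_subset: "sets (block_algebra m a b) \<subseteq> events"
  unfolding block_algebra_def by (rule sets_augmented_subset)

lemma measurable_block_algebraD: "f \<in> measurable (block_algebra m a b) N \<Longrightarrow> f \<in> measurable M N"
  by (rule measurable_from_subalg[of M "block_algebra m a b"])
    (unfold subalgebra_def, intro conjI space_block_algebra sets_block_algebra_subset)

lemma indep_block_algebra: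
  "A \<in> sets (block_algebra m a b) \<Longrightarrow> B \<in> sets (block_algebra m b c) \<Longrightarrow> prob (A \<inter> B) = prob A * prob B"
  unfolding block_algebra_def
  by (rule indep_setD[OF indep_set_augmented]) (rule Int_stable_block block_events indep_set_block)+

lemma incr_measurable_block_algebra:
  assumes "a * 2 ^ n \<le> k" "k < b * 2 ^ n"
  shows "incr (m + n) k \<in> borel_measurable (block_algebra m a b)"
proof (rule measurableI)
  fix B :: "real set" assume "B \<in> sets borel"
  then have "incr (m + n) k -` B \<inter> space M \<in> block m a b"
    unfolding block_def incr_sigma_def 
    by (intro UN_I[of n UNIV] sigma_sets.Basic UN_I[of k "{a * 2 ^ n..<b * 2 ^ n}"]) (use assms in auto)
  then show "incr (m + n) k -` B \<inter> space (block_algebra m a b) \<in> sets (block_algebra m a b)"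
    using subset_sets_augmented[OF block_events, of m a b] by (auto simp: block_algebra_def space_augmented)
qed simp

lemmas block_AE_limit = borel_measurable_AE_limit[OF complete space_block_algebra null_sets_block_algebra]
lemmas block_AE_eq = borel_measurable_AE_eq[OF complete space_block_algebra null_sets_block_algebra]

end

section \<open>Jump counts as limits of functions of increments\<close>

context dyadic_levy
begin

text \<open>Two limits connect the next three definitions: \<open>incr_sum\<close> is a function of
  increments and tends almost surely to \<open>jump_sum\<close> as \<open>r\<close> grows; with the
  tents of \<open>U\<close> for \<open>\<psi>\<close>, \<open>jump_sum\<close> tends to
  \<open>jump_count\<close>. Measurability and equality of laws are passed along both. The threshold
  \<open>e\<close> keeps the sum finite.\<close>

definition jump_sum :: "(real \<Rightarrow> real) \<Rightarrow> real \<Rightarrow> nat \<Rightarrow> nat \<Rightarrow> 'a \<Rightarrow> real" where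
  "jump_sum \<psi> e n i \<omega> = (\<Sum>u | u \<in> cell n i \<and> e < \<bar>jmp \<omega> u\<bar>. \<psi> (jmp \<omega> u))"

definition incr_sum :: "(real \<Rightarrow> real) \<Rightarrow> nat \<Rightarrow> nat \<Rightarrow> nat \<Rightarrow> 'a \<Rightarrow> real" where
  "incr_sum \<psi> n i r \<omega> = (\<Sum>k\<in>{i * 2 ^ r..<Suc i * 2 ^ r}. \<psi> (incr (n + r) k \<omega>))"

definition jump_count :: "real set \<Rightarrow> nat \<Rightarrow> nat \<Rightarrow> 'a \<Rightarrow> real" where
  "jump_count U n i \<omega> = real (card {u \<in> cell n i. jmp \<omega> u \<in> U})"

lemma cell_subset: "i < 2 ^ n \<Longrightarrow> cell n i \<subseteq> {0<..T}"
proof -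
  assume "i < 2 ^ n"
  then have "real (Suc i) * mesh n \<le> real (2 ^ n) * mesh n"
    using mesh_pos[of n] by (intro mult_right_mono) (auto simp del: of_nat_power)
  then have "real (Suc i) * mesh n \<le> T" by (simp only: power_mult_mesh)
  moreover have "0 \<le> real i * mesh n" using mesh_pos[of n] by simp
  ultimately show ?thesis unfolding cell_def by (auto simp del: of_nat_Suc)
qed

lemma finite_large_jumps_cell:
  assumes "cadlag_on {0..} (\<lambda>t. X t \<omega>)" "0 < e"
  shows "finite {u \<in> cell n i. e < \<bar>jmp \<omega> u\<bar>}"
proof (rule finite_subset[OF _ finite_large_jumps[OF assms, of "real (Suc i) * mesh n"]])
  have "0 \<le> real i * mesh n" using mesh_pos[of n] by simp
  then show "{u \<in> cell n i. e < \<bar>jmp \<omega> u\<bar>} \<subseteq> {u. 0 < u \<and> u \<le> real (Suc i) * mesh n \<and> e < \<bar>jmp \<omega> u\<bar>}"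
    unfolding cell_def by (auto simp del: of_nat_Suc)
qed

lemma incr_sum_tendsto:
  assumes \<psi>: "\<And>y. isCont \<psi> y" "0 < e" "\<And>y. \<bar>y\<bar> \<le> e \<Longrightarrow> \<psi> y = 0"
  shows "AE \<omega> in M. (\<lambda>r. incr_sum \<psi> n i r \<omega>) \<longlonglongrightarrow> jump_sum \<psi> e n i \<omega>"
  using cadlag_paths
proof eventually_elim
  case (elim \<omega>)
  have "(\<lambda>r. \<Sum>k\<in>{i * 2 ^ r..<Suc i * 2 ^ r}. \<psi> (X (real (Suc k) * mesh (n + r)) \<omega> - X (real k * mesh (n + r)) \<omega>))
     \<longlonglongrightarrow> (\<Sum>u | real i * mesh n < u \<and> u \<le> real (Suc i) * mesh n \<and> e < \<bar>jmp \<omega> u\<bar>. \<psi> (jmp \<omega> u))"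
  proof (rule cadlag_grid_sum_tendsto[OF elim _ \<psi>])
    show "0 \<le> real i * mesh n" using mesh_pos[of n] by simp
    show "\<forall>\<^sub>F r in sequentially. real (i * 2 ^ r) * mesh (n + r) = real i * mesh n \<and>
        real (Suc i * 2 ^ r) * mesh (n + r) = real (Suc i) * mesh n"
      by (simp only: mesh_mult_power) simp
  qed (use mesh_pos mesh_add_tendsto in auto)
  then show ?case unfolding incr_sum_def jump_sum_def incr_def cell_def
    by (simp del: of_nat_Suc add: conj_assoc)
qed

lemma incr_sum_measurable:
  assumes \<psi>: "\<And>y. isCont \<psi> y" and i: "a * 2 ^ r \<le> i" "i < b * 2 ^ r"
  shows "incr_sum \<psi> (m + r) i s \<in> borel_measurable (block_algebra m a b)"
proof -
  have "incr (m + r + s) k \<in> borel_measurable (block_algebra m a b)" if k: "k \<in> {i * 2 ^ s..<Suc i * 2 ^ s}" for k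
  proof -
    have "a * 2 ^ (r + s) \<le> i * 2 ^ s" using i by (simp add: power_add flip: mult.assoc)
    moreover have "Suc i * 2 ^ s \<le> b * 2 ^ (r + s)"
      using i mult_le_mono1[of "Suc i" "b * 2 ^ r" "2 ^ s"] by (simp add: power_add mult.assoc)
    ultimately show ?thesis
      using k incr_measurable_block_algebra[of a "r + s" k b m] by (simp add: add.assoc)
  qed
  moreover have "\<psi> \<in> borel_measurable borel"
    using \<psi> by (intro borel_measurable_continuous_onI) (simp add: continuous_on_eq_continuous_at)
  ultimately show ?thesis unfolding incr_sum_def
    by (intro borel_measurable_sum) (metis measurable_compose)
qed

lemma jump_sum_measurable:
  assumes \<psi>: "\<And>y. isCont \<psi> y" "0 < e" "\<And>y. \<bar>y\<bar> \<le> e \<Longrightarrow> \<psi> y = 0"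
    and i: "a * 2 ^ r \<le> i" "i < b * 2 ^ r"
  shows "jump_sum \<psi> e (m + r) i \<in> borel_measurable (block_algebra m a b)"
  by (rule block_AE_limit[OF incr_sum_measurable[OF \<psi>(1) i] incr_sum_tendsto[OF \<psi>]])

text \<open>The \<open>2 ^ r\<close> increments inside a cell are independent and identically
  distributed, so as a random vector they have the same product law for every cell.\<close>

lemma distr_incr_sum:
  assumes \<psi>: "\<And>y. isCont \<psi> y"
  shows "distr M borel (incr_sum \<psi> n i r) = distr M borel (incr_sum \<psi> n j r)"
proof -
  let ?I = "{..<2 ^ r} :: nat set"
  define V where "V i \<omega> = (\<lambda>k\<in>?I. incr (n + r) (i * 2 ^ r + k) \<omega>)" for i \<omega>
  have V: "distr M (\<Pi>\<^sub>M k\<in>?I. borel) (V i) = (\<Pi>\<^sub>M k\<in>?I. distr M borel (incr (n + r) 0))" for i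
  proof -
    have "?I \<noteq> {}" by (auto simp: lessThan_empty_iff)
    then have "distr M (\<Pi>\<^sub>M k\<in>?I. borel) (V i) = (\<Pi>\<^sub>M k\<in>?I. distr M borel (incr (n + r) (i * 2 ^ r + k)))"
      unfolding V_def using indep_vars_incr[of "n + r" "i * 2 ^ r" "2 ^ r"]
      by (subst (asm) indep_vars_iff_distr_eq_PiM') auto
    also have "\<dots> = (\<Pi>\<^sub>M k\<in>?I. distr M borel (incr (n + r) 0))"
      by (intro PiM_cong refl distr_incr)
    finally show ?thesis .
  qed
  have \<psi>_meas [measurable]: "\<psi> \<in> borel_measurable borel"
    using \<psi> by (intro borel_measurable_continuous_onI) (simp add: continuous_on_eq_continuous_at)
  have "distr M borel (incr_sum \<psi> n i r) = distr (\<Pi>\<^sub>M k\<in>?I. distr M borel (incr (n + r) 0)) borel (\<lambda>x. \<Sum>k\<in>?I. \<psi> (x k))" for i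
  proof -
    have "incr_sum \<psi> n i r = (\<lambda>x. \<Sum>k\<in>?I. \<psi> (x k)) \<circ> V i"
    proof
      fix \<omega>
      have "(\<Sum>k\<in>{i * 2 ^ r..<Suc i * 2 ^ r}. \<psi> (incr (n + r) k \<omega>)) = (\<Sum>k\<in>?I. \<psi> (incr (n + r) (i * 2 ^ r + k) \<omega>))"
        using sum.shift_bounds_nat_ivl[of "\<lambda>k. \<psi> (incr (n + r) k \<omega>)" 0 "i * 2 ^ r" "2 ^ r"]
        by (simp add: add.commute lessThan_atLeast0)
      then show "incr_sum \<psi> n i r \<omega> = ((\<lambda>x. \<Sum>k\<in>?I. \<psi> (x k)) \<circ> V i) \<omega>"
        by (simp add: incr_sum_def V_def)
    qed
    moreover have "(\<lambda>x. \<Sum>k\<in>?I. \<psi> (x k)) \<in> borel_measurable (\<Pi>\<^sub>M k\<in>?I. borel)" by measurable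
    moreover have "V i \<in> measurable M (\<Pi>\<^sub>M k\<in>?I. borel)" unfolding V_def by measurable
    ultimately have "distr M borel (incr_sum \<psi> n i r) = distr (distr M (\<Pi>\<^sub>M k\<in>?I. borel) (V i)) borel (\<lambda>x. \<Sum>k\<in>?I. \<psi> (x k))"
      by (simp add: distr_distr)
    then show ?thesis by (simp only: V)
  qed
  then show ?thesis by simp
qed

lemma incr_sum_measurable_M:
  assumes "\<And>y. isCont \<psi> y" "i < 2 ^ n"
  shows "incr_sum \<psi> n i s \<in> borel_measurable M"
  using measurable_block_algebraD[OF incr_sum_measurable[OF assms(1), where m = 0 and a = 0 and b = 1 and r = n and i = i and s = s]]
    assms(2) by simp

lemma jump_sum_measurable_M:
  assumes "\<And>y. isCont \<psi> y" "0 < e" "\<And>y. \<bar>y\<bar> \<le> e \<Longrightarrow> \<psi> y = 0" "i < 2 ^ n"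
  shows "jump_sum \<psi> e n i \<in> borel_measurable M"
  using measurable_block_algebraD[OF jump_sum_measurable[OF assms(1-3), where m = 0 and a = 0 and b = 1 and r = n and i = i]]
    assms(4) by simp

lemma distr_jump_sum:
  assumes \<psi>: "\<And>y. isCont \<psi> y" "0 < e" "\<And>y. \<bar>y\<bar> \<le> e \<Longrightarrow> \<psi> y = 0" and "i < 2 ^ n" "j < 2 ^ n"
  shows "distr M borel (jump_sum \<psi> e n i) = distr M borel (jump_sum \<psi> e n j)"
  using \<psi> assms(4,5)
  by (intro distr_eq_AE_limit[OF _ _ _ _ distr_incr_sum[OF \<psi>(1)] incr_sum_tendsto[OF \<psi>] incr_sum_tendsto[OF \<psi>]]
      incr_sum_measurable_M jump_sum_measurable_M)

lemma open_off_zeroE: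
  assumes "U \<in> open_off_zero"
  obtains e where "open U" "U \<noteq> UNIV" "0 \<notin> U" "0 < e" "\<And>y. y \<in> U \<Longrightarrow> e < \<bar>y\<bar>"
proof -
  obtain e where e: "open U" "0 < e" "\<And>y. y \<in> U \<Longrightarrow> e < \<bar>y\<bar>"
    using assms unfolding open_off_zero_def by blast
  have "0 \<notin> U" using e(3)[of 0] e(2) by auto
  then show ?thesis using e by (intro that[of e]) auto
qed

lemma jump_sum_tendsto_count:
  assumes U: "open U" "U \<noteq> UNIV" "0 < e" "\<And>y. y \<in> U \<Longrightarrow> e < \<bar>y\<bar>"
  shows "AE \<omega> in M. (\<lambda>l. jump_sum (tent U l) e n i \<omega>) \<longlonglongrightarrow> jump_count U n i \<omega>"
  using cadlag_paths
proof eventually_elim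
  case (elim \<omega>)
  have fin: "finite {u \<in> cell n i. e < \<bar>jmp \<omega> u\<bar>}" by (rule finite_large_jumps_cell[OF elim U(3)])
  have "(\<lambda>l. jump_sum (tent U l) e n i \<omega>) \<longlonglongrightarrow> (\<Sum>u | u \<in> cell n i \<and> e < \<bar>jmp \<omega> u\<bar>. indicator U (jmp \<omega> u))"
    unfolding jump_sum_def by (intro tendsto_sum tent_tendsto U)
  also have "(\<Sum>u | u \<in> cell n i \<and> e < \<bar>jmp \<omega> u\<bar>. indicator U (jmp \<omega> u)) =
      (\<Sum>u | u \<in> cell n i \<and> e < \<bar>jmp \<omega> u\<bar>. if jmp \<omega> u \<in> U then 1 else 0 :: real)"
    by (intro sum.cong) (auto simp: indicator_def)
  also have "\<dots> = jump_count U n i \<omega>"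
  proof -
    have "{u. u \<in> cell n i \<and> e < \<bar>jmp \<omega> u\<bar>} \<inter> {u. jmp \<omega> u \<in> U} = {u \<in> cell n i. jmp \<omega> u \<in> U}"
      using U(4) by auto
    then show ?thesis using fin by (simp add: sum.If_cases jump_count_def)
  qed
  finally show ?case .
qed

lemma tent_off: "(\<And>y. y \<in> U \<Longrightarrow> e < \<bar>y\<bar>) \<Longrightarrow> \<bar>y\<bar> \<le> e \<Longrightarrow> tent U l y = 0"
  by (rule tent_eq_0) force

lemma jump_count_measurable:
  assumes U: "U \<in> open_off_zero" and i: "a * 2 ^ r \<le> i" "i < b * 2 ^ r"
  shows "jump_count U (m + r) i \<in> borel_measurable (block_algebra m a b)"
proof -
  obtain e where e: "open U" "U \<noteq> UNIV" "0 < e" "\<And>y. y \<in> U \<Longrightarrow> e < \<bar>y\<bar>"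
    using open_off_zeroE[OF U] by metis
  show ?thesis
    by (rule block_AE_limit[OF _ jump_sum_tendsto_count[OF e]])
      (rule jump_sum_measurable[OF isCont_tent e(3) tent_off i], rule e(4))
qed

lemma jump_count_measurable_M:
  "U \<in> open_off_zero \<Longrightarrow> i < 2 ^ n \<Longrightarrow> jump_count U n i \<in> borel_measurable M"
  using measurable_block_algebraD[OF jump_count_measurable[where m = 0 and a = 0 and b = 1 and r = n and i = i]]
  by simp

lemma nn_integral_jump_count:
  assumes U: "U \<in> open_off_zero" and ij: "i < 2 ^ n" "j < 2 ^ n"
  shows "(\<integral>\<^sup>+\<omega>. ennreal (jump_count U n i \<omega>) \<partial>M) = (\<integral>\<^sup>+\<omega>. ennreal (jump_count U n j \<omega>) \<partial>M)"
proof -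
  obtain e where e: "open U" "U \<noteq> UNIV" "0 < e" "\<And>y. y \<in> U \<Longrightarrow> e < \<bar>y\<bar>"
    using open_off_zeroE[OF U] by metis
  have meas: "jump_sum (tent U l) e n k \<in> borel_measurable M" if "k < 2 ^ n" for k l
    using that e(4) by (intro jump_sum_measurable_M isCont_tent e(3) tent_off[of U e])
  have [measurable]: "jump_count U n i \<in> borel_measurable M" "jump_count U n j \<in> borel_measurable M"
    using jump_count_measurable_M[OF U] ij by auto
  have "distr M borel (jump_count U n i) = distr M borel (jump_count U n j)"
    by (rule distr_eq_AE_limit[OF meas[OF ij(1)] meas[OF ij(2)] _ _ distr_jump_sum[OF isCont_tent e(3) tent_off ij]
        jump_sum_tendsto_count[OF e] jump_sum_tendsto_count[OF e]]) (use e(4) in auto)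
  then have "(\<integral>\<^sup>+x. ennreal x \<partial>distr M borel (jump_count U n i)) = (\<integral>\<^sup>+x. ennreal x \<partial>distr M borel (jump_count U n j))"
    by simp
  then show ?thesis by (simp add: nn_integral_distr)
qed

definition off_zero :: "nat \<Rightarrow> real set" where "off_zero l = {y. 1 / real (Suc l) < \<bar>y\<bar>}"

abbreviation large_jumps :: "nat \<Rightarrow> 'a \<Rightarrow> real set" where
  "large_jumps l \<omega> \<equiv> {u \<in> {0<..T}. jmp \<omega> u \<in> off_zero l}"

lemma off_zero: "off_zero l \<in> open_off_zero"
  unfolding open_off_zero_def off_zero_def
  by (auto intro!: open_Collect_less continuous_intros exI[of _ "1 / real (Suc l)"])

lemma off_zero_mono: "l \<le> l' \<Longrightarrow> off_zero l \<subseteq> off_zero l'"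
  unfolding off_zero_def using frac_le[of 1 1 "real (Suc l)" "real (Suc l')"] by force

lemma off_zero_UN: "(\<Union>l. off_zero l) = - {0}"
proof -
  have "\<exists>l. 1 / real (Suc l) < \<bar>y\<bar>" if "y \<noteq> 0" for y :: real
    using that nat_approx_posE[of "\<bar>y\<bar>"] by (metis zero_less_abs_iff)
  then show ?thesis by (force simp: off_zero_def)
qed

lemma finite_exhaust_off_zero:
  assumes "finite I" "\<And>u. u \<in> I \<Longrightarrow> y u \<noteq> 0"
  shows "\<exists>l0. \<forall>l\<ge>l0. \<forall>u\<in>I. y u \<in> off_zero l"
proof -
  have "\<forall>u\<in>I. \<exists>l. y u \<in> off_zero l" using assms(2) off_zero_UN by auto
  then obtain l where "\<And>u. u \<in> I \<Longrightarrow> y u \<in> off_zero (l u)" by metis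
  moreover have "off_zero (l u) \<subseteq> off_zero k" if "u \<in> I" "Max (l ` I) \<le> k" for u k
    using that assms(1) by (intro off_zero_mono) (meson Max_ge finite_imageI imageI order_trans)
  ultimately show ?thesis by blast
qed

lemma sum_jump_count:
  assumes "cadlag_on {0..} (\<lambda>t. X t \<omega>)" "U \<in> open_off_zero"
  shows "(\<Sum>i<2 ^ n. jump_count U n i \<omega>) = real (card {u \<in> {0<..T}. jmp \<omega> u \<in> U})"
proof -
  obtain e where e: "0 < e" "\<And>y. y \<in> U \<Longrightarrow> e < \<bar>y\<bar>" using open_off_zeroE[OF assms(2)] by metis
  have T: "real (2 ^ n) * mesh n = T" by (rule power_mult_mesh)
  have "finite {u. 0 < u \<and> u \<le> T \<and> jmp \<omega> u \<in> U}"
    by (rule finite_subset[OF _ finite_large_jumps[OF assms(1) e(1), of T]]) (use e(2) in auto)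
  then have "(\<Sum>i\<in>{0..<2 ^ n}. card {u \<in> {real i * mesh n<..real (Suc i) * mesh n}. jmp \<omega> u \<in> U}) =
    card {u. real 0 * mesh n < u \<and> u \<le> real (2 ^ n) * mesh n \<and> jmp \<omega> u \<in> U}"
    by (intro card_cells_sum mesh_pos) (simp_all only: T, simp_all)
  then have "(\<Sum>i<2 ^ n. card {u \<in> cell n i. jmp \<omega> u \<in> U}) = card {u. 0 < u \<and> u \<le> T \<and> jmp \<omega> u \<in> U}"
    unfolding T cell_def lessThan_atLeast0 by simp
  then show ?thesis
    unfolding jump_count_def by (simp flip: of_nat_sum add: conj_assoc)
qed

text \<open>\<open>\<nu>\<close> counts jumps up to time 1, whereas \<open>T\<close> may be larger.
  At a level \<open>m\<close> with mesh at most 1 the mean over the first cell is at most the mass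
  of \<open>\<nu>\<close>, and by stationarity so is the mean over each of the \<open>2 ^ m\<close>
  cells. The bound is uniform in \<open>l\<close>.\<close>

lemma finite_expected_jumps:
  assumes levy: "is_levy_measure M X \<nu>" and fin: "finite_measure \<nu>"
  obtains B where "B < \<infinity>"
    "\<And>l. (\<integral>\<^sup>+\<omega>. ennreal (real (card (large_jumps l \<omega>))) \<partial>M) \<le> B"
proof -
  obtain m where m: "T / 2 ^ m \<le> 1"
  proof -
    obtain m where "T < 2 ^ m" using real_arch_pow[of 2 T] by auto
    then show ?thesis by (intro that[of m]) simp
  qed
  have "- {0} \<in> sets \<nu>" using levy unfolding is_levy_measure_def by (simp add: sets_restrict_space_iff)
  then have \<nu>: "emeasure \<nu> (- {0}) = (\<integral>\<^sup>+\<omega>. emeasure (jump_measure (\<lambda>t. X t \<omega>)) ({0<..1} \<times> - {0}) \<partial>M)"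
    using levy unfolding is_levy_measure_def by blast
  have "of_nat (2 ^ m) * emeasure \<nu> (- {0}) < \<infinity>"
    using finite_measure.emeasure_finite[OF fin, of "- {0}"]
    by (simp add: ennreal_mult_less_top less_top[symmetric] ennreal_mult_eq_top_iff del: of_nat_power)
  moreover have "(\<integral>\<^sup>+\<omega>. ennreal (real (card (large_jumps l \<omega>))) \<partial>M) \<le> of_nat (2 ^ m) * emeasure \<nu> (- {0})" for l
  proof -
    have first: "(\<integral>\<^sup>+\<omega>. ennreal (jump_count (off_zero l) m 0 \<omega>) \<partial>M) \<le> emeasure \<nu> (- {0})"
      unfolding \<nu>
    proof (rule nn_integral_mono)
      fix \<omega>
      define A where "A = {u \<in> cell m 0. jmp \<omega> u \<in> off_zero l}"
      have "emeasure (jump_measure (\<lambda>t. X t \<omega>)) ({0<..1} \<times> - {0}) =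
          emeasure (count_space UNIV) {t. 0 < t \<and> (t, jmp \<omega> t) \<in> {0<..1} \<times> - {0}}"
        by (rule emeasure_jump_measure) (auto intro!: borel_Times)
      moreover have "emeasure (count_space UNIV) A \<le> emeasure (count_space UNIV) {t. 0 < t \<and> (t, jmp \<omega> t) \<in> {0<..1} \<times> - {0}}"
      proof (rule emeasure_mono)
        show "A \<subseteq> {t. 0 < t \<and> (t, jmp \<omega> t) \<in> {0<..1} \<times> - {0}}"
          using order_trans[OF _ m] off_zero_UN by (auto simp: A_def cell_def mesh_def)
      qed simp
      moreover have "ennreal (real (card A)) \<le> emeasure (count_space UNIV) A"
        by (cases "finite A") (simp_all add: ennreal_of_nat_eq_real_of_nat)
      ultimately show "ennreal (jump_count (off_zero l) m 0 \<omega>) \<le> emeasure (jump_measure (\<lambda>t. X t \<omega>)) ({0<..1} \<times> - {0})"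
        by (simp add: jump_count_def A_def)
    qed
    have "(\<integral>\<^sup>+\<omega>. ennreal (real (card (large_jumps l \<omega>))) \<partial>M) =
        (\<integral>\<^sup>+\<omega>. (\<Sum>i<2 ^ m. ennreal (jump_count (off_zero l) m i \<omega>)) \<partial>M)"
    proof (rule nn_integral_cong_AE, use cadlag_paths in eventually_elim)
      case (elim \<omega>)
      show ?case
        by (subst sum_ennreal) (simp add: jump_count_def, simp only: sum_jump_count[OF elim off_zero])
    qed
    also have "\<dots> = (\<Sum>i<2 ^ m. \<integral>\<^sup>+\<omega>. ennreal (jump_count (off_zero l) m i \<omega>) \<partial>M)"
      using jump_count_measurable_M[OF off_zero] by (intro nn_integral_sum) auto
    also have "\<dots> \<le> (\<Sum>i\<in>{..<2 ^ m :: nat}. emeasure \<nu> (- {0}))"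
    proof (rule sum_mono)
      fix i :: nat assume "i \<in> {..<2 ^ m}"
      then show "(\<integral>\<^sup>+\<omega>. ennreal (jump_count (off_zero l) m i \<omega>) \<partial>M) \<le> emeasure \<nu> (- {0})"
        using nn_integral_jump_count[OF off_zero, of i m 0 l] first by simp
    qed
    finally show ?thesis by simp
  qed
  ultimately show ?thesis by (rule that)
qed

lemma card_off_zero_measurable:
  "(\<lambda>\<omega>. real (card (large_jumps l \<omega>))) \<in> borel_measurable M"
proof -
  have "cell 0 0 = {0<..T}" by (simp add: cell_def mesh_def)
  then show ?thesis
    using jump_count_measurable_M[OF off_zero, of 0 0 l] by (simp add: jump_count_def[abs_def])
qed

text \<open>Fatou for the counts of jumps larger than \<open>1 / real (Suc l)\<close>: their means
  are bounded uniformly in \<open>l\<close>, while infinitely many jumps would drive the counts to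
  infinity.\<close>

lemma AE_finite_jumps:
  assumes levy: "is_levy_measure M X \<nu>" "finite_measure \<nu>"
  shows "AE \<omega> in M. finite {u \<in> {0<..T}. jmp \<omega> u \<noteq> 0}"
proof -
  obtain B where B: "B < \<infinity>"
    "\<And>l. (\<integral>\<^sup>+\<omega>. ennreal (real (card (large_jumps l \<omega>))) \<partial>M) \<le> B"
    by (rule finite_expected_jumps[OF levy]) blast
  define N where "N l \<omega> = ennreal (real (card (large_jumps l \<omega>)))" for l \<omega>
  have [measurable]: "N l \<in> borel_measurable M" for l
    unfolding N_def using card_off_zero_measurable by measurable
  have "(\<integral>\<^sup>+\<omega>. liminf (\<lambda>l. N l \<omega>) \<partial>M) \<le> liminf (\<lambda>l. \<integral>\<^sup>+\<omega>. N l \<omega> \<partial>M)"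
    by (rule nn_integral_liminf) measurable
  also have "\<dots> \<le> B"
    using B(2) by (intro Liminf_le) (auto simp: N_def)
  finally have "(\<integral>\<^sup>+\<omega>. liminf (\<lambda>l. N l \<omega>) \<partial>M) \<noteq> \<infinity>" using B(1) by auto
  then have "AE \<omega> in M. liminf (\<lambda>l. N l \<omega>) \<noteq> \<infinity>"
    by (intro nn_integral_PInf_AE) measurable
  then show ?thesis using cadlag_paths
  proof eventually_elim
    case (elim \<omega>)
    show ?case
    proof (rule ccontr)
      assume inf: "infinite {u \<in> {0<..T}. jmp \<omega> u \<noteq> 0}"
      have "of_nat K \<le> liminf (\<lambda>l. N l \<omega>)" for K :: nat
      proof -
        obtain F where F: "F \<subseteq> {u \<in> {0<..T}. jmp \<omega> u \<noteq> 0}" "finite F" "card F = K"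
          using infinite_arbitrarily_large[OF inf] by metis
        obtain l0 where l0: "\<And>l u. l0 \<le> l \<Longrightarrow> u \<in> F \<Longrightarrow> jmp \<omega> u \<in> off_zero l"
          using finite_exhaust_off_zero[OF F(2), of "jmp \<omega>"] F(1) by blast
        have "of_nat K \<le> N l \<omega>" if "l0 \<le> l" for l
        proof -
          have "finite {u. 0 < u \<and> u \<le> T \<and> 1 / real (Suc l) < \<bar>jmp \<omega> u\<bar>}"
            by (rule finite_large_jumps[OF elim(2)]) simp
          moreover have "large_jumps l \<omega> = {u. 0 < u \<and> u \<le> T \<and> 1 / real (Suc l) < \<bar>jmp \<omega> u\<bar>}"
            by (auto simp: off_zero_def)
          ultimately have "card F \<le> card (large_jumps l \<omega>)"
            using F(1) l0[OF that] by (intro card_mono) auto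
          then show ?thesis unfolding N_def using F(3)
            by (simp flip: ennreal_of_nat_eq_real_of_nat)
        qed
        then show ?thesis by (intro Liminf_bounded) (auto simp: eventually_sequentially)
      qed
      moreover obtain K :: nat where "liminf (\<lambda>l. N l \<omega>) < of_nat K"
        using ennreal_Ex_less_of_nat[of "liminf (\<lambda>l. N l \<omega>)"] elim(1) by (auto simp: less_top)
      ultimately show False by (meson leD)
    qed
  qed
qed

end

section \<open>The jumps of a process of finite activity\<close>

locale finite_activity = dyadic_levy M X T for M :: "'a measure" and X :: "real \<Rightarrow> 'a \<Rightarrow> real" and T :: real +
  fixes \<nu> :: "real measure"
  assumes levy: "is_levy_measure M X \<nu>" and finite_\<nu>: "finite_measure \<nu>"
begin

text \<open>Made empty where the jump set is infinite, which happens only on a null set. Finiteness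
  then holds for every \<open>\<omega>\<close>, as the lemmas on marks require.\<close>

definition jumps :: "'a \<Rightarrow> real set" where
  "jumps \<omega> = (if finite {u \<in> {0<..T}. jmp \<omega> u \<noteq> 0} then {u \<in> {0<..T}. jmp \<omega> u \<noteq> 0} else {})"

lemma finite_jumps: "finite (jumps \<omega>)"
  by (simp add: jumps_def)

lemma jumps_subset: "jumps \<omega> \<subseteq> {0<..T}"
  by (auto simp: jumps_def)

lemma jmp_nonzero: "u \<in> jumps \<omega> \<Longrightarrow> jmp \<omega> u \<noteq> 0"
  by (auto simp: jumps_def split: if_splits)

lemma AE_jumps: "AE \<omega> in M. jumps \<omega> = {u \<in> {0<..T}. jmp \<omega> u \<noteq> 0}"
  using AE_finite_jumps[OF levy finite_\<nu>] by eventually_elim (simp add: jumps_def)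

definition mark_count :: "real set \<Rightarrow> nat \<Rightarrow> nat \<Rightarrow> 'a \<Rightarrow> real" where
  "mark_count A n i \<omega> = real (card {u \<in> jumps \<omega> \<inter> cell n i. jmp \<omega> u \<in> A})"

lemma AE_jump_count_eq:
  assumes U: "U \<in> open_off_zero" and "i < 2 ^ n"
  shows "AE \<omega> in M. jump_count U n i \<omega> = mark_count U n i \<omega>"
  using AE_jumps
proof eventually_elim
  case (elim \<omega>)
  have "0 \<notin> U" using open_off_zeroE[OF U] by metis
  then have "{u \<in> cell n i. jmp \<omega> u \<in> U} = {u \<in> jumps \<omega> \<inter> cell n i. jmp \<omega> u \<in> U}"
    unfolding elim using cell_subset[OF assms(2)] by auto
  then show ?case by (simp add: jump_count_def mark_count_def)
qed

lemma mark_count_zero: "mark_count {0} n i = (\<lambda>_. 0)"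
proof
  fix \<omega>
  have "{u \<in> jumps \<omega> \<inter> cell n i. jmp \<omega> u \<in> {0}} = {}" using jmp_nonzero by auto
  then show "mark_count {0} n i \<omega> = 0" unfolding mark_count_def by (simp only: card.empty of_nat_0)
qed

lemma mark_count_gen_measurable:
  assumes A: "A \<in> insert {0} open_off_zero" and i: "a * 2 ^ r \<le> i" "i < b * 2 ^ r" and b: "b \<le> 2 ^ m"
  shows "mark_count A (m + r) i \<in> borel_measurable (block_algebra m a b)"
proof (cases "A = {0}")
  case True
  then show ?thesis by (simp add: mark_count_zero)
next
  case False
  then have A: "A \<in> open_off_zero" using A by simp
  have "i < 2 ^ (m + r)"
    unfolding power_add by (rule less_le_trans[OF i(2) mult_le_mono1[OF b]])
  then show ?thesis
    by (intro block_AE_eq[OF jump_count_measurable[OF A i]] AE_jump_count_eq[OF A])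
qed

lemma card_off_zero_tendsto:
  assumes "I \<subseteq> jumps \<omega>"
  shows "(\<lambda>l. real (card {u \<in> I. jmp \<omega> u \<in> off_zero l})) \<longlonglongrightarrow> real (card I)"
proof -
  have I: "finite I" using assms finite_jumps finite_subset by blast
  have "\<exists>l0. \<forall>l\<ge>l0. \<forall>u\<in>I. jmp \<omega> u \<in> off_zero l"
    using assms jmp_nonzero by (intro finite_exhaust_off_zero I) auto
  then have "\<forall>\<^sub>F l in sequentially. real (card I) = real (card {u \<in> I. jmp \<omega> u \<in> off_zero l})"
    by (auto simp: eventually_sequentially intro!: arg_cong[where f = card])
  then show ?thesis by (rule Lim_transform_eventually[OF tendsto_const])
qed

text \<open>The total count is not covered by the generator, since \<open>UNIV\<close> is not
  bounded away from 0. It is the limit of the counts in \<open>off_zero l\<close>, eventually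
  constant for each \<open>\<omega>\<close>.\<close>

lemma card_jumps_cell_measurable:
  assumes i: "a * 2 ^ r \<le> i" "i < b * 2 ^ r" and b: "b \<le> 2 ^ m"
  shows "(\<lambda>\<omega>. real (card (jumps \<omega> \<inter> cell (m + r) i))) \<in> borel_measurable (block_algebra m a b)"
proof (rule borel_measurable_LIMSEQ_real)
  show "mark_count (off_zero l) (m + r) i \<in> borel_measurable (block_algebra m a b)" for l
    by (intro mark_count_gen_measurable insertI2 off_zero i b)
  show "(\<lambda>l. mark_count (off_zero l) (m + r) i \<omega>) \<longlonglongrightarrow> real (card (jumps \<omega> \<inter> cell (m + r) i))" for \<omega>
    unfolding mark_count_def by (rule card_off_zero_tendsto) auto
qed

lemma mark_count_measurable:
  assumes A: "A \<in> sets borel" and i: "a * 2 ^ r \<le> i" "i < b * 2 ^ r" and b: "b \<le> 2 ^ m"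
  shows "mark_count A (m + r) i \<in> borel_measurable (block_algebra m a b)"
  unfolding mark_count_def
proof (rule borel_measurable_card_marks)
  show "A \<in> sigma_sets UNIV (insert {0} open_off_zero)" using A by (simp add: sets_borel_open_off_zero)
  show "(\<lambda>\<omega>. real (card {u \<in> jumps \<omega> \<inter> cell (m + r) i. jmp \<omega> u \<in> A})) \<in> borel_measurable (block_algebra m a b)"
    if "A \<in> insert {0} open_off_zero" for A
    using mark_count_gen_measurable[OF that i b] unfolding mark_count_def[abs_def] .
qed (use finite_jumps Int_stable_open_off_zero card_jumps_cell_measurable[OF i b] in auto)

lemma sum_marks_measurable:
  assumes F: "F \<in> borel_measurable borel" and i: "a * 2 ^ r \<le> i" "i < b * 2 ^ r" and b: "b \<le> 2 ^ m"
  shows "(\<lambda>\<omega>. \<Sum>u\<in>jumps \<omega> \<inter> cell (m + r) i. F (jmp \<omega> u) :: real) \<in> borel_measurable (block_algebra m a b)"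
proof (rule borel_measurable_sum_marks[where Y = jmp and N = borel and F = F, OF _ _ _ F])
  show "(\<lambda>\<omega>. real (card {u \<in> jumps \<omega> \<inter> cell (m + r) i. jmp \<omega> u \<in> A})) \<in> borel_measurable (block_algebra m a b)"
    if "A \<in> sets borel" for A
    using mark_count_measurable[OF that i b] unfolding mark_count_def[abs_def] .
qed (use finite_jumps in auto)

lemma cell_0_0: "cell 0 0 = {0<..T}"
  by (simp add: cell_def mesh_def)

lemma mark_count_total: "mark_count A 0 0 \<omega> = real (card {u \<in> jumps \<omega>. jmp \<omega> u \<in> A})"
proof -
  have "jumps \<omega> \<inter> cell 0 0 = jumps \<omega>" using jumps_subset by (auto simp: cell_0_0)
  then show ?thesis by (simp add: mark_count_def)
qed

lemma mark_count_measurable_M: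
  assumes "A \<in> sets borel" "i < 2 ^ n"
  shows "mark_count A n i \<in> borel_measurable M"
  using measurable_block_algebraD[OF mark_count_measurable[OF assms(1), where m = 0 and a = 0 and b = 1 and r = n and i = i]]
    assms(2) by simp

text \<open>The mean measure of the jump sizes over the whole of \<open>(0, T]\<close>; it plays the
  role of \<open>T\<close> times the Levy measure, and it is compensated by the factor
  \<open>1 / T\<close> in \<open>time_measure\<close>.\<close>

definition jump_intensity :: "real measure" where
  "jump_intensity = mark_intensity M jumps jmp borel"

lemma space_jump_intensity [simp]: "space jump_intensity = UNIV"
  and sets_jump_intensity [simp, measurable_cong]: "sets jump_intensity = sets borel"
  by (simp_all add: jump_intensity_def)

lemma emeasure_jump_intensity:
  assumes "A \<in> sets borel"
  shows "emeasure jump_intensity A = (\<integral>\<^sup>+\<omega>. ennreal (mark_count A 0 0 \<omega>) \<partial>M)"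
  unfolding jump_intensity_def mark_count_total
  using mark_count_measurable_M[of _ 0 0] assms
  by (intro emeasure_mark_intensity finite_jumps) (auto simp: mark_count_total[abs_def])

lemma sum_mark_count:
  assumes "a \<le> b" "b \<le> 2 ^ n"
  shows "(\<Sum>i\<in>{a..<b}. mark_count A n i \<omega>) =
    real (card {u \<in> jumps \<omega>. real a * mesh n < u \<and> u \<le> real b * mesh n \<and> jmp \<omega> u \<in> A})"
proof -
  have "(\<Sum>i\<in>{a..<b}. card {u \<in> {real i * mesh n<..real (Suc i) * mesh n}. u \<in> jumps \<omega> \<and> jmp \<omega> u \<in> A}) =
      card {u. real a * mesh n < u \<and> u \<le> real b * mesh n \<and> u \<in> jumps \<omega> \<and> jmp \<omega> u \<in> A}"
    by (rule card_cells_sum[OF mesh_pos _ assms(1)]) (rule finite_subset[OF _ finite_jumps], auto)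
  moreover have "{u \<in> {real i * mesh n<..real (Suc i) * mesh n}. u \<in> jumps \<omega> \<and> jmp \<omega> u \<in> A} =
      {u \<in> jumps \<omega> \<inter> cell n i. jmp \<omega> u \<in> A}" for i
    by (auto simp: cell_def)
  moreover have "{u. real a * mesh n < u \<and> u \<le> real b * mesh n \<and> u \<in> jumps \<omega> \<and> jmp \<omega> u \<in> A} =
      {u \<in> jumps \<omega>. real a * mesh n < u \<and> u \<le> real b * mesh n \<and> jmp \<omega> u \<in> A}" by auto
  ultimately show ?thesis by (simp add: mark_count_def flip: of_nat_sum)
qed

text \<open>By stationarity the \<open>2 ^ n\<close> cells have equal means, and these add up to the
  mean over \<open>(0, T]\<close>. The claim is restricted to the generator, because equality of
  laws between cells is known only there.\<close>

lemma nn_integral_mark_count: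
  assumes A: "A \<in> insert {0} open_off_zero" and i: "i < 2 ^ n"
  shows "(\<integral>\<^sup>+\<omega>. ennreal (mark_count A n i \<omega>) \<partial>M) = ennreal (1 / 2 ^ n) * emeasure jump_intensity A"
proof (cases "A = {0}")
  case True
  then show ?thesis by (simp add: mark_count_zero emeasure_jump_intensity)
next
  case False
  then have A: "A \<in> open_off_zero" using A by simp
  then have borel: "A \<in> sets borel" by (auto simp: open_off_zero_def)
  have eq: "(\<integral>\<^sup>+\<omega>. ennreal (mark_count A n k \<omega>) \<partial>M) = (\<integral>\<^sup>+\<omega>. ennreal (mark_count A n i \<omega>) \<partial>M)" if k: "k < 2 ^ n" for k
  proof -
    have "(\<integral>\<^sup>+\<omega>. ennreal (mark_count A n k \<omega>) \<partial>M) = (\<integral>\<^sup>+\<omega>. ennreal (jump_count A n k \<omega>) \<partial>M)" if "k < 2 ^ n" for k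
      using AE_jump_count_eq[OF A that] by (intro nn_integral_cong_AE) (auto elim!: eventually_mono)
    then show ?thesis using nn_integral_jump_count[OF A k i] k i by simp
  qed
  have "emeasure jump_intensity A = (\<integral>\<^sup>+\<omega>. (\<Sum>k\<in>{0..<2 ^ n :: nat}. ennreal (mark_count A n k \<omega>)) \<partial>M)"
    unfolding emeasure_jump_intensity[OF borel]
  proof (rule nn_integral_cong)
    fix \<omega>
    have "{u \<in> jumps \<omega>. real 0 * mesh n < u \<and> u \<le> real (2 ^ n) * mesh n \<and> jmp \<omega> u \<in> A} = {u \<in> jumps \<omega>. jmp \<omega> u \<in> A}"
      unfolding power_mult_mesh using jumps_subset[of \<omega>] by auto
    then have "mark_count A 0 0 \<omega> = (\<Sum>k\<in>{0..<2 ^ n}. mark_count A n k \<omega>)"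
      using sum_mark_count[of 0 "2 ^ n" n A \<omega>] by (simp only: mark_count_total)
    then show "ennreal (mark_count A 0 0 \<omega>) = (\<Sum>k\<in>{0..<2 ^ n}. ennreal (mark_count A n k \<omega>))"
      by (subst sum_ennreal) (simp_all add: mark_count_def[of A n])
  qed
  also have "\<dots> = (\<Sum>k\<in>{0..<2 ^ n :: nat}. \<integral>\<^sup>+\<omega>. ennreal (mark_count A n k \<omega>) \<partial>M)"
    using mark_count_measurable_M[OF borel] by (intro nn_integral_sum) auto
  also have "\<dots> = (\<Sum>k\<in>{0..<2 ^ n :: nat}. \<integral>\<^sup>+\<omega>. ennreal (mark_count A n i \<omega>) \<partial>M)"
    by (intro sum.cong refl eq) simp
  also have "\<dots> = ennreal (2 ^ n) * (\<integral>\<^sup>+\<omega>. ennreal (mark_count A n i \<omega>) \<partial>M)"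
    by (simp add: ennreal_power flip: ennreal_numeral)
  finally have "ennreal (1 / 2 ^ n) * emeasure jump_intensity A =
      ennreal (1 / 2 ^ n) * ennreal (2 ^ n) * (\<integral>\<^sup>+\<omega>. ennreal (mark_count A n i \<omega>) \<partial>M)"
    by (simp add: mult.assoc)
  then show ?thesis by (simp flip: ennreal_mult)
qed

lemma finite_jump_intensity: "emeasure jump_intensity UNIV < \<infinity>"
proof -
  obtain B where B: "B < \<infinity>"
    "\<And>l. (\<integral>\<^sup>+\<omega>. ennreal (real (card (large_jumps l \<omega>))) \<partial>M) \<le> B"
    by (rule finite_expected_jumps[OF levy finite_\<nu>]) blast
  define N where "N l \<omega> = ennreal (mark_count (off_zero l) 0 0 \<omega>)" for l \<omega>
  have ob: "off_zero l \<in> sets borel" for l using off_zero[of l] by (auto simp: open_off_zero_def)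
  have [measurable]: "N l \<in> borel_measurable M" for l
    unfolding N_def using mark_count_measurable_M[OF ob] by measurable
  have "emeasure jump_intensity UNIV = (\<integral>\<^sup>+\<omega>. liminf (\<lambda>l. N l \<omega>) \<partial>M)"
    unfolding emeasure_jump_intensity[OF space_in_borel]
  proof (rule nn_integral_cong)
    fix \<omega>
    have "(\<lambda>l. N l \<omega>) \<longlonglongrightarrow> ennreal (mark_count UNIV 0 0 \<omega>)"
      unfolding N_def mark_count_total using card_off_zero_tendsto[of "jumps \<omega>" \<omega>]
      by (intro tendsto_ennrealI) simp
    then show "ennreal (mark_count UNIV 0 0 \<omega>) = liminf (\<lambda>l. N l \<omega>)"
      by (simp add: lim_imp_Liminf)
  qed
  also have "\<dots> \<le> liminf (\<lambda>l. \<integral>\<^sup>+\<omega>. N l \<omega> \<partial>M)"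
    by (rule nn_integral_liminf) measurable
  also have "\<dots> \<le> B"
  proof (intro Liminf_le)
    have "(\<integral>\<^sup>+\<omega>. N l \<omega> \<partial>M) \<le> (\<integral>\<^sup>+\<omega>. ennreal (real (card (large_jumps l \<omega>))) \<partial>M)" for l
    proof (rule nn_integral_mono_AE, use AE_jumps in eventually_elim)
      case (elim \<omega>)
      have "0 \<notin> off_zero l" by (simp add: off_zero_def)
      then have "{u \<in> jumps \<omega>. jmp \<omega> u \<in> off_zero l} = large_jumps l \<omega>"
        unfolding elim by auto
      then show ?case by (simp add: N_def mark_count_total)
    qed
    then show "\<forall>\<^sub>F l in sequentially. (\<integral>\<^sup>+\<omega>. N l \<omega> \<partial>M) \<le> B"
      using B(2) order_trans by (intro always_eventually) blast
  qed simp
  finally show ?thesis using B(1) by simp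
qed

lemma finite_measure_jump_intensity: "finite_measure jump_intensity"
  using finite_jump_intensity by (intro finite_measureI) simp

text \<open>The uniform law on \<open>(0, T]\<close> restricted to times after \<open>q\<close>, not
  renormalised: an interval of cells at level \<open>n\<close> gets the number of its cells divided
  by \<open>2 ^ n\<close>.\<close>

definition time_measure :: "real \<Rightarrow> real measure" where
  "time_measure q = density lborel (\<lambda>u. ennreal (1 / T) * indicator {q<..T} u)"

lemma sets_time_measure [simp, measurable_cong]: "sets (time_measure q) = sets borel"
  and space_time_measure [simp]: "space (time_measure q) = UNIV"
  by (simp_all add: time_measure_def)

lemma emeasure_time_measure:
  assumes [measurable]: "S \<in> sets borel"
  shows "emeasure (time_measure q) S = ennreal (1 / T) * emeasure lborel (S \<inter> {q<..T})"
proof -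
  have "emeasure (time_measure q) S = (\<integral>\<^sup>+u. ennreal (1 / T) * indicator {q<..T} u * indicator S u \<partial>lborel)"
    unfolding time_measure_def by (rule emeasure_density) auto
  also have "\<dots> = (\<integral>\<^sup>+u. ennreal (1 / T) * indicator (S \<inter> {q<..T}) u \<partial>lborel)"
    by (intro nn_integral_cong) (auto simp: indicator_def)
  also have "\<dots> = ennreal (1 / T) * emeasure lborel (S \<inter> {q<..T})"
    by (simp add: nn_integral_cmult)
  finally show ?thesis .
qed

lemma finite_measure_time_measure: "finite_measure (time_measure q)"
proof (rule finite_measureI)
  have "emeasure lborel {q<..T} < \<infinity>" by (cases "q \<le> T") auto
  then show "emeasure (time_measure q) (space (time_measure q)) \<noteq> \<infinity>"
    by (simp add: emeasure_time_measure ennreal_mult_eq_top_iff)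
qed

section \<open>Generating boxes and the compensation formula\<close>

definition dyadic_atMost :: "nat \<Rightarrow> real set set" where
  "dyadic_atMost m = {{..real_of_int k * mesh (m + r)} | k r. True}"

text \<open>Every half-line is the intersection of the half-lines ending at its upper dyadic
  roundings. Dyadic end points of level at least \<open>m\<close> matter because after
  \<open>q\<close> the jumps in such a half-line fill whole cells of a grid that also contains
  \<open>q\<close>.\<close>

lemma sets_borel_dyadic_atMost: "sets borel = sigma_sets UNIV (dyadic_atMost m)"
proof (rule antisym)
  have "{..t} \<in> sigma_sets UNIV (dyadic_atMost m)" for t
  proof -
    define d where "d r = real_of_int \<lceil>t / mesh (m + r)\<rceil> * mesh (m + r)" for r
    have d: "t \<le> d r" "d r \<le> t + mesh (m + r)" for r
    proof -
      have me: "0 \<le> mesh (m + r)" using mesh_pos[of "m + r"] by simp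
      have "t / mesh (m + r) \<le> real_of_int \<lceil>t / mesh (m + r)\<rceil>" "real_of_int \<lceil>t / mesh (m + r)\<rceil> \<le> t / mesh (m + r) + 1"
        by linarith+
      from this[THEN mult_right_mono, OF me]
      have "t / mesh (m + r) * mesh (m + r) \<le> d r" "d r \<le> (t / mesh (m + r) + 1) * mesh (m + r)"
        unfolding d_def .
      then show "t \<le> d r" "d r \<le> t + mesh (m + r)"
        using mesh_pos[of "m + r"] by (simp_all add: distrib_right)
    qed
    have "{..t} = (\<Inter>r. {..d r})"
    proof safe
      fix u assume u: "u \<in> (\<Inter>r. {..d r})"
      have "(\<lambda>r. t + mesh (m + r)) \<longlonglongrightarrow> t" using tendsto_add[OF tendsto_const mesh_add_tendsto] by simp
      then show "u \<le> t" by (rule LIMSEQ_le_const) (use u d(2) order_trans in blast)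
    qed (use d(1) order_trans in auto)
    moreover have "{..d r} \<in> sigma_sets UNIV (dyadic_atMost m)" for r
      unfolding dyadic_atMost_def d_def by (intro sigma_sets.Basic) blast
    ultimately show ?thesis by (auto intro!: sigma_sets_Inter)
  qed
  then show "sets borel \<subseteq> sigma_sets UNIV (dyadic_atMost m)"
    unfolding borel_eq_atMost by (subst sets_measure_of) (auto intro!: sigma_sets_mono)
  have "dyadic_atMost m \<subseteq> sets borel" by (auto simp: dyadic_atMost_def)
  from sets.sigma_sets_subset[OF this] show "sigma_sets UNIV (dyadic_atMost m) \<subseteq> sets borel" by simp
qed

definition mark_boxes :: "nat \<Rightarrow> ((real \<times> real) \<times> real) set set" where
  "mark_boxes m = {(C \<times> A) \<times> D | C A D. C \<in> sets borel \<and> A \<in> insert {0} open_off_zero \<and> D \<in> dyadic_atMost m}"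

lemma sets_mark_boxes: "sets ((borel \<Otimes>\<^sub>M borel) \<Otimes>\<^sub>M borel) = sigma_sets UNIV (mark_boxes m)"
proof -
  define E1 where "E1 = {C \<times> A | C A. C \<in> sets (borel :: real measure) \<and> A \<in> insert {0} open_off_zero}"
  have cover: "(\<Union>l. off_zero l) \<union> {0} = UNIV" by (auto simp: off_zero_UN)
  have "sets (borel \<Otimes>\<^sub>M borel :: (real \<times> real) measure) = sets (sigma (space borel \<times> space borel) E1)"
    unfolding E1_def
  proof (rule sets_pair_eq)
    show "countable {UNIV :: real set}" "{UNIV} \<subseteq> sets (borel :: real measure)" "\<Union>{UNIV :: real set} = space borel" by auto
    show "countable (insert {0} (range off_zero))" "insert {0} (range off_zero) \<subseteq> insert {0} open_off_zero"
      "\<Union>(insert {0} (range off_zero)) = space borel"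
      using cover off_zero by auto
  qed (use sets_borel_open_off_zero sets.sigma_sets_eq[of "borel :: real measure"] in auto)
  then have 1: "sets (borel \<Otimes>\<^sub>M borel :: (real \<times> real) measure) = sigma_sets (space (borel \<Otimes>\<^sub>M borel)) E1"
    by (simp add: space_pair_measure sets_measure_of)
  have "sets ((borel \<Otimes>\<^sub>M borel) \<Otimes>\<^sub>M borel :: ((real \<times> real) \<times> real) measure) =
      sets (sigma (space (borel \<Otimes>\<^sub>M borel) \<times> space borel) {a \<times> b | a b. a \<in> E1 \<and> b \<in> dyadic_atMost m})"
  proof (rule sets_pair_eq[OF _ 1])
    show "countable ((\<lambda>A. UNIV \<times> A) ` insert {0} (range off_zero))" by auto
    show "(\<lambda>A. UNIV \<times> A) ` insert {0} (range off_zero) \<subseteq> E1"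
    proof (rule image_subsetI)
      fix A assume "A \<in> insert {0} (range off_zero)"
      then have "A \<in> insert {0} open_off_zero" using off_zero by auto
      then show "UNIV \<times> A \<in> E1" unfolding E1_def using space_in_borel by blast
    qed
    show "\<Union>((\<lambda>A. UNIV \<times> A) ` insert {0} (range off_zero)) = space (borel \<Otimes>\<^sub>M borel)"
      using cover by (auto simp: space_pair_measure)
    show "countable (range (\<lambda>k. {..real_of_int (int k) * mesh (m + 0)}))" by simp
    show "range (\<lambda>k. {..real_of_int (int k) * mesh (m + 0)}) \<subseteq> dyadic_atMost m" unfolding dyadic_atMost_def by blast
    have "\<exists>k. u \<le> real k * mesh m" for u
      using reals_Archimedean3[OF mesh_pos[of m]] by (meson less_imp_le)
    then show "\<Union>(range (\<lambda>k. {..real_of_int (int k) * mesh (m + 0)})) = space borel" by auto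
  qed (use sets_borel_dyadic_atMost in \<open>auto simp: space_pair_measure\<close>)
  moreover have "{a \<times> b | a b. a \<in> E1 \<and> b \<in> dyadic_atMost m} = mark_boxes m"
    unfolding mark_boxes_def E1_def by blast
  ultimately show ?thesis by (simp add: space_pair_measure sets_measure_of)
qed

lemma Int_stable_mark_boxes: "Int_stable (mark_boxes m)"
proof (rule Int_stableI)
  fix P Q assume "P \<in> mark_boxes m" "Q \<in> mark_boxes m"
  then obtain C A D C' A' D' where P: "P = (C \<times> A) \<times> D" "C \<in> sets borel" "A \<in> insert {0} open_off_zero" "D \<in> dyadic_atMost m"
    and Q: "Q = (C' \<times> A') \<times> D'" "C' \<in> sets borel" "A' \<in> insert {0} open_off_zero" "D' \<in> dyadic_atMost m"
    unfolding mark_boxes_def by blast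
  have "D \<inter> D' = D \<or> D \<inter> D' = D'" using P(4) Q(4) by (auto simp: dyadic_atMost_def)
  then have "D \<inter> D' \<in> dyadic_atMost m" using P(4) Q(4) by auto
  moreover have "A \<inter> A' \<in> insert {0} open_off_zero"
    using Int_stable_open_off_zero P(3) Q(3) unfolding Int_stable_def by blast
  moreover have "P \<inter> Q = ((C \<inter> C') \<times> (A \<inter> A')) \<times> (D \<inter> D')" using P(1) Q(1) by auto
  ultimately show "P \<inter> Q \<in> mark_boxes m" unfolding mark_boxes_def using P(2) Q(2) by blast
qed

text \<open>
  Compensation formula: after time \<open>q = j T / 2\<^sup>m\<close> the jump times and sizes have intensity
  Lebesgue times \<open>jump_intensity / T\<close>, independently of a variable \<open>V\<close> determined by the past of \<open>q\<close>.
\<close>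

lemma emeasure_marks_after:
  fixes V :: "'a \<Rightarrow> real"
  assumes V: "V \<in> borel_measurable (block_algebra m 0 j)" and j: "j \<le> 2 ^ m"
    and L: "L \<in> sets ((borel \<Otimes>\<^sub>M borel) \<Otimes>\<^sub>M borel)"
  defines "I \<equiv> \<lambda>\<omega>. {u \<in> jumps \<omega>. real j * mesh m < u}" and "Y \<equiv> \<lambda>\<omega> u. ((V \<omega>, jmp \<omega> u), u)"
  shows "(\<lambda>\<omega>. card_marks I Y L \<omega>) \<in> borel_measurable M"
    and "(\<integral>\<^sup>+\<omega>. ennreal (card_marks I Y L \<omega>) \<partial>M) =
      emeasure ((distr M borel V \<Otimes>\<^sub>M jump_intensity) \<Otimes>\<^sub>M time_measure (real j * mesh m)) L"
proof -
  define q where "q = real j * mesh m"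
  define N where "N = ((borel \<Otimes>\<^sub>M borel) \<Otimes>\<^sub>M borel :: ((real \<times> real) \<times> real) measure)"
  define Q where "Q = (distr M borel V \<Otimes>\<^sub>M jump_intensity) \<Otimes>\<^sub>M time_measure q"
  interpret c: finite_measure jump_intensity by (rule finite_measure_jump_intensity)
  interpret t: finite_measure "time_measure q" by (rule finite_measure_time_measure)
  have V_M [measurable]: "V \<in> borel_measurable M" using V by (rule measurable_block_algebraD)
  have finI: "finite (I \<omega>)" for \<omega> unfolding I_def using finite_jumps by simp
  have box: "(\<lambda>\<omega>. card_marks I Y P \<omega>) \<in> borel_measurable M \<and>
      (\<integral>\<^sup>+\<omega>. ennreal (card_marks I Y P \<omega>) \<partial>M) = emeasure Q P"
    if box: "P \<in> mark_boxes m" for P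
  proof -
    obtain C A D where P: "P = (C \<times> A) \<times> D" and C: "C \<in> sets borel"
      and A: "A \<in> insert {0} open_off_zero" and D: "D \<in> dyadic_atMost m"
      using box unfolding mark_boxes_def by blast
    obtain k r where D: "D = {..real_of_int k * mesh (m + r)}" using D unfolding dyadic_atMost_def by blast
    note P = P[unfolded D]
    have A_borel: "A \<in> sets borel" using A sets_borel_open_off_zero sigma_sets.Basic by blast
    define d where "d = mesh (m + r)"
    have d: "0 < d" unfolding d_def by (rule mesh_pos)
    define a where "a = j * 2 ^ r"
    \<comment> \<open>\<open>k\<close> clipped to the relevant cell indices: at least
      \<open>a\<close>, so that a half-line ending before \<open>q\<close> gives an empty range, and
      at most \<open>2 ^ (m + r)\<close>, since only jumps up to \<open>T\<close> count.\<close>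
    define b where "b = max a (min (nat k) (2 ^ (m + r)))"
    have a: "real a * d = q" unfolding a_def d_def q_def by (rule mesh_mult_power)
    have a_le: "a \<le> 2 ^ (m + r)" unfolding a_def power_add by (rule mult_le_mono1[OF j])
    then have b: "a \<le> b" "b \<le> 2 ^ (m + r)" by (auto simp: b_def)
    have range: "q < u \<and> u \<le> T \<and> u \<le> real_of_int k * d \<longleftrightarrow> q < u \<and> u \<le> real b * d" for u
    proof -
      have T: "T = real (2 ^ (m + r)) * d" unfolding d_def by (rule power_mult_mesh[symmetric])
      have "q < u \<Longrightarrow> u \<le> real_of_int k * d \<longleftrightarrow> u \<le> real (nat k) * d"
      proof (cases "0 \<le> k")
        case False
        assume "q < u"
        moreover have "0 \<le> q" using a d by (simp flip: a)
        moreover have "real_of_int k * d < 0" using False d by (simp add: mult_neg_pos)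
        ultimately show ?thesis using False by auto
      qed auto
      moreover have "real b * d = max q (min (real (nat k) * d) T)"
        unfolding b_def T a[symmetric] using d
        by (simp add: max_mult_distrib_right min_mult_distrib_right of_nat_max of_nat_min del: of_nat_power)
      ultimately show ?thesis by auto
    qed
    define S where "S \<omega> = (\<Sum>i\<in>{a..<b}. mark_count A (m + r) i \<omega>)" for \<omega>
    have count: "card_marks I Y P \<omega> = indicator (V -` C \<inter> space M) \<omega> * S \<omega>" if "\<omega> \<in> space M" for \<omega>
    proof -
      have "{u \<in> I \<omega>. Y \<omega> u \<in> P} = (if V \<omega> \<in> C then {u \<in> jumps \<omega>. real a * d < u \<and> u \<le> real b * d \<and> jmp \<omega> u \<in> A} else {})"
      proof -
        have "u \<le> T" if "u \<in> jumps \<omega>" for u using jumps_subset[of \<omega>] that by auto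
        then show ?thesis
          unfolding I_def Y_def P q_def[symmetric] d_def[symmetric] a using range by auto
      qed
      then show ?thesis using that unfolding S_def d_def by (simp add: sum_mark_count[OF b])
    qed
    \<comment> \<open>Cells with index at least \<open>a\<close> lie after \<open>q\<close>, so
      \<open>S\<close> belongs to the block of the future and \<open>V\<close> to that of the
      past.\<close>
    have "mark_count A (m + r) i \<in> borel_measurable (block_algebra m j (2 ^ m))" if "i \<in> {a..<b}" for i
      using that b by (intro mark_count_measurable A_borel) (auto simp: a_def power_add)
    then have S: "S \<in> borel_measurable (block_algebra m j (2 ^ m))" unfolding S_def by (intro borel_measurable_sum)
    have VC: "V -` C \<inter> space M \<in> sets (block_algebra m 0 j)" using measurable_sets[OF V C] by simp
    have [measurable]: "S \<in> borel_measurable M" "V -` C \<inter> space M \<in> events"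
      using measurable_block_algebraD[OF S] VC sets_block_algebra_subset by auto
    have meas: "(\<lambda>\<omega>. card_marks I Y P \<omega>) \<in> borel_measurable M"
      by (subst measurable_cong[OF count]) measurable
    have "(\<integral>\<^sup>+\<omega>. ennreal (card_marks I Y P \<omega>) \<partial>M) =
        (\<integral>\<^sup>+\<omega>. indicator (V -` C \<inter> space M) \<omega> * ennreal (S \<omega>) \<partial>M)"
      by (intro nn_integral_cong) (simp add: count indicator_def)
    also have "\<dots> = emeasure M (V -` C \<inter> space M) * (\<integral>\<^sup>+\<omega>. ennreal (S \<omega>) \<partial>M)"
    proof (rule nn_integral_indicator_indep[OF sets_block_algebra_subset space_block_algebra])
      show "(\<lambda>\<omega>. ennreal (S \<omega>)) \<in> borel_measurable (block_algebra m j (2 ^ m))" using S by measurable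
      show "prob (V -` C \<inter> space M \<inter> B) = prob (V -` C \<inter> space M) * prob B" if "B \<in> sets (block_algebra m j (2 ^ m))" for B
        by (rule indep_block_algebra[OF VC that])
    qed simp
    also have "(\<integral>\<^sup>+\<omega>. ennreal (S \<omega>) \<partial>M) = (\<Sum>i\<in>{a..<b}. \<integral>\<^sup>+\<omega>. ennreal (mark_count A (m + r) i \<omega>) \<partial>M)"
    proof -
      have "ennreal (S \<omega>) = (\<Sum>i\<in>{a..<b}. ennreal (mark_count A (m + r) i \<omega>))" for \<omega>
        unfolding S_def by (rule sum_ennreal[symmetric]) (simp add: mark_count_def)
      then have "(\<integral>\<^sup>+\<omega>. ennreal (S \<omega>) \<partial>M) = (\<integral>\<^sup>+\<omega>. (\<Sum>i\<in>{a..<b}. ennreal (mark_count A (m + r) i \<omega>)) \<partial>M)" by simp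
      also have "\<dots> = (\<Sum>i\<in>{a..<b}. \<integral>\<^sup>+\<omega>. ennreal (mark_count A (m + r) i \<omega>) \<partial>M)"
        using b mark_count_measurable_M[OF A_borel] by (intro nn_integral_sum) auto
      finally show ?thesis .
    qed
    also have "\<dots> = (\<Sum>i\<in>{a..<b}. ennreal (1 / 2 ^ (m + r)) * emeasure jump_intensity A)"
      using b by (intro sum.cong refl nn_integral_mark_count A) auto
    also have "\<dots> = ennreal (real (b - a) / 2 ^ (m + r)) * emeasure jump_intensity A"
      by (simp add: mult.assoc[symmetric] ennreal_of_nat_eq_real_of_nat flip: ennreal_mult)
    also have "ennreal (real (b - a) / 2 ^ (m + r)) = emeasure (time_measure q) {..real_of_int k * mesh (m + r)}"
    proof -
      have "{..real_of_int k * d} \<inter> {q<..T} = {q<..real b * d}"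
        by (rule set_eqI) (use range in \<open>simp only: Int_iff atMost_iff greaterThanAtMost_iff, blast\<close>)
      moreover have "q \<le> real b * d" using b d a by (metis mult_right_mono of_nat_mono less_imp_le)
      moreover have "real b * d - q = real (b - a) * d" using b(1) by (simp add: a[symmetric] of_nat_diff algebra_simps)
      ultimately have "emeasure (time_measure q) {..real_of_int k * d} = ennreal (1 / T) * ennreal (real (b - a) * d)"
        by (simp add: emeasure_time_measure)
      also have "\<dots> = ennreal (1 / T * (real (b - a) * d))" using T_pos d by (subst ennreal_mult) auto
      also have "1 / T * (real (b - a) * d) = real (b - a) / 2 ^ (m + r)"
        using T_pos by (simp add: d_def mesh_def)
      finally show ?thesis by (simp add: d_def)
    qed
    also have "emeasure M (V -` C \<inter> space M) * (emeasure (time_measure q) {..real_of_int k * mesh (m + r)} * emeasure jump_intensity A)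
        = emeasure Q P"
      unfolding Q_def P using C A_borel
      by (subst t.emeasure_pair_measure_Times, simp_all, subst c.emeasure_pair_measure_Times)
        (simp_all add: emeasure_distr ac_simps)
    finally show ?thesis using meas by blast
  qed
  have L': "L \<in> sets N" using L by (simp add: N_def)
  have total: "(\<lambda>\<omega>. real (card (I \<omega>))) \<in> borel_measurable M"
  proof -
    have "(\<lambda>\<omega>. \<Sum>i\<in>{j..<2 ^ m}. mark_count UNIV m i \<omega>) \<in> borel_measurable M"
      using mark_count_measurable_M[of UNIV _ m] by (intro borel_measurable_sum) auto
    moreover have "(\<Sum>i\<in>{j..<2 ^ m}. mark_count UNIV m i \<omega>) = real (card (I \<omega>))" for \<omega>
    proof -
      have "{u \<in> jumps \<omega>. real j * mesh m < u \<and> u \<le> real (2 ^ m) * mesh m \<and> jmp \<omega> u \<in> UNIV} = I \<omega>"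
        unfolding power_mult_mesh I_def using jumps_subset[of \<omega>] by auto
      then show ?thesis by (simp only: sum_mark_count[OF j order_refl])
    qed
    ultimately show ?thesis by simp
  qed
  have cardm: "(\<lambda>\<omega>. card_marks I Y P \<omega>) \<in> borel_measurable M" if "P \<in> sets N" for P
    by (rule borel_measurable_card_marks[where E = "mark_boxes m" and \<Omega> = UNIV])
      (use that box total finI Int_stable_mark_boxes sets_mark_boxes[of m] in \<open>auto simp: N_def\<close>)
  then show "(\<lambda>\<omega>. card_marks I Y L \<omega>) \<in> borel_measurable M" using L' .
  have em: "emeasure (mark_intensity M I Y N) P = (\<integral>\<^sup>+\<omega>. ennreal (card_marks I Y P \<omega>) \<partial>M)"
    if "P \<in> sets N" for P
    by (rule emeasure_mark_intensity[OF finI cardm that])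
  have sets_Q: "sets Q = sets N"
    unfolding Q_def N_def by (intro sets_pair_measure_cong) simp_all
  have mark_boxes_N: "P \<in> sets N" if "P \<in> mark_boxes m" for P
    using that sets_mark_boxes[of m] by (auto simp: N_def)
  have "mark_intensity M I Y N = Q"
  proof (rule measure_eqI_generator_eq_countable[OF Int_stable_mark_boxes])
    show "mark_boxes m \<subseteq> Pow UNIV" by simp
    show "emeasure (mark_intensity M I Y N) P = emeasure Q P" if "P \<in> mark_boxes m" for P
      using box[OF that] em[OF mark_boxes_N[OF that]] by simp
    show "sets (mark_intensity M I Y N) = sigma_sets UNIV (mark_boxes m)" "sets Q = sigma_sets UNIV (mark_boxes m)"
      using sets_mark_boxes[of m] sets_Q by (simp_all add: N_def)
    \<comment> \<open>The whole space is not a box, since \<open>UNIV\<close> is no admissible set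
      of sizes; a countable cover by boxes takes its place.\<close>
    let ?C = "(\<lambda>(A, k). (UNIV \<times> A) \<times> {..real_of_int (int k) * mesh (m + 0)}) ` (insert {0} (range off_zero) \<times> UNIV)"
    show "countable ?C" by auto
    show C: "?C \<subseteq> mark_boxes m"
    proof (rule image_subsetI, clarify)
      fix A and k :: nat assume "A \<in> insert {0} (range off_zero)"
      then have "A \<in> insert {0} open_off_zero" using off_zero by blast
      moreover have "{..real_of_int (int k) * mesh (m + 0)} \<in> dyadic_atMost m" unfolding dyadic_atMost_def by blast
      ultimately show "(UNIV \<times> A) \<times> {..real_of_int (int k) * mesh (m + 0)} \<in> mark_boxes m"
        unfolding mark_boxes_def using space_in_borel by blast
    qed
    have "\<exists>k. u \<le> real k * mesh m" for u
      using reals_Archimedean3[OF mesh_pos[of m]] by (meson less_imp_le)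
    moreover have "\<exists>A\<in>insert {0} (range off_zero). y \<in> A" for y
      using off_zero_UN by (cases "y = 0") auto
    ultimately have ex: "\<exists>P\<in>?C. w \<in> P" for w
    proof -
      obtain v y u where w: "w = ((v, y), u)" by (metis prod.collapse)
      obtain A k where "A \<in> insert {0} (range off_zero)" "y \<in> A" "u \<le> real k * mesh m"
        using \<open>\<And>u. \<exists>k. u \<le> real k * mesh m\<close> \<open>\<And>y. \<exists>A\<in>insert {0} (range off_zero). y \<in> A\<close> by meson
      then show ?thesis unfolding w by (intro bexI[of _ "(UNIV \<times> A) \<times> {..real_of_int (int k) * mesh (m + 0)}"]) auto
    qed
    show "\<Union>?C = UNIV"
      by (rule UNIV_eq_I[symmetric]) (rule Union_iff[THEN iffD2, OF ex])
    have "emeasure Q (space Q) < \<infinity>"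
    proof -
      interpret V: prob_space "distr M borel V" by (rule prob_space_distr) simp
      have "finite_measure (distr M borel V \<Otimes>\<^sub>M jump_intensity)"
        by (intro finite_measure_pair_measure finite_measure_jump_intensity V.finite_measure_axioms)
      then have "finite_measure Q"
        unfolding Q_def by (intro finite_measure_pair_measure[OF finite_measure_time_measure])
      then show ?thesis by (simp add: finite_measure.emeasure_finite less_top[symmetric])
    qed
    then show "emeasure (mark_intensity M I Y N) P \<noteq> \<infinity>" if "P \<in> ?C" for P
    proof -
      have "P \<in> mark_boxes m" using C that by blast
      then have "emeasure (mark_intensity M I Y N) P = emeasure Q P"
        using box em mark_boxes_N by simp
      also have "\<dots> \<le> emeasure Q (space Q)" by (rule emeasure_space)
      finally show ?thesis using \<open>emeasure Q (space Q) < \<infinity>\<close> by auto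
    qed
  qed
  then show "(\<integral>\<^sup>+\<omega>. ennreal (card_marks I Y L \<omega>) \<partial>M) =
      emeasure ((distr M borel V \<Otimes>\<^sub>M jump_intensity) \<Otimes>\<^sub>M time_measure (real j * mesh m)) L"
    using em[OF L'] by (simp add: Q_def q_def)
qed

text \<open>By the compensation formula the mean number of marks in \<open>L\<close> is the product
  measure of \<open>L\<close>, and this vanishes by integrating over the null time slices. All jumps
  after \<open>q\<close> are covered at once, in particular the last one.\<close>

lemma AE_no_marks_in_null:
  fixes V :: "'a \<Rightarrow> real"
  assumes V: "V \<in> borel_measurable (block_algebra m 0 j)" and j: "j \<le> 2 ^ m"
    and L: "L \<in> sets ((borel \<Otimes>\<^sub>M borel) \<Otimes>\<^sub>M borel)"
    and null: "\<And>p. emeasure lborel (Pair p -` L) = 0"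
  shows "AE \<omega> in M. \<forall>u\<in>jumps \<omega>. real j * mesh m < u \<longrightarrow> ((V \<omega>, jmp \<omega> u), u) \<notin> L"
proof -
  define q where "q = real j * mesh m"
  interpret t: finite_measure "time_measure q" by (rule finite_measure_time_measure)
  have "emeasure (time_measure q) (Pair p -` L) = 0" for p
  proof -
    have [measurable]: "Pair p -` L \<in> sets borel" using L by (rule sets_Pair1)
    have "emeasure lborel (Pair p -` L \<inter> {q<..T}) \<le> emeasure lborel (Pair p -` L)" by (rule emeasure_mono) auto
    then show ?thesis using null[of p] by (simp add: emeasure_time_measure)
  qed
  moreover have "L \<in> sets ((distr M borel V \<Otimes>\<^sub>M jump_intensity) \<Otimes>\<^sub>M time_measure q)"
    using L by (simp cong: sets_pair_measure_cong)
  ultimately have "emeasure ((distr M borel V \<Otimes>\<^sub>M jump_intensity) \<Otimes>\<^sub>M time_measure q) L = 0"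
    by (simp add: t.emeasure_pair_measure_alt)
  then have "(\<integral>\<^sup>+\<omega>. ennreal (real (card {u \<in> {u \<in> jumps \<omega>. real j * mesh m < u}. ((V \<omega>, jmp \<omega> u), u) \<in> L})) \<partial>M) = 0"
    using emeasure_marks_after(2)[OF V j L] by (simp add: q_def)
  then have "AE \<omega> in M. ennreal (real (card {u \<in> {u \<in> jumps \<omega>. real j * mesh m < u}. ((V \<omega>, jmp \<omega> u), u) \<in> L})) = 0"
    using emeasure_marks_after(1)[OF V j L] by (subst (asm) nn_integral_0_iff_AE) auto
  then show ?thesis
  proof eventually_elim
    case (elim \<omega>)
    have "finite {u \<in> {u \<in> jumps \<omega>. real j * mesh m < u}. ((V \<omega>, jmp \<omega> u), u) \<in> L}"
      by (rule finite_subset[OF _ finite_jumps]) auto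
    then have "{u \<in> {u \<in> jumps \<omega>. real j * mesh m < u}. ((V \<omega>, jmp \<omega> u), u) \<in> L} = {}" using elim by simp
    then show ?case by blast
  qed
qed

end

section \<open>The density\<close>

lemma jump_measure_integral:
  fixes F :: "real \<Rightarrow> real \<Rightarrow> real"
  assumes int: "set_integrable (jump_measure p) ({0<..t} \<times> - {0}) (\<lambda>(s, y). F s y)"
    and fin: "finite {u \<in> {0<..t}. jump p u \<noteq> 0}"
  shows "(LINT (s, y):({0<..t} \<times> - {0})|jump_measure p. F s y) =
    (\<Sum>u | u \<in> {0<..t} \<and> jump p u \<noteq> 0. F u (jump p u))"
proof -
  define J where "J = {s. 0 < s \<and> jump p s \<noteq> 0}"
  define R where "R = restrict_space (borel :: (real \<times> real) measure) ({0<..} \<times> - {0})"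
  define H where "H z = indicat_real ({0<..t} \<times> - {0}) z *\<^sub>R (case z of (s, y) \<Rightarrow> F s y)" for z
  have jm: "jump_measure p = distr (count_space J) R (\<lambda>s. (s, jump p s))"
    by (simp add: jump_measure_def J_def R_def)
  have meas: "(\<lambda>s. (s, jump p s)) \<in> measurable (count_space J) R"
    by (auto simp: measurable_count_space_eq1 R_def J_def space_restrict_space)
  have "H \<in> borel_measurable (jump_measure p)"
    using int unfolding set_integrable_def H_def by (rule borel_measurable_integrable)
  then have "H \<in> borel_measurable R" by (simp add: jm)
  then have "(\<integral>z. H z \<partial>jump_measure p) = (\<integral>s. H (s, jump p s) \<partial>count_space J)"
    unfolding jm using meas by (intro integral_distr)
  also have "\<dots> = (\<Sum>s | s \<in> J \<and> H (s, jump p s) \<noteq> 0. H (s, jump p s))"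
    by (rule lebesgue_integral_count_space_finite_support)
      (rule finite_subset[OF _ fin], auto simp: H_def J_def indicator_def split: if_splits)
  also have "\<dots> = (\<Sum>u | u \<in> {0<..t} \<and> jump p u \<noteq> 0. H (u, jump p u))"
    by (rule sum.mono_neutral_left[OF fin]) (auto simp: H_def J_def indicator_def split: if_splits)
  also have "\<dots> = (\<Sum>u | u \<in> {0<..t} \<and> jump p u \<noteq> 0. F u (jump p u))"
    by (intro sum.cong) (auto simp: H_def)
  finally show ?thesis by (simp add: set_lebesgue_integral_def H_def)
qed

lemma bounded_range_abs_le:
  fixes f :: "real \<Rightarrow> real"
  assumes "bounded (f ` A)"
  obtains K where "0 < K" "\<And>a. a \<in> A \<Longrightarrow> \<bar>f a\<bar> \<le> K"
proof -
  obtain K where "\<forall>y\<in>f ` A. norm y \<le> K" "0 < K" using assms bounded_pos by metis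
  then show ?thesis using that[of K] by auto
qed

lemma abs_le_sup_norm_on:
  assumes "bounded (f ` A)" "a \<in> A"
  shows "\<bar>f a\<bar> \<le> sup_norm_on A f"
proof -
  obtain K where K: "0 < K" "\<And>a. a \<in> A \<Longrightarrow> \<bar>f a\<bar> \<le> K" using bounded_range_abs_le[OF assms(1)] by metis
  show ?thesis unfolding sup_norm_on_def
    by (rule cSUP_upper[OF assms(2)]) (use K in \<open>auto intro!: bdd_aboveI2\<close>)
qed

lemma bounded_deriv_lipschitz:
  fixes f :: "real \<Rightarrow> real"
  assumes "\<And>z. f differentiable (at z)" and "\<And>z. \<bar>deriv f z\<bar> \<le> L"
  shows "\<bar>f a - f b\<bar> \<le> L * \<bar>a - b\<bar>"
proof -
  have "(f has_real_derivative deriv f z) (at z)" for z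
    using assms(1)[of z] by (simp add: DERIV_deriv_iff_real_differentiable)
  then show ?thesis
    using field_differentiable_bound[of UNIV f "deriv f" L a b] assms(2) by auto
qed

text \<open>The Lagrange form of the remainder asks for the existence of the second derivative but
  not for its continuity, in keeping with the assumptions on \<open>f\<close>.\<close>

lemma second_order_taylor:
  fixes f :: "real \<Rightarrow> real"
  assumes f: "\<And>z. f differentiable (at z)" and f': "\<And>z. deriv f differentiable (at z)"
  shows "\<exists>\<xi>. f (w + \<eta>) = f w + deriv f w * \<eta> + deriv (deriv f) \<xi> / 2 * \<eta>\<^sup>2"
proof (cases "\<eta> = 0")
  case False
  define D where "D m = (if m = (0::nat) then f else if m = 1 then deriv f else deriv (deriv f))" for m
  have "\<exists>t. (if w + \<eta> < w then w + \<eta> < t \<and> t < w else w < t \<and> t < w + \<eta>) \<and>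
      f (w + \<eta>) = (\<Sum>m<2. D m w / fact m * (w + \<eta> - w) ^ m) + D 2 t / fact 2 * (w + \<eta> - w) ^ 2"
  proof (rule Taylor[where a = "min w (w + \<eta>)" and b = "max w (w + \<eta>)"])
    show "\<forall>m t. m < 2 \<and> min w (w + \<eta>) \<le> t \<and> t \<le> max w (w + \<eta>) \<longrightarrow> (D m has_real_derivative D (Suc m) t) (at t)"
      using f f' by (auto simp: D_def less_2_cases_iff DERIV_deriv_iff_real_differentiable)
  qed (use False in \<open>auto simp: D_def\<close>)
  then show ?thesis by (auto simp: D_def numeral_2_eq_2 ac_simps)
qed auto

text \<open>The Wronskian condition says that moving the jump time moves the state after the jump transversally to the flow.\<close>

lemma wronskian_transversal:
  fixes f g h :: "real \<Rightarrow> real"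
  assumes f: "\<And>z. f differentiable (at z)" and f': "\<And>z. deriv f differentiable (at z)"
    and f'': "bounded (range (deriv (deriv f)))" and g: "bounded (range g)" and h: "bounded (h ` (- {0}))"
    and y: "y \<noteq> 0"
    and W: "\<bar>h y * wronskian g f w\<bar> >
      1 / 2 * sup_norm_on UNIV (deriv (deriv f)) * (sup_norm_on (- {0}) h)\<^sup>2 * (sup_norm_on UNIV g)\<^sup>2"
  shows "(1 + h y * deriv g w) * f w \<noteq> f (w + h y * g w)"
proof
  assume eq: "(1 + h y * deriv g w) * f w = f (w + h y * g w)"
  obtain \<xi> where "f (w + h y * g w) = f w + deriv f w * (h y * g w) + deriv (deriv f) \<xi> / 2 * (h y * g w)\<^sup>2"
    using second_order_taylor[OF f f'] by blast
  \<comment> \<open>Equality cancels the terms \<open>f w\<close> and leaves the Wronskian term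
    equal to the Taylor remainder, whose size is at most the bound that \<open>W\<close>
    exceeds.\<close>
  then have "h y * wronskian g f w = deriv (deriv f) \<xi> / 2 * (h y * g w)\<^sup>2"
    using eq by (simp add: wronskian_def algebra_simps)
  then have "\<bar>h y * wronskian g f w\<bar> = \<bar>deriv (deriv f) \<xi> / 2 * (h y * g w)\<^sup>2\<bar>" by (rule arg_cong)
  also have "\<dots> = \<bar>deriv (deriv f) \<xi>\<bar> / 2 * ((h y)\<^sup>2 * (g w)\<^sup>2)"
    by (simp add: abs_mult power_mult_distrib)
  also have "\<dots> \<le> sup_norm_on UNIV (deriv (deriv f)) / 2 * ((sup_norm_on (- {0}) h)\<^sup>2 * (sup_norm_on UNIV g)\<^sup>2)"
  proof -
    have 1: "\<bar>deriv (deriv f) \<xi>\<bar> \<le> sup_norm_on UNIV (deriv (deriv f))" "\<bar>g w\<bar> \<le> sup_norm_on UNIV g"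
      "\<bar>h y\<bar> \<le> sup_norm_on (- {0}) h"
      using f'' g h y by (auto intro!: abs_le_sup_norm_on)
    then have "(h y)\<^sup>2 \<le> (sup_norm_on (- {0}) h)\<^sup>2" "(g w)\<^sup>2 \<le> (sup_norm_on UNIV g)\<^sup>2"
      by (auto intro: abs_le_square_iff[THEN iffD1] order_trans)
    then show ?thesis using 1 by (intro mult_mono) auto
  qed
  finally show False using W by simp
qed

theorem theorem5p7:
  fixes M :: "'a measure" and X Z :: "real \<Rightarrow> 'a \<Rightarrow> real" and \<nu> :: "real measure"
    and T x :: real and f g h :: "real \<Rightarrow> real"
  assumes "0 < T"
    and "complete_measure M"
    and "levy_process M X"
    and "is_levy_measure M X \<nu>"
    and "finite_measure \<nu>"
    and "\<exists>y\<in>- {0}. h y \<noteq> 0"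
    and "bounded (h ` (- {0}))"
    and "h \<in> borel_measurable \<nu>"
    and "integrable \<nu> (\<lambda>y. (h y)\<^sup>2)"
    and "bounded (range f)"
    and "\<And>z. f differentiable (at z)"
    and "bounded (range (deriv f))"
    and "\<And>z. deriv f differentiable (at z)"
    and "bounded (range (deriv (deriv f)))"
    and "bounded (range g)"
    and "\<And>z. g differentiable (at z)"
    and "bounded (range (deriv g))"
    and "\<And>z y. y \<noteq> 0 \<Longrightarrow>
           \<bar>h y * wronskian g f z\<bar> >
             1 / 2 * sup_norm_on UNIV (deriv (deriv f)) * (sup_norm_on (- {0}) h)\<^sup>2 * (sup_norm_on UNIV g)\<^sup>2"
    and "jump_sde_solution M X T x f g h Z"
  shows "has_density_on M (Z T)
           {\<omega>\<in>space M. emeasure (jump_measure (\<lambda>t. X t \<omega>)) ({0<..T} \<times> (- {0})) > 0}"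
proof -
  interpret levy_process M X by fact
  interpret complete_measure M by fact
  interpret finite_activity M X T \<nu>
    using assms(1-5) by (intro finite_activity.intro dyadic_levy.intro dyadic_levy_axioms.intro finite_activity_axioms.intro)
  obtain K where K: "\<And>a. \<bar>f a\<bar> \<le> K" using bounded_range_abs_le[OF assms(10)] by auto
  obtain L where L: "0 < L" "\<And>a. \<bar>deriv f a\<bar> \<le> L" using bounded_range_abs_le[OF assms(12)] by auto
  obtain Kg where Kg: "\<And>a. \<bar>g a\<bar> \<le> Kg" using bounded_range_abs_le[OF assms(15)] by auto
  obtain Lg where Lg: "\<And>a. \<bar>deriv g a\<bar> \<le> Lg" using bounded_range_abs_le[OF assms(17)] by auto
  obtain H where H: "0 < H" "\<And>y. y \<noteq> 0 \<Longrightarrow> \<bar>h y\<bar> \<le> H" using bounded_range_abs_le[OF assms(7)] by auto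
  interpret ode: bounded_lipschitz f L K
    using K L bounded_deriv_lipschitz[OF assms(11) L(2)] by unfold_locales
  have g_deriv: "(g has_real_derivative deriv g z) (at z)" for z
    using assms(16)[of z] by (simp add: DERIV_deriv_iff_real_differentiable)
  have f_borel [measurable]: "f \<in> borel_measurable borel"
    using ode.isCont_f by (intro borel_measurable_continuous_onI) (simp add: continuous_on_eq_continuous_at)
  have g_borel [measurable]: "g \<in> borel_measurable borel"
    using g_deriv by (intro borel_measurable_continuous_onI) (meson DERIV_isCont continuous_at_imp_continuous_on)
  text \<open>\<open>h\<close> is only measurable off \<open>0\<close>, and its value at \<open>0\<close> is irrelevant.\<close>
  define h' where "h' y = (if y = 0 then 0 else h y)" for y
  have h'_borel [measurable]: "h' \<in> borel_measurable borel"
  proof -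
    have "sets \<nu> = sets (restrict_space borel (- {0}))" using assms(4) by (simp add: is_levy_measure_def)
    then have "h \<in> borel_measurable (restrict_space borel (- {0}))"
      using assms(8) measurable_cong_sets by blast
    then have "(\<lambda>y. indicator (- {0}) y *\<^sub>R h y) \<in> borel_measurable borel"
      by (subst (asm) borel_measurable_restrict_space_iff) auto
    moreover have "(\<lambda>y. indicator (- {0}) y *\<^sub>R h y) = h'" by (auto simp: h'_def fun_eq_iff)
    ultimately show ?thesis by simp
  qed
  have h'_bound: "\<bar>h' y\<bar> \<le> H" for y using H by (simp add: h'_def)
  \<comment> \<open>The stochastic equation becomes a deterministic one for almost every path.
    Replacing \<open>h\<close> by \<open>h'\<close> changes nothing, because no jump has size
    0.\<close>
  have path: "AE \<omega> in M. jump_ode_path f L K g (\<lambda>u. h' (jmp \<omega> u)) (\<lambda>t. Z t \<omega>) x T Lg Kg H (jumps \<omega>)"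
  proof -
    have "AE \<omega> in M. \<forall>t\<in>{0..T}.
           set_integrable lborel {0..t} (\<lambda>s. f (Z s \<omega>)) \<and>
           set_integrable (jump_measure (\<lambda>t. X t \<omega>)) ({0<..t} \<times> (- {0})) (\<lambda>(s, y). h y * g (left_limit (\<lambda>r. Z r \<omega>) s)) \<and>
           Z t \<omega> = x + (LINT s:{0..t}|lborel. f (Z s \<omega>)) +
             (LINT (s, y):({0<..t} \<times> (- {0}))|jump_measure (\<lambda>t. X t \<omega>). h y * g (left_limit (\<lambda>r. Z r \<omega>) s))"
      using assms(19) unfolding jump_sde_solution_def by (auto elim!: eventually_mono)
    then show ?thesis using AE_jumps
    proof eventually_elim
      case (elim \<omega>)
      show ?case
      proof unfold_locales
        show "finite (jumps \<omega>)" "jumps \<omega> \<subseteq> {0<..T}" by (rule finite_jumps jumps_subset)+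
        show "\<bar>g a\<bar> \<le> Kg" "\<bar>h' (jmp \<omega> u)\<bar> \<le> H" for a u by (rule Kg h'_bound)+
        show "\<bar>g a - g b\<bar> \<le> Lg * \<bar>a - b\<bar>" for a b by (rule bounded_deriv_lipschitz[OF assms(16) Lg])
        fix t assume t: "0 \<le> t" "t \<le> T"
        show "set_integrable lborel {0..t} (\<lambda>s. f (Z s \<omega>))" using elim(1) t by simp
        have J: "{u \<in> {0<..t}. jmp \<omega> u \<noteq> 0} = jumps \<omega> \<inter> {..t}" unfolding elim(2) using t by auto
        have "(LINT (s, y):({0<..t} \<times> (- {0}))|jump_measure (\<lambda>t. X t \<omega>). h y * g (left_limit (\<lambda>r. Z r \<omega>) s)) =
            (\<Sum>u | u \<in> {0<..t} \<and> jmp \<omega> u \<noteq> 0. h (jmp \<omega> u) * g (left_limit (\<lambda>r. Z r \<omega>) u))"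
        proof (rule jump_measure_integral)
          show "finite {u \<in> {0<..t}. jmp \<omega> u \<noteq> 0}" unfolding J using finite_jumps by simp
        qed (use elim(1) t in simp)
        also have "\<dots> = (\<Sum>u\<in>jumps \<omega> \<inter> {..t}. h' (jmp \<omega> u) * g (left_limit (\<lambda>r. Z r \<omega>) u))"
          unfolding J by (intro sum.cong refl) (use jmp_nonzero in \<open>simp add: h'_def\<close>)
        finally show "Z t \<omega> = x + (LINT s:{0..t}|lborel. f (Z s \<omega>)) +
            (\<Sum>u\<in>jumps \<omega> \<inter> {..t}. h' (jmp \<omega> u) * g (left_limit (\<lambda>r. Z r \<omega>) u))"
          using elim(1) t by simp
      qed
    qed
  qed
  \<comment> \<open>Adaptedness is a consequence of the equation: the Euler scheme up to
    \<open>q\<close> uses only the jumps before \<open>q\<close>, and it converges to the given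
    solution.\<close>
  have adapted: "Z (real j * mesh m) \<in> borel_measurable (block_algebra m 0 j)" if j: "j \<le> 2 ^ m" for m j
  proof (rule block_AE_limit)
    define S where "S r k \<omega> = (\<Sum>u\<in>jumps \<omega> \<inter> cell (m + r) k. h' (jmp \<omega> u))" for r k \<omega>
    show "(\<lambda>\<omega>. euler_scheme f g (mesh (m + r)) (\<lambda>k. S r k \<omega>) x (j * 2 ^ r)) \<in> borel_measurable (block_algebra m 0 j)" for r
    proof -
      have [measurable]: "S r k \<in> borel_measurable (block_algebra m 0 j)" if "k < j * 2 ^ r" for k
        unfolding S_def using that j by (intro sum_marks_measurable) auto
      have "(\<lambda>\<omega>. euler_scheme f g (mesh (m + r)) (\<lambda>k. S r k \<omega>) x k) \<in> borel_measurable (block_algebra m 0 j)"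
        if "k \<le> j * 2 ^ r" for k
        using that
      proof (induction k)
        case (Suc k)
        then have [measurable]: "(\<lambda>\<omega>. euler_scheme f g (mesh (m + r)) (\<lambda>k. S r k \<omega>) x k) \<in> borel_measurable (block_algebra m 0 j)"
          "S r k \<in> borel_measurable (block_algebra m 0 j)" by simp_all
        show ?case unfolding euler_scheme.simps Let_def by measurable
      qed simp
      then show ?thesis by simp
    qed
    show "AE \<omega> in M. (\<lambda>r. euler_scheme f g (mesh (m + r)) (\<lambda>k. S r k \<omega>) x (j * 2 ^ r)) \<longlonglongrightarrow> Z (real j * mesh m) \<omega>"
      using path
    proof eventually_elim
      case (elim \<omega>)
      have "real j * mesh m \<le> real (2 ^ m) * mesh m"
        using j mesh_pos[of m] by (intro mult_right_mono of_nat_mono) auto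
      then have "real j * mesh m \<le> T" by (simp only: power_mult_mesh)
      then show ?case
        unfolding S_def cell_def
        by (intro jump_ode_path.euler_tendsto[OF elim] mesh_pos mesh_add_tendsto always_eventually allI mesh_mult_power)
    qed
  qed
  show ?thesis unfolding has_density_on_def
  proof (intro ballI impI)
    fix B :: "real set" assume B [measurable]: "B \<in> sets borel" and B0: "emeasure lborel B = 0"
    let ?E = "{\<omega>\<in>space M. Z T \<omega> \<in> B} \<inter>
      {\<omega>\<in>space M. emeasure (jump_measure (\<lambda>t. X t \<omega>)) ({0<..T} \<times> (- {0})) > 0}"
    have B_neg: "negligible B"
      using B B0 by (simp add: negligible_iff_null_sets null_sets_def null_sets_completionI)
    \<comment> \<open>The end value at \<open>T\<close> if the path is at \<open>v\<close> at time
      \<open>q\<close> and has exactly one jump after \<open>q\<close>, of size \<open>y\<close> at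
      time \<open>u\<close>.\<close>
    define kick where "kick q = (\<lambda>((v, y), u). ode.flow (T - u) (ode.flow (u - q) v + h' y * g (ode.flow (u - q) v)))" for q
    \<comment> \<open>Size 0 has to be excluded: without a kick the end value does not depend on
      \<open>u\<close>, so a whole time slice could be mapped into \<open>B\<close>.\<close>
    define Bad where "Bad q = {p :: (real \<times> real) \<times> real. snd (fst p) \<noteq> 0 \<and> kick q p \<in> B}" for q
    have Bad_sets: "Bad q \<in> sets ((borel \<Otimes>\<^sub>M borel) \<Otimes>\<^sub>M borel)" for q
    proof -
      let ?N = "(borel \<Otimes>\<^sub>M borel) \<Otimes>\<^sub>M borel :: ((real \<times> real) \<times> real) measure"
      have [measurable]: "kick q \<in> borel_measurable ?N"
        unfolding kick_def split_beta by measurable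
      have "{p \<in> space ?N. snd (fst p) \<noteq> 0 \<and> kick q p \<in> B} \<in> sets ?N" by measurable
      then show ?thesis by (simp add: Bad_def space_pair_measure)
    qed
    have Bad_null: "emeasure lborel (Pair p -` Bad q) = 0" for p q
    proof -
      obtain v y where p: "p = (v, y)" by (cases p)
      show ?thesis
      proof (cases "y = 0")
        case False
        have "(1 + h y * deriv g z) * f z \<noteq> f (z + h y * g z)" for z
          by (rule wronskian_transversal[OF assms(11,13,14,15,7) False assms(18)[OF False]])
        then have "negligible {u. ode.flow (T - u) (ode.flow (u - q) v + h y * g (ode.flow (u - q) v)) \<in> B}"
          by (rule ode.negligible_flow_kick[OF g_deriv _ B_neg])
        moreover have "Pair p -` Bad q = {u. ode.flow (T - u) (ode.flow (u - q) v + h y * g (ode.flow (u - q) v)) \<in> B}"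
          using False by (auto simp: Bad_def kick_def p h'_def)
        ultimately have "Pair p -` Bad q \<in> null_sets lebesgue" by (simp add: negligible_iff_null_sets)
        moreover have "Pair p -` Bad q \<in> sets lborel" using sets_Pair1[OF Bad_sets] by simp
        ultimately show ?thesis by (simp add: null_sets_def)
      qed (simp add: Bad_def p)
    qed
    \<comment> \<open>One null set for each dyadic time, countably many in all; hence
      \<open>q\<close> may below be chosen depending on \<open>\<omega>\<close>.\<close>
    have "AE \<omega> in M. \<forall>m j. j \<le> 2 ^ m \<longrightarrow> (\<forall>u\<in>jumps \<omega>. real j * mesh m < u \<longrightarrow>
        ((Z (real j * mesh m) \<omega>, jmp \<omega> u), u) \<notin> Bad (real j * mesh m))"
      unfolding AE_all_countable
    proof (intro allI)
      fix m j :: nat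
      show "AE \<omega> in M. j \<le> 2 ^ m \<longrightarrow> (\<forall>u\<in>jumps \<omega>. real j * mesh m < u \<longrightarrow>
          ((Z (real j * mesh m) \<omega>, jmp \<omega> u), u) \<notin> Bad (real j * mesh m))"
      proof (cases "j \<le> 2 ^ m")
        case True
        from AE_no_marks_in_null[OF adapted[OF True] True Bad_sets[of "real j * mesh m"] Bad_null]
        show ?thesis by simp
      qed simp
    qed
    then have "AE \<omega> in M. \<omega> \<notin> ?E"
      using path AE_jumps
    proof eventually_elim
      case (elim \<omega>)
      show ?case
      proof
        assume "\<omega> \<in> ?E"
        then have ZB: "Z T \<omega> \<in> B" and pos: "emeasure (jump_measure (\<lambda>t. X t \<omega>)) ({0<..T} \<times> (- {0})) > 0" by auto
        have "emeasure (jump_measure (\<lambda>t. X t \<omega>)) ({0<..T} \<times> (- {0})) =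
            emeasure (count_space UNIV) {t. 0 < t \<and> (t, jmp \<omega> t) \<in> {0<..T} \<times> (- {0})}"
          by (rule emeasure_jump_measure) (auto intro!: borel_Times)
        also have "{t. 0 < t \<and> (t, jmp \<omega> t) \<in> {0<..T} \<times> (- {0})} = jumps \<omega>" unfolding elim(3) by auto
        finally have ne: "jumps \<omega> \<noteq> {}" using pos by auto
        define u where "u = Max (jumps \<omega>)"
        have u: "u \<in> jumps \<omega>" "\<And>s. s \<in> jumps \<omega> \<Longrightarrow> s \<le> u"
          using ne finite_jumps by (simp_all add: u_def)
        have uT: "0 < u" "u \<le> T" using u(1) jumps_subset[of \<omega>] by auto
        \<comment> \<open>The previous jump time, or 0 if \<open>u\<close> is the only jump.\<close>
        define s where "s = Max (insert 0 (jumps \<omega> - {u}))"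
        have s: "0 \<le> s" "\<And>r. r \<in> jumps \<omega> \<Longrightarrow> r \<noteq> u \<Longrightarrow> r \<le> s" "s < u"
        proof -
          have fin: "finite (insert 0 (jumps \<omega> - {u}))" using finite_jumps by simp
          show "0 \<le> s" "\<And>r. r \<in> jumps \<omega> \<Longrightarrow> r \<noteq> u \<Longrightarrow> r \<le> s" using fin by (simp_all add: s_def)
          have "s \<in> insert 0 (jumps \<omega> - {u})" unfolding s_def using fin by (intro Max_in) auto
          then show "s < u" using uT u(2)[of s] by auto
        qed
        \<comment> \<open>A mesh below the gap between \<open>s\<close> and \<open>u\<close>: the
          cell containing \<open>u\<close> is open on the left, so its left end \<open>q\<close>
          lies strictly between \<open>s\<close> and \<open>u\<close>.\<close>
        obtain m where m: "mesh m < u - s"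
          using order_tendstoD(2)[OF mesh_tendsto, of "u - s"] s(3) by (auto simp: eventually_sequentially)
        define j where "j = nat \<lceil>u / mesh m\<rceil> - 1"
        have "u \<in> {real j * mesh m<..real (Suc j) * mesh m}"
          unfolding j_def by (subst grid_cell_unique[OF mesh_pos uT(1)]) simp
        then have j: "real j * mesh m < u" "u \<le> real j * mesh m + mesh m" by (auto simp: algebra_simps)
        define q where "q = real j * mesh m"
        have sq: "s < q" "q < u" "0 \<le> q" using j m mesh_pos[of m] by (auto simp: q_def)
        have "real j * mesh m < real (2 ^ m) * mesh m" unfolding power_mult_mesh using j uT by linarith
        then have "j \<le> 2 ^ m" using mesh_pos[of m] by (simp add: mult_less_cancel_right_pos del: of_nat_power) 
        then have "((Z q \<omega>, jmp \<omega> u), u) \<notin> Bad q" using elim(1) u(1) sq(2) by (auto simp: q_def)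
        moreover have "jumps \<omega> \<inter> {q<..T} = {u}"
        proof -
          have "r = u" if "r \<in> jumps \<omega>" "q < r" for r using s(2)[OF that(1)] that(2) sq(1) by force
          then have "jumps \<omega> \<inter> {q<..T} \<subseteq> {u}" by (metis IntE greaterThanAtMost_iff singletonI subsetI)
          moreover have "u \<in> jumps \<omega> \<inter> {q<..T}" using u(1) sq uT by simp
          ultimately show ?thesis by blast
        qed
        then have "Z T \<omega> = kick q ((Z q \<omega>, jmp \<omega> u), u)"
          using jump_ode_path.end_value_last_jump[OF elim(2) sq(3,2) uT(2)] by (simp add: kick_def)
        ultimately show False using ZB jmp_nonzero[OF u(1)] by (simp add: Bad_def)
      qed
    qed
    \<comment> \<open>Completeness also supplies the measurability of the event, as a subset of a
      null set.\<close>
    then have "{\<omega> \<in> space M. \<not> \<omega> \<notin> ?E} \<in> null_sets M"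
      by (auto simp: eventually_ae_filter intro: complete2)
    moreover have "{\<omega> \<in> space M. \<not> \<omega> \<notin> ?E} = ?E" by blast
    ultimately show "?E \<in> null_sets M" by simp
  qed
qed

end
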